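(* Let $1\le p,q\le\infty$ and let $u$ (on $\Omega\times\mathbb{C}^n$) and $v$ (on $\mathbb{H}^n$) be non-negative measurable weights such that Pitt's inequality holds, i.e. there is a constant $C_0$ such that for all $g\in\mathcal{S}(\mathbb{H}^n)$, $$\left(\int_{\Omega\times\mathbb{C}^n}|\tilde g(a,w)|^q\,u(a,w)^q\,dw\,d\nu_2(a)\right)^{1/q}\le C_0\left(\int_{\mathbb{H}^n}|g(z,t)|^p\,v(z,t)^p\,dz\,dt\right)^{1/p}.$$ Then there is a constant $C$ such that for all $f\in C_0^\infty(\mathbb{H}^n)$, $$\int_{\mathbb{H}^n}|f(z,t)|^2\,dz\,dt\le C\left(\int_{\Omega\times\mathbb{C}^n}\left|\lambda\,u^{-1}(a,w)\,\tilde f(a,w)\right|^{q'}d\nu_2(a)\,dw\right)^{1/q'}\left(\int_{\mathbb{H}^n}\left|t\,v(z,t)f(z,t)\right|^p\,dz\,dt\right)^{1/p},$$ where $a=(\lambda,(2k+n)|\lambda|)$.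
   Context: The Heisenberg group $\mathbb{H}^n=\mathbb{C}^n\times\mathbb{R}$ ($n\ge1$) has group law $(z,t)(w,s)=(z+w,\,t+s+\frac12\operatorname{Im}(z\cdot\bar w))$, with Lebesgue (Haar) measure $dz\,dt$; $\mathcal{S}(\mathbb{H}^n)$ is the Schwartz space on $\mathbb{C}^n\times\mathbb{R}$ and $C_0^\infty(\mathbb{H}^n)$ the smooth compactly supported functions. For $\delta>-1$, $k\in\{0,1,2,\dots\}$, the Laguerre polynomial is $L_k^\delta(t)=\frac{t^{-\delta}e^t}{k!}\left(\frac{d}{dt}\right)^k(e^{-t}t^{k+\delta})$. For $\lambda\in\mathbb{R}^*=\mathbb{R}\setminus\{0\}$ put $\varphi^{n-1}_{k,\lambda}(z)=L^{n-1}_k(\frac12|\lambda||z|^2)e^{-\frac14|\lambda||z|^2}$ and $e^{n-1}_{k,\lambda}(z,t)=e^{i\lambda t}\varphi^{n-1}_{k,\lambda}(z)$. The Heisenberg fan $\Omega$ is the union of the rays $R_k=\{(\lambda,(2k+n)|\lambda|):\lambda\in\mathbb{R}^*\}$, $k=0,1,2,\dots$, and $R_\infty=\{(0,\tau):\tau\ge0\}$. The Strichartz Fourier transform of $f$ is the function on $\Omega\times\mathbb{C}^n$ given by $\widehat f(a,w)=\int_{\mathbb{H}^n}f(z,t)\,e_a((z,t)^{-1}(w,0))\,dz\,dt$ for $a=(\lambda,(2k+n)|\lambda|)\in R_k$, where $e_a=e^{n-1}_{k,\lambda}$, and $\widehat f(0,\tau,w)=(n-1)!\,2^{n-1}\int_{\mathbb{H}^n}f(z,t)\frac{J_{n-1}(\sqrt\tau|w-z|)}{(\sqrt\tau|w-z|)^{n-1}}\,dz\,dt$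 on $R_\infty$ ($J_{n-1}$ the Bessel function). The normalized transform is $\tilde f(a,w)=\frac{k!(n-1)!}{(k+n-1)!}\widehat f(a,w)$ for $a\in R_k$ and $\tilde f(0,\tau,w)=\widehat f(0,\tau,w)$. The measure $\nu_2$ on $\Omega$ is defined by $$\int_\Omega\phi(a)\,d\nu_2(a)=(2\pi)^{-2n-1}\int_{-\infty}^\infty\left(\sum_{k=0}^\infty\left(\frac{(k+n-1)!}{k!(n-1)!}\right)^2\phi(\lambda,(2k+n)|\lambda|)\right)|\lambda|^{2n}\,d\lambda$$ (so $R_\infty$ is $\nu_2$-null). $q'$ is the Hölder conjugate of $q$; $u^{-1}=1/u$ with $1/0=+\infty$. When an exponent is $\infty$ the corresponding expression is the usual (essential) supremum norm.
   Formalization: Functions f for which the first norm on the right is infinite and the second is 0 are excluded: the product is then the indeterminate ∞·0, and with ∞·0 = 0 the inequality fails (take u = v = 0 and any nonzero f). *)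

theory Defs
  imports
    "HOL-Analysis.Analysis"
    "HOL-Probability.Essential_Supremum"
    "HOL-Computational_Algebra.Polynomial"
begin

section \<open>Smooth functions and Schwartz functions\<close>

definition partial_deriv ::
    "'a::euclidean_space \<Rightarrow> ('a \<Rightarrow> 'b::real_normed_vector) \<Rightarrow> 'a \<Rightarrow> 'b"
  where "partial_deriv b f x = frechet_derivative f (at x) b"

abbreviation iter_partial ::
    "'a::euclidean_space list \<Rightarrow> ('a \<Rightarrow> 'b::real_normed_vector) \<Rightarrow> 'a \<Rightarrow> 'b"
  where "iter_partial bs f \<equiv> foldr partial_deriv bs f"

text \<open>All iterated partial derivatives exist and are again (totally) differentiable, in
  particular continuous; this is the class of infinitely differentiable functions.\<close>

definition smooth :: "('a::euclidean_space \<Rightarrow> 'b::real_normed_vector) \<Rightarrow> bool"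
  where "smooth f \<longleftrightarrow> (\<forall>bs \<in> lists Basis. iter_partial bs f differentiable_on UNIV)"

definition schwartz :: "('a::euclidean_space \<Rightarrow> complex) set"
  where "schwartz = {f. smooth f \<and>
    (\<forall>bs \<in> lists Basis. \<forall>N::nat. \<exists>B::real. \<forall>x. (1 + norm x) ^ N * norm (iter_partial bs f x) \<le> B)}"

definition test_functions :: "('a::euclidean_space \<Rightarrow> complex) set"
  where "test_functions = {f. smooth f \<and> compact (closure {x. f x \<noteq> 0})}"

section \<open>Weighted Lebesgue norms\<close>

definition ennreal_powr :: "ennreal \<Rightarrow> real \<Rightarrow> ennreal"
  where "ennreal_powr x r = (if x = \<infinity> then \<infinity> else ennreal (enn2real x powr r))"

text \<open>The integrand is extended-valued because weights may occur as \<open>inverse u\<close> with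
  \<open>inverse 0 = \<infinity>\<close>. Inside an integrand the measure-theoretic convention \<open>0 * \<infinity> = 0\<close> of
  \<^typ>\<open>ennreal\<close> is the intended one. A product of two norms of the form \<open>0 * \<infinity>\<close>, however, is
  indeterminate, and must not be read as \<open>0\<close>.\<close>

definition Lp_norm :: "'a measure \<Rightarrow> ennreal \<Rightarrow> ('a \<Rightarrow> ennreal) \<Rightarrow> ennreal"
  where "Lp_norm M p F =
    (if p = \<infinity> then esssup M F
     else ennreal_powr (\<integral>\<^sup>+x. ennreal_powr (F x) (enn2real p) \<partial>M) (1 / enn2real p))"

section \<open>Laguerre polynomials and Bessel functions\<close>

definition rodrigues :: "nat \<Rightarrow> real \<Rightarrow> real \<Rightarrow> real"
  where "rodrigues k d t =
    t powr (- d) * exp t / fact k * (deriv ^^ k) (\<lambda>s. exp (- s) * s powr (real k + d)) t"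

text \<open>Since \<open>0 powr d = 0\<close>, the Rodrigues expression is meaningful for positive arguments only;
  the Laguerre polynomial is the polynomial which it represents there.\<close>

definition laguerre :: "nat \<Rightarrow> real \<Rightarrow> real poly"
  where "laguerre k d = (THE P. \<forall>t>0. poly P t = rodrigues k d t)"

lemma deriv_iter_exp_powr:
  "\<exists>P. \<forall>t>0. (deriv ^^ j) (\<lambda>s::real. exp (- s) * s powr a) t = exp (- t) * t powr (a - real j) * poly P t"
proof (induction j)
  case 0
  show ?case by (rule exI[of _ 1]) simp
next
  case (Suc j)
  let ?g = "\<lambda>s::real. exp (- s) * s powr a"
  from Suc obtain P where
    P: "\<And>t. t > 0 \<Longrightarrow> (deriv ^^ j) ?g t = exp (- t) * t powr (a - real j) * poly P t" by blast
  define Q where "Q = [:a - real j, - 1:] * P + [:0, 1:] * pderiv P"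
  have "(deriv ^^ Suc j) ?g t = exp (- t) * t powr (a - real (Suc j)) * poly Q t"
    if t: "t > 0" for t
  proof -
    have ev: "\<forall>\<^sub>F s in nhds t. (deriv ^^ j) ?g s = exp (- s) * s powr (a - real j) * poly P s"
      by (rule eventually_mono[OF eventually_nhds_in_open[of "{0<..}" t]]) (use t P in auto)
    have pw: "t powr (a - real j) = t * t powr (a - real j - 1)"
      using t by (simp add: powr_diff)
    have "((\<lambda>s. exp (- s) * s powr (a - real j) * poly P s) has_field_derivative
        exp (- t) * t powr (a - real (Suc j)) * poly Q t) (at t)"
      using t
      by (auto intro!: derivative_eq_intros simp: Q_def pw algebra_simps)
    then have "deriv (\<lambda>s. exp (- s) * s powr (a - real j) * poly P s) t =
        exp (- t) * t powr (a - real (Suc j)) * poly Q t"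
      by (rule DERIV_imp_deriv)
    with deriv_cong_ev[OF ev refl] show ?thesis by simp
  qed
  then show ?case by blast
qed

lemma poly_laguerre:
  assumes "t > 0"
  shows "poly (laguerre k d) t = rodrigues k d t"
proof -
  obtain P where P: "\<And>t. t > 0 \<Longrightarrow> (deriv ^^ k) (\<lambda>s::real. exp (- s) * s powr (real k + d)) t
      = exp (- t) * t powr (real k + d - real k) * poly P t"
    using deriv_iter_exp_powr[of k "real k + d"] by blast
  have ex: "\<forall>t>0. poly (smult (1 / fact k) P) t = rodrigues k d t"
  proof (intro allI impI)
    fix t :: real assume t: "t > 0"
    have "rodrigues k d t = (t powr (- d) * t powr d) * (exp t * exp (- t)) * poly P t / fact k"
      unfolding rodrigues_def P[OF t] by simp
    also have "t powr (- d) * t powr d = 1"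
      using t by (simp add: powr_add[symmetric])
    also have "exp t * exp (- t) = 1"
      by (simp add: exp_minus)
    finally show "poly (smult (1 / fact k) P) t = rodrigues k d t" by simp
  qed
  have "\<exists>!P. \<forall>t>0. poly P t = rodrigues k d t"
  proof (rule ex1I[of _ "smult (1 / fact k) P"], fact ex)
    fix Q assume Q: "\<forall>t>0. poly Q t = rodrigues k d t"
    have "{0<..} \<subseteq> {t. poly (Q - smult (1 / fact k) P) t = 0}"
    proof
      fix t :: real assume "t \<in> {0<..}"
      then have t: "t > 0" by simp
      show "t \<in> {t. poly (Q - smult (1 / fact k) P) t = 0}"
        unfolding mem_Collect_eq poly_diff using Q[rule_format, OF t] ex[rule_format, OF t] by simp
    qed
    then have "infinite {t. poly (Q - smult (1 / fact k) P) t = 0}"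
      by (rule infinite_super) (rule infinite_Ioi)
    with poly_roots_finite[of "Q - smult (1 / fact k) P"] show "Q = smult (1 / fact k) P"
      by (metis right_minus_eq)
  qed
  from theI'[OF this] have "\<forall>t>0. poly (laguerre k d) t = rodrigues k d t"
    unfolding laguerre_def .
  with assms show ?thesis by simp
qed

definition bessel_J :: "nat \<Rightarrow> real \<Rightarrow> real"
  where "bessel_J m s = (\<Sum>j. (- 1) ^ j / (fact j * fact (j + m)) * (s / 2) ^ (2 * j + m))"

text \<open>\<open>J\<^sub>m(s) / s\<^sup>m\<close>, continued to the removable singularity at \<open>s = 0\<close>.\<close>

definition bessel_quotient :: "nat \<Rightarrow> real \<Rightarrow> real"
  where "bessel_quotient m s = (if s = 0 then 1 / (2 ^ m * fact m) else bessel_J m s / s ^ m)"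

section \<open>The Heisenberg group\<close>

type_synonym 'n heis = "(complex ^ 'n) \<times> real"

definition heis_mult :: "'n::finite heis \<Rightarrow> 'n heis \<Rightarrow> 'n heis"
  where "heis_mult x y =
    (fst x + fst y, snd x + snd y + 1 / 2 * Im (\<Sum>i\<in>UNIV. fst x $ i * cnj (fst y $ i)))"

definition heis_inv :: "'n::finite heis \<Rightarrow> 'n heis"
  where "heis_inv x = (- fst x, - snd x)"

lemma heis_mult_inv: "heis_mult (heis_inv x) x = (0, 0)" "heis_mult x (heis_inv x) = (0, 0)"
  by (simp_all add: heis_mult_def heis_inv_def sum_negf complex_mult_cnj)

definition laguerre_fun :: "nat \<Rightarrow> real \<Rightarrow> complex ^ 'n::finite \<Rightarrow> real"
  where "laguerre_fun k l z =
    poly (laguerre k (real CARD('n) - 1)) (1 / 2 * \<bar>l\<bar> * (norm z)\<^sup>2) * exp (- (1 / 4 * \<bar>l\<bar> * (norm z)\<^sup>2))"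

definition heis_e :: "nat \<Rightarrow> real \<Rightarrow> 'n::finite heis \<Rightarrow> complex"
  where "heis_e k l x = exp (\<i> * of_real (l * snd x)) * of_real (laguerre_fun k l (fst x))"

section \<open>The Heisenberg fan and the measure on it\<close>

definition fan_ray :: "nat \<Rightarrow> nat \<Rightarrow> (real \<times> real) set"
  where "fan_ray n k = {(l, (2 * real k + real n) * \<bar>l\<bar>) | l. l \<noteq> 0}"

definition fan_limit_ray :: "(real \<times> real) set"
  where "fan_limit_ray = {(0, \<tau>) | \<tau>. 0 \<le> \<tau>}"

definition fan :: "nat \<Rightarrow> (real \<times> real) set"
  where "fan n = (\<Union>k. fan_ray n k) \<union> fan_limit_ray"

definition fan_index :: "nat \<Rightarrow> real \<times> real \<Rightarrow> nat"
  where "fan_index n a = (THE k. a \<in> fan_ray n k)"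

lemma fan_index_eq: "a \<in> fan_ray n k \<Longrightarrow> fan_index n a = k"
  unfolding fan_index_def by (rule the_equality) (auto simp: fan_ray_def)

definition fan_mult :: "nat \<Rightarrow> nat \<Rightarrow> real"
  where "fan_mult n k = fact (k + n - 1) / (fact k * fact (n - 1))"

text \<open>The measure is the image, under \<open>(k, l) \<mapsto> (l, (2k+n)|l|)\<close>, of a weighted product of counting
  measure and Lebesgue measure; the lemma below gives its defining integration formula.\<close>

definition nu2 :: "nat \<Rightarrow> (real \<times> real) measure"
  where "nu2 n = distr
    (density (count_space UNIV \<Otimes>\<^sub>M lborel)
      (\<lambda>(k, l). ennreal ((fan_mult n k)\<^sup>2 * \<bar>l\<bar> ^ (2 * n) / (2 * pi) ^ (2 * n + 1))))
    (restrict_space borel (fan n))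
    (\<lambda>(k, l). (l, (2 * real k + real n) * \<bar>l\<bar>))"

lemma fan_param_in: "(l, (2 * real k + real n) * \<bar>l\<bar>) \<in> fan n"
  by (cases "l = 0") (auto simp: fan_def fan_ray_def fan_limit_ray_def)

lemma nn_integral_nu2:
  assumes \<phi>: "\<phi> \<in> borel_measurable (restrict_space borel (fan n))"
  shows "(\<integral>\<^sup>+a. \<phi> a \<partial>nu2 n) = ennreal (1 / (2 * pi) ^ (2 * n + 1)) *
    (\<integral>\<^sup>+l. (\<Sum>k. ennreal ((fan_mult n k)\<^sup>2) * \<phi> (l, (2 * real k + real n) * \<bar>l\<bar>))
       * ennreal (\<bar>l\<bar> ^ (2 * n)) \<partial>lborel)"
proof -
  interpret C: sigma_finite_measure "count_space (UNIV :: nat set)"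
    by (rule sigma_finite_measure_count_space)
  interpret P: pair_sigma_finite "count_space (UNIV :: nat set)" "lborel :: real measure" ..
  let ?g = "\<lambda>(k, l). (l, (2 * real k + real n) * \<bar>l\<bar>)"
  let ?d = "\<lambda>(k, l::real). ennreal ((fan_mult n k)\<^sup>2 * \<bar>l\<bar> ^ (2 * n) / (2 * pi) ^ (2 * n + 1))"
  have g: "?g \<in> (count_space UNIV \<Otimes>\<^sub>M lborel) \<rightarrow>\<^sub>M restrict_space borel (fan n)"
    by (rule measurable_restrict_space2) (auto simp: fan_param_in)
  have d[measurable]: "?d \<in> borel_measurable (count_space UNIV \<Otimes>\<^sub>M lborel)"
    by measurable
  have \<phi>g[measurable]: "(\<lambda>x. \<phi> (?g x)) \<in> borel_measurable (count_space UNIV \<Otimes>\<^sub>M lborel)"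
    by (rule measurable_compose[OF g \<phi>])
  have \<phi>k[measurable]: "(\<lambda>l. \<phi> (l, (2 * real k + real n) * \<bar>l\<bar>)) \<in> borel_measurable lborel" for k
    using measurable_compose[OF measurable_Pair1' \<phi>g, of k] by simp
  have eq: "?d (k, l) * \<phi> (?g (k, l)) = ennreal (1 / (2 * pi) ^ (2 * n + 1)) *
      ((ennreal ((fan_mult n k)\<^sup>2) * \<phi> (l, (2 * real k + real n) * \<bar>l\<bar>)) * ennreal (\<bar>l\<bar> ^ (2 * n)))" for k l
  proof -
    have "?d (k, l) = ennreal (1 / (2 * pi) ^ (2 * n + 1)) * ennreal ((fan_mult n k)\<^sup>2) * ennreal (\<bar>l\<bar> ^ (2 * n))"
      by (simp add: ennreal_mult[symmetric])
    then show ?thesis by (simp add: ac_simps)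
  qed
  have "(\<integral>\<^sup>+a. \<phi> a \<partial>nu2 n) = (\<integral>\<^sup>+x. ?d x * \<phi> (?g x) \<partial>(count_space UNIV \<Otimes>\<^sub>M lborel))"
    unfolding nu2_def using g \<phi>
    by (subst nn_integral_distr) (auto simp: nn_integral_density)
  also have "\<dots> = (\<integral>\<^sup>+l. (\<integral>\<^sup>+k. ?d (k, l) * \<phi> (?g (k, l)) \<partial>count_space UNIV) \<partial>lborel)"
    by (rule P.nn_integral_snd[symmetric]) measurable
  also have "\<dots> = (\<integral>\<^sup>+l. ennreal (1 / (2 * pi) ^ (2 * n + 1)) *
      ((\<Sum>k. ennreal ((fan_mult n k)\<^sup>2) * \<phi> (l, (2 * real k + real n) * \<bar>l\<bar>)) * ennreal (\<bar>l\<bar> ^ (2 * n))) \<partial>lborel)"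
    unfolding eq by (simp only: nn_integral_count_space_nat ennreal_suminf_cmult ennreal_suminf_multc)
  also have "\<dots> = ennreal (1 / (2 * pi) ^ (2 * n + 1)) *
    (\<integral>\<^sup>+l. (\<Sum>k. ennreal ((fan_mult n k)\<^sup>2) * \<phi> (l, (2 * real k + real n) * \<bar>l\<bar>))
       * ennreal (\<bar>l\<bar> ^ (2 * n)) \<partial>lborel)"
    by (rule nn_integral_cmult) measurable
  finally show ?thesis .
qed

section \<open>The Strichartz Fourier transform\<close>

definition strichartz :: "('n::finite heis \<Rightarrow> complex) \<Rightarrow> real \<times> real \<Rightarrow> complex ^ 'n \<Rightarrow> complex"
  where "strichartz f a w =
    (if fst a \<noteq> 0 then
       \<integral>x. f x * heis_e (fan_index CARD('n) a) (fst a) (heis_mult (heis_inv x) (w, 0)) \<partial>lborel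
     else
       of_real (fact (CARD('n) - 1) * 2 ^ (CARD('n) - 1)) *
       (\<integral>x. f x * of_real (bessel_quotient (CARD('n) - 1) (sqrt (snd a) * norm (w - fst x))) \<partial>lborel))"

definition normalized_strichartz ::
    "('n::finite heis \<Rightarrow> complex) \<Rightarrow> real \<times> real \<Rightarrow> complex ^ 'n \<Rightarrow> complex"
  where "normalized_strichartz f a w =
    (if fst a \<noteq> 0 then strichartz f a w / of_real (fan_mult CARD('n) (fan_index CARD('n) a))
     else strichartz f a w)"

text \<open>Weights are only required to be measurable in the sense of Lebesgue, so the product
  measure on \<open>\<Omega> \<times> \<complex>\<^sup>n\<close> is completed.\<close>

definition fan_measure :: "((real \<times> real) \<times> (complex ^ 'n::finite)) measure"
  where "fan_measure = completion (nu2 CARD('n) \<Otimes>\<^sub>M lborel)"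

end

theory Submission
  imports Defs "HOL-Probability.Characteristic_Functions"
begin


text \<open>Integration by parts in \<open>t\<close> gives
  \<open>\<integral>|f|\<^sup>2 = - 2 Re \<integral> (\<partial>\<^sub>t f) cnj (t f)\<close>. The transform of \<open>\<partial>\<^sub>t f\<close> is \<open>\<i> \<lambda>\<close> times that of \<open>f\<close>, so once the
  right-hand side is bounded by \<open>2 \<integral> |\<lambda>| |f~| |(t f)~|\<close> over the fan, Hoelder's inequality
  with weights \<open>1/u\<close> and \<open>u\<close>, followed by Pitt's inequality for \<open>t f\<close>, finishes the proof.

  The bound over the fan is one half of Parseval's identity, and no convergence of spectral
  expansions is needed for it. At fixed \<open>\<lambda>\<close> the transform is twisted convolution with the Laguerre
  functions; the corresponding kernels \<open>K\<^sub>k\<close> reproduce themselves up to the factor \<open>(2 \<pi> / |\<lambda>|)\<^sup>n\<close>, and \<open>\<Sum>\<^sub>k r\<^sup>k K\<^sub>k\<close> is a Gaussian which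
  approximates a multiple of the identity as \<open>r \<rightarrow> 1\<close>. Hence \<open>\<integral> H cnj G\<close> is, up to a factor, an Abel limit of
  \<open>\<Sum>\<^sub>k r\<^sup>k \<integral> K\<^sub>k H cnj (K\<^sub>k G)\<close>, to which the triangle inequality applies. The variable \<open>\<lambda>\<close> is treated
  in the same way with a Gaussian cut-off.\<close>

section \<open>Gaussian integrals\<close>

text \<open>The series of kernels is controlled only through \<open>mehler_majorant\<close>, which
  decays for \<open>r < 1/3\<close> and grows for \<open>r > 1/3\<close>. Identities between kernels
  are therefore read off as power series coefficients at small \<open>r\<close>, while the passage
  \<open>r \<rightarrow> 1\<close> takes place inside pairings of compactly supported functions,
  where the growth stays bounded. The constants fit as follows. The factor
  \<open>(2 * pi / \<bar>l\<bar>) ^ CARD('n)\<close> enters once through the reproducing law and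
  once as the mass of the limiting Gaussian, which gives
  \<open>(\<bar>l\<bar> / (2 * pi)) ^ (2 * CARD('n))\<close>. Together with
  \<open>1 / (2 * pi)\<close> from the variable \<open>t\<close>, and with the square of
  \<open>fan_mult\<close> undoing the two normalizations, this is the density of \<open>nu2\<close>.
  The last difficulty is the zero set of \<open>u\<close>: there the integrand in Hoelder's
  inequality is 0 by the convention \<open>0 * \<infinity> = 0\<close>, and finiteness of the first
  norm has to make up for it.\<close>

lemma lborel_has_bochner_integral_prod:
  fixes f :: "'a::euclidean_space \<Rightarrow> real \<Rightarrow> 'b::{real_normed_field,banach,second_countable_topology}"
  assumes f: "\<And>b. b \<in> Basis \<Longrightarrow> has_bochner_integral lborel (f b) (I b)"
  shows "has_bochner_integral lborel (\<lambda>x::'a. \<Prod>b\<in>Basis. f b (x \<bullet> b)) (\<Prod>b\<in>Basis. I b)"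
proof -
  interpret product_sigma_finite "\<lambda>b::'a. lborel :: real measure" by standard
  have int: "integrable lborel (f b)" if "b \<in> Basis" for b
    using f[OF that] by (simp add: has_bochner_integral_iff)
  have [measurable]: "(\<lambda>g. \<Sum>b\<in>Basis. g b *\<^sub>R b) \<in> (\<Pi>\<^sub>M b\<in>(Basis::'a set). lborel) \<rightarrow>\<^sub>M (borel :: 'a measure)"
    by measurable
  have fm[measurable]: "f b \<in> borel_measurable borel" if "b \<in> Basis" for b
    using int[OF that] by auto
  have m: "(\<lambda>x::'a. \<Prod>b\<in>Basis. f b (x \<bullet> b)) \<in> borel_measurable borel"
    by (intro borel_measurable_prod measurable_compose[OF _ fm]) auto
  have eq: "(\<Prod>b\<in>Basis. f b ((\<Sum>b\<in>Basis. g b *\<^sub>R b) \<bullet> b)) = (\<Prod>b\<in>Basis. f b (g b))" for g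
    by (intro prod.cong refl) simp
  have "has_bochner_integral (\<Pi>\<^sub>M b\<in>(Basis::'a set). lborel) (\<lambda>g. \<Prod>b\<in>Basis. f b (g b)) (\<Prod>b\<in>Basis. I b)"
    unfolding has_bochner_integral_iff
    using product_integrable_prod[OF finite_Basis int] product_integral_prod[OF finite_Basis int] f
    by (auto simp: has_bochner_integral_iff intro!: prod.cong)
  then have "has_bochner_integral (\<Pi>\<^sub>M b\<in>(Basis::'a set). lborel)
      (\<lambda>g. \<Prod>b\<in>Basis. f b ((\<Sum>b\<in>Basis. g b *\<^sub>R b) \<bullet> b)) (\<Prod>b\<in>Basis. I b)"
    unfolding eq .
  \<comment> \<open>\<open>lborel\<close> on a Euclidean space is this image of the product of
    one-dimensional Lebesgue measures (\<open>lborel_eq\<close>).\<close>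
  then have "has_bochner_integral (distr (\<Pi>\<^sub>M b\<in>Basis. lborel) borel (\<lambda>g. \<Sum>b\<in>Basis. g b *\<^sub>R b))
      (\<lambda>x::'a. \<Prod>b\<in>Basis. f b (x \<bullet> b)) (\<Prod>b\<in>Basis. I b)"
    using m by (simp add: has_bochner_integral_iff integrable_distr_eq integral_distr)
  then show ?thesis
    unfolding lborel_eq[symmetric] .
qed

text \<open>Rescaling by \<open>s = sqrt (2 * a)\<close> reduces the integral to the characteristic
  function of the standard normal distribution at \<open>\<kappa> / s\<close>.\<close>

lemma has_bochner_integral_gaussian_real:
  fixes a \<kappa> :: real
  assumes a: "0 < a"
  shows "has_bochner_integral lborel
    (\<lambda>x. complex_of_real (exp (- (a * x\<^sup>2))) * exp (\<i> * of_real (\<kappa> * x)))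
    (of_real (sqrt (pi / a) * exp (- \<kappa>\<^sup>2 / (4 * a))))"
proof -
  define s where "s = sqrt (2 * a)"
  have s: "s > 0" "s\<^sup>2 = 2 * a" using a by (simp_all add: s_def)
  have "has_bochner_integral std_normal_distribution (\<lambda>x. exp (\<i> * of_real (\<kappa> / s * x)))
     (of_real (exp (- (\<kappa> / s)\<^sup>2 / 2)))"
    using fun_cong[OF char_std_normal_distribution, of "\<kappa> / s"]
      prob_space.integrable_iexp[OF prob_space_normal_density[of 1 0], of "\<lambda>x. \<kappa> / s * x"]
    unfolding char_def has_bochner_integral_iff by simp
  then have "has_bochner_integral lborel (\<lambda>x. std_normal_density x *\<^sub>R exp (\<i> * of_real (\<kappa> / s * x)))
     (of_real (exp (- (\<kappa> / s)\<^sup>2 / 2)))"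
    unfolding has_bochner_integral_iff
    by (simp add: integrable_density integral_density normal_density_nonneg)
  then have "has_bochner_integral lborel
      (\<lambda>x. std_normal_density (0 + s * x) *\<^sub>R exp (\<i> * of_real (\<kappa> / s * (0 + s * x))))
     (of_real (exp (- (\<kappa> / s)\<^sup>2 / 2)) /\<^sub>R \<bar>s\<bar>)"
    using s by (intro lborel_has_bochner_integral_real_affine_iff[THEN iffD1]) auto
  from has_bochner_integral_scaleR_right[where c="sqrt (2 * pi)", OF this]
  have "has_bochner_integral lborel
      (\<lambda>x. sqrt (2 * pi) *\<^sub>R (std_normal_density (s * x) *\<^sub>R exp (\<i> * of_real (\<kappa> * x))))
     (sqrt (2 * pi) *\<^sub>R (of_real (exp (- (\<kappa> / s)\<^sup>2 / 2)) /\<^sub>R \<bar>s\<bar>))"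
    using s by simp
  moreover have "sqrt (2 * pi) *\<^sub>R (std_normal_density (s * x) *\<^sub>R exp (\<i> * of_real (\<kappa> * x)))
      = of_real (exp (- (a * x\<^sup>2))) * exp (\<i> * of_real (\<kappa> * x))" for x
    using s by (simp add: std_normal_density_def power_mult_distrib scaleR_conv_of_real)
  moreover have "sqrt (2 * pi) *\<^sub>R (complex_of_real (exp (- (\<kappa> / s)\<^sup>2 / 2)) /\<^sub>R \<bar>s\<bar>)
      = of_real (sqrt (pi / a) * exp (- \<kappa>\<^sup>2 / (4 * a)))"
  proof -
    have "sqrt (2 * pi) / s = sqrt (pi / a)"
      by (simp add: s_def real_sqrt_mult real_sqrt_divide)
    moreover have "- (\<kappa> / s)\<^sup>2 / 2 = - \<kappa>\<^sup>2 / (4 * a)"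
      using s a by (simp add: power_divide)
    ultimately show ?thesis
      using s by (simp add: scaleR_conv_of_real field_simps flip: of_real_mult of_real_divide)
  qed
  ultimately show ?thesis by (simp only:)
qed

lemma has_bochner_integral_gaussian:
  fixes k :: "'a::euclidean_space"
  assumes a: "0 < a"
  shows "has_bochner_integral lborel
    (\<lambda>x. complex_of_real (exp (- (a * (norm x)\<^sup>2))) * exp (\<i> * of_real (k \<bullet> x)))
    (of_real (sqrt (pi / a) ^ DIM('a) * exp (- (norm k)\<^sup>2 / (4 * a))))"
proof -
  have "has_bochner_integral lborel
    (\<lambda>x. \<Prod>b\<in>Basis. complex_of_real (exp (- (a * (x \<bullet> b)\<^sup>2))) * exp (\<i> * of_real ((k \<bullet> b) * (x \<bullet> b))))
    (\<Prod>b\<in>(Basis::'a set). of_real (sqrt (pi / a) * exp (- (k \<bullet> b)\<^sup>2 / (4 * a))))"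
    by (rule lborel_has_bochner_integral_prod) (rule has_bochner_integral_gaussian_real[OF a])
  moreover have "(\<Prod>b\<in>Basis. complex_of_real (exp (- (a * (x \<bullet> b)\<^sup>2))) * exp (\<i> * of_real ((k \<bullet> b) * (x \<bullet> b))))
      = complex_of_real (exp (- (a * (norm x)\<^sup>2))) * exp (\<i> * of_real (k \<bullet> x))" for x
  proof -
    have "(\<Prod>b\<in>Basis. exp (- (a * (x \<bullet> b)\<^sup>2))) = exp (- (a * (norm x)\<^sup>2))"
      unfolding power2_norm_eq_inner euclidean_inner[of x x]
      by (simp add: exp_sum[symmetric] sum_distrib_left sum_negf power2_eq_square)
    moreover have "(\<Prod>b\<in>Basis. exp (\<i> * complex_of_real ((k \<bullet> b) * (x \<bullet> b)))) = exp (\<i> * of_real (k \<bullet> x))"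
      by (simp add: exp_sum[symmetric] euclidean_inner[of k x] sum_distrib_left)
    ultimately show ?thesis
      by (simp add: prod.distrib flip: of_real_prod)
  qed
  moreover have "(\<Prod>b\<in>(Basis::'a set). complex_of_real (sqrt (pi / a) * exp (- (k \<bullet> b)\<^sup>2 / (4 * a))))
      = of_real (sqrt (pi / a) ^ DIM('a) * exp (- (norm k)\<^sup>2 / (4 * a)))"
    unfolding power2_norm_eq_inner euclidean_inner[of k k]
    by (simp add: prod.distrib exp_sum[symmetric]
        sum_negf sum_divide_distrib power2_eq_square flip: of_real_prod)
  ultimately show ?thesis by (simp only:)
qed

lemma lborel_has_bochner_integral_translate:
  fixes f :: "'a::euclidean_space \<Rightarrow> 'b::{banach,second_countable_topology}"
  assumes "has_bochner_integral lborel f I"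
  shows "has_bochner_integral lborel (\<lambda>x. f (c + x)) I"
proof -
  have f[measurable]: "f \<in> borel_measurable borel"
    using borel_measurable_has_bochner_integral[OF assms] by simp
  have "has_bochner_integral (distr lborel borel ((+) c)) f I"
    unfolding lborel_distr_plus by (fact assms)
  then show ?thesis
    unfolding has_bochner_integral_iff
    by (subst (asm) integrable_distr_eq, simp, simp, subst (asm) integral_distr) simp_all
qed

text \<open>Completing the square about the weighted mean \<open>m\<close> of the two centres leaves
  one Gaussian of rate \<open>a + b\<close> and the constant \<open>exp E\<close>; the frequency
  \<open>k\<close> then contributes its phase at \<open>m\<close>.\<close>

lemma has_bochner_integral_two_gaussians:
  fixes k p q :: "'a::euclidean_space"
  assumes ab: "0 < a + b"
  shows "has_bochner_integral lborel
    (\<lambda>w. complex_of_real (exp (- (a * (norm (w - p))\<^sup>2) - b * (norm (w - q))\<^sup>2)) * exp (\<i> * of_real (k \<bullet> w)))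
    (of_real (sqrt (pi / (a + b)) ^ DIM('a) *
       exp (- (a * b / (a + b) * (norm (p - q))\<^sup>2) - (norm k)\<^sup>2 / (4 * (a + b))))
     * exp (\<i> * of_real ((a * (k \<bullet> p) + b * (k \<bullet> q)) / (a + b))))"
proof -
  define m where "m = (a / (a + b)) *\<^sub>R p + (b / (a + b)) *\<^sub>R q"
  define E where "E = - (a * b / (a + b) * (norm (p - q))\<^sup>2)"
  \<comment> \<open>After multiplication by \<open>a + b\<close> this is the quadratic identity
    \<open>3\<close> below, with \<open>P = w - p\<close> and \<open>Q = w - q\<close>.\<close>
  have eq: "- (a * (norm (w - p))\<^sup>2) - b * (norm (w - q))\<^sup>2 = E - (a + b) * (norm (- m + w))\<^sup>2" for w
  proof -
    have "(a + b) * ((a + b) * (norm (- m + w))\<^sup>2) = (norm ((a + b) *\<^sub>R (- m + w)))\<^sup>2"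
      by (simp add: power_mult_distrib power2_eq_square)
    also have "(a + b) *\<^sub>R (- m + w) = (a + b) *\<^sub>R w - (a + b) *\<^sub>R m"
      by (simp add: algebra_simps)
    also have "(a + b) *\<^sub>R m = a *\<^sub>R p + b *\<^sub>R q"
      using ab by (simp add: m_def scaleR_add_right)
    also have "(a + b) *\<^sub>R w - (a *\<^sub>R p + b *\<^sub>R q) = a *\<^sub>R (w - p) + b *\<^sub>R (w - q)"
      by (simp add: algebra_simps)
    finally have 1: "(a + b) * ((a + b) * (norm (- m + w))\<^sup>2) = (norm (a *\<^sub>R (w - p) + b *\<^sub>R (w - q)))\<^sup>2" .
    have 2: "(a + b) * E = - (a * b * (norm ((w - q) - (w - p)))\<^sup>2)"
      using ab by (simp add: E_def)
    have 3: "(a + b) * (- (a * (norm P)\<^sup>2) - b * (norm Q)\<^sup>2) =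
        - (a * b * (norm (Q - P))\<^sup>2) - (norm (a *\<^sub>R P + b *\<^sub>R Q))\<^sup>2" for P Q :: 'a
      unfolding power2_norm_eq_inner
      by (simp add: inner_add inner_diff inner_commute[of Q P] algebra_simps)
    have "(a + b) * (- (a * (norm (w - p))\<^sup>2) - b * (norm (w - q))\<^sup>2) = (a + b) * (E - (a + b) * (norm (- m + w))\<^sup>2)"
      unfolding right_diff_distrib[of "a + b" E] 1 2 3 ..
    then show ?thesis using ab by simp
  qed
  have "has_bochner_integral lborel
      (\<lambda>w. complex_of_real (exp (- ((a + b) * (norm (- m + w))\<^sup>2))) * exp (\<i> * of_real (k \<bullet> (- m + w))))
      (of_real (sqrt (pi / (a + b)) ^ DIM('a) * exp (- (norm k)\<^sup>2 / (4 * (a + b)))))"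
    by (rule lborel_has_bochner_integral_translate[OF has_bochner_integral_gaussian[OF ab]])
  from has_bochner_integral_mult_right[where c="of_real (exp E) * exp (\<i> * of_real (k \<bullet> m))", OF this]
  have "has_bochner_integral lborel
      (\<lambda>w. (of_real (exp E) * exp (\<i> * of_real (k \<bullet> m))) *
        (complex_of_real (exp (- ((a + b) * (norm (- m + w))\<^sup>2))) * exp (\<i> * of_real (k \<bullet> (- m + w)))))
      ((of_real (exp E) * exp (\<i> * of_real (k \<bullet> m))) *
       of_real (sqrt (pi / (a + b)) ^ DIM('a) * exp (- (norm k)\<^sup>2 / (4 * (a + b)))))"
    .
  moreover have "(of_real (exp E) * exp (\<i> * of_real (k \<bullet> m))) *
        (complex_of_real (exp (- ((a + b) * (norm (- m + w))\<^sup>2))) * exp (\<i> * of_real (k \<bullet> (- m + w))))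
      = complex_of_real (exp (- (a * (norm (w - p))\<^sup>2) - b * (norm (w - q))\<^sup>2)) * exp (\<i> * of_real (k \<bullet> w))" for w
  proof -
    have "exp E * exp (- ((a + b) * (norm (- m + w))\<^sup>2)) = exp (- (a * (norm (w - p))\<^sup>2) - b * (norm (w - q))\<^sup>2)"
      unfolding eq by (simp add: mult_exp_exp)
    moreover have "exp (\<i> * of_real (k \<bullet> m)) * exp (\<i> * of_real (k \<bullet> (- m + w))) = exp (\<i> * of_real (k \<bullet> w))"
      by (simp add: mult_exp_exp inner_simps algebra_simps)
    moreover have "(of_real A * u) * (of_real B * v) = of_real (A * B) * (u * v)" for A B and u v :: complex
      by simp
    ultimately show ?thesis by (simp only:)
  qed
  moreover have "(of_real (exp E) * exp (\<i> * of_real (k \<bullet> m))) *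
       of_real (sqrt (pi / (a + b)) ^ DIM('a) * exp (- (norm k)\<^sup>2 / (4 * (a + b)))) =
     (of_real (sqrt (pi / (a + b)) ^ DIM('a) *
       exp (- (a * b / (a + b) * (norm (p - q))\<^sup>2) - (norm k)\<^sup>2 / (4 * (a + b))))
     * exp (\<i> * of_real ((a * (k \<bullet> p) + b * (k \<bullet> q)) / (a + b))))"
  proof -
    have "k \<bullet> m = (a * (k \<bullet> p) + b * (k \<bullet> q)) / (a + b)"
      by (simp add: m_def inner_simps add_divide_distrib)
    then show ?thesis by (simp add: E_def exp_diff exp_minus field_simps)
  qed
  ultimately show ?thesis by (simp only:)
qed


section \<open>Laguerre polynomials\<close>

text \<open>Pascal's rule. If the sum is read as the \<open>j\<close>-th power of (shift - identity)
  applied to the sequence \<open>a\<close>, this is the recursion from one power to the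
  next.\<close>

lemma binomial_difference_Suc:
  fixes a :: "nat \<Rightarrow> 'a::comm_ring_1"
  shows "(\<Sum>l\<le>Suc j. (- 1) ^ (Suc j - l) * of_nat (Suc j choose l) * a l) =
    (\<Sum>l\<le>j. (- 1) ^ (j - l) * of_nat (j choose l) * a (Suc l)) -
    (\<Sum>l\<le>j. (- 1) ^ (j - l) * of_nat (j choose l) * a l)"
proof -
  have 1: "(\<Sum>l\<le>Suc j. (- 1) ^ (Suc j - l) * of_nat (Suc j choose l) * a l) =
    (- 1) ^ Suc j * a 0 + (\<Sum>l\<le>j. (- 1) ^ (j - l) * (of_nat (j choose l) + of_nat (j choose Suc l)) * a (Suc l))"
    by (subst sum.atMost_Suc_shift) simp
  have 2: "(\<Sum>l\<le>j. (- 1) ^ (j - l) * of_nat (j choose l) * a l) =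
    (\<Sum>l\<le>Suc j. (- 1) ^ (j - l) * of_nat (j choose l) * a l)"
    by (simp add: binomial_eq_0)
  have 3: "\<dots> = (- 1) ^ j * a 0 + (\<Sum>l\<le>j. (- 1) ^ (j - Suc l) * of_nat (j choose Suc l) * a (Suc l))"
    by (subst sum.atMost_Suc_shift) simp
  have 4: "(- 1) ^ (j - Suc l) * of_nat (j choose Suc l) * a (Suc l)
      = - ((- 1) ^ (j - l) * of_nat (j choose Suc l) * a (Suc l))" for l
  proof (cases "l < j")
    case True
    then have "(- 1 :: 'a) ^ (j - l) = (- 1) ^ Suc (j - Suc l)" by (simp only: Suc_diff_Suc)
    then show ?thesis by simp
  next
    case False
    then show ?thesis by (simp add: binomial_eq_0)
  qed
  show ?thesis
    unfolding 1 2 3 4 by (simp add: sum_negf sum.distrib ring_distribs)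
qed

text \<open>Conjugation by \<open>exp (- s)\<close> turns differentiation D into D - 1, so the sum
  is the \<open>j\<close>-th power of D - 1 applied to \<open>s ^ N\<close>, and D acts on the
  successive derivatives of \<open>s ^ N\<close> as a shift.\<close>

lemma higher_deriv_exp_minus_times_power:
  fixes t :: real
  shows "(deriv ^^ j) (\<lambda>s. exp (- s) * s ^ N) t =
    exp (- t) * (\<Sum>l\<le>j. (- 1) ^ (j - l) * of_nat (j choose l) * ((\<Prod>i<l. real (N - i)) * t ^ (N - l)))"
proof (induction j arbitrary: t)
  case 0
  show ?case by simp
next
  case (Suc j)
  \<comment> \<open>\<open>a l\<close> is the \<open>l\<close>-th derivative of
    \<open>s ^ N\<close>. For \<open>l > N\<close> the factor with \<open>i = N\<close> is 0, which
    also takes care of the truncated exponent \<open>N - l\<close>.\<close>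
  define a where "a l s = (\<Prod>i<l. real (N - i)) * s ^ (N - l)" for l and s :: real
  define S where "S j s = (\<Sum>l\<le>j. (- 1) ^ (j - l) * of_nat (j choose l) * a l s)" for j and s :: real
  have eq: "(deriv ^^ j) (\<lambda>s. exp (- s) * s ^ N) = (\<lambda>s. exp (- s) * S j s)"
    using Suc.IH by (auto simp: S_def a_def)
  have a: "(a l has_real_derivative a (Suc l) t) (at t)" for l
    unfolding a_def by (auto intro!: derivative_eq_intros)
  have S: "(S j has_real_derivative (\<Sum>l\<le>j. (- 1) ^ (j - l) * of_nat (j choose l) * a (Suc l) t)) (at t)"
    unfolding S_def by (intro DERIV_sum DERIV_cmult a)
  have "((\<lambda>s. exp (- s) * S j s) has_real_derivative exp (- t) *
      ((\<Sum>l\<le>j. (- 1) ^ (j - l) * of_nat (j choose l) * a (Suc l) t) - S j t)) (at t)"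
    by (rule derivative_eq_intros S refl | simp add: algebra_simps)+
  then have "deriv (\<lambda>s. exp (- s) * S j s) t = exp (- t) * S (Suc j) t"
    unfolding S_def binomial_difference_Suc by (rule DERIV_imp_deriv)
  then show ?case
    by (simp add: eq S_def a_def)
qed

lemma higher_deriv_cong_open:
  fixes f g :: "'a::real_normed_field \<Rightarrow> 'a"
  assumes "open S" and "\<And>x. x \<in> S \<Longrightarrow> f x = g x" and "x \<in> S"
  shows "(deriv ^^ j) f x = (deriv ^^ j) g x"
  using assms(3)
proof (induction j arbitrary: x)
  case 0
  then show ?case using assms(2) by simp
next
  case (Suc j)
  have "\<forall>\<^sub>F y in nhds x. (deriv ^^ j) f y = (deriv ^^ j) g y"
    using eventually_nhds_in_open[OF assms(1) Suc.prems] by eventually_elim (rule Suc.IH)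
  then show ?case by (simp add: deriv_cong_ev)
qed

text \<open>Expanding the derivative in \<open>rodrigues\<close> gives the formula for positive
  arguments. Polynomials that agree on a half-line are equal, so it extends to all \<open>x\<close>,
  in particular to the negative arguments behind the majorant.\<close>

lemma poly_laguerre_nat:
  "poly (laguerre k (real m)) x = (\<Sum>i\<le>k. of_nat ((k + m) choose (k - i)) * (- x) ^ i / fact i)"
proof -
  define Q :: "real poly" where "Q = (\<Sum>i\<le>k. monom (of_nat ((k + m) choose (k - i)) * (- 1) ^ i / fact i) i)"
  have Q: "poly Q x = (\<Sum>i\<le>k. of_nat ((k + m) choose (k - i)) * (- x) ^ i / fact i)" for x :: real
    unfolding Q_def by (simp add: poly_sum poly_monom power_minus[of x] mult_ac)
  have "poly (laguerre k (real m)) t = poly Q t" if t: "t > 0" for t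
  proof -
    \<comment> \<open>\<open>powr\<close> agrees with the natural power on the positive axis but not
      in general; an open set containing \<open>t\<close> suffices for comparing iterated
      derivatives.\<close>
    have "(deriv ^^ k) (\<lambda>s. exp (- s) * s powr (real k + real m)) t = (deriv ^^ k) (\<lambda>s. exp (- s) * s ^ (k + m)) t"
    proof (rule higher_deriv_cong_open[of "{0<..}"])
      show "exp (- s) * s powr (real k + real m) = exp (- s) * s ^ (k + m)" if "s \<in> {0<..}" for s :: real
        using that powr_realpow[of s "k + m"] by simp
    qed (use t in auto)
    also have "\<dots> = exp (- t) * (\<Sum>l\<le>k. (- 1) ^ (k - l) * of_nat (k choose l) *
        ((\<Prod>i<l. real (k + m - i)) * t ^ (k + m - l)))"
      by (rule higher_deriv_exp_minus_times_power)
    also have "(\<Sum>l\<le>k. (- 1) ^ (k - l) * of_nat (k choose l) * ((\<Prod>i<l. real (k + m - i)) * t ^ (k + m - l)))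
      = (\<Sum>i\<le>k. (- 1) ^ i * of_nat (k choose i) * ((\<Prod>i<k - i. real (k + m - i)) * t ^ (m + i)))"
      by (rule sum.reindex_bij_witness[of _ "\<lambda>i. k - i" "\<lambda>i. k - i"])
        (auto simp: binomial_symmetric[symmetric] add.commute)
    also have "\<dots> = fact k * t ^ m * poly Q t"
      unfolding Q sum_distrib_left
    proof (rule sum.cong[OF refl])
      fix i assume "i \<in> {..k}"
      then have i: "i \<le> k" by simp
      have "(\<Prod>j<k - i. real (k + m - j)) = fact (k + m) / fact (m + i)"
      proof -
        have "(\<Prod>j<l. real (N - j)) = fact N / fact (N - l)" if "l \<le> N" for N l :: nat
          using that
        proof (induction l)
          case (Suc l)
          then have "fact (N - l) = real (N - l) * fact (N - Suc l)"
            by (metis Suc_diff_Suc Suc_le_lessD fact_Suc of_nat_mult of_nat_fact)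
          moreover have "real (N - l) \<noteq> 0" using Suc.prems by simp
          ultimately show ?case using Suc by (simp del: of_nat_diff)
        qed simp
        from this[of "k - i" "k + m"] show ?thesis using i by (simp add: add.commute)
      qed
      moreover have "real (k choose i) = fact k / (fact i * fact (k - i))"
        by (rule binomial_fact[OF i])
      moreover have "real ((k + m) choose (k - i)) = fact (k + m) / (fact (k - i) * fact (m + i))"
        using i by (subst binomial_fact) (simp_all add: add.commute)
      ultimately show "(- 1) ^ i * real (k choose i) * ((\<Prod>j<k - i. real (k + m - j)) * t ^ (m + i)) =
         fact k * t ^ m * (real ((k + m) choose (k - i)) * (- t) ^ i / fact i)"
        by (simp add: power_add power_minus[of t] mult_ac)
    qed
    finally have "rodrigues k (real m) t = (t powr (- real m) * t ^ m) * (exp t * exp (- t)) * poly Q t"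
      unfolding rodrigues_def by simp
    also have "t powr (- real m) * t ^ m = 1"
      using t by (simp add: powr_minus powr_realpow)
    also have "exp t * exp (- t) = 1"
      by (simp add: exp_minus)
    finally show ?thesis
      by (simp add: poly_laguerre[OF t])
  qed
  then have "{0<..} \<subseteq> {t. poly (laguerre k (real m) - Q) t = 0}"
    by auto
  then have "infinite {t. poly (laguerre k (real m) - Q) t = 0}"
    by (rule infinite_super) (rule infinite_Ioi)
  with poly_roots_finite have "laguerre k (real m) - Q = 0" by blast
  then show ?thesis by (simp add: Q)
qed

text \<open>The binomial series with exponent \<open>- (M + 1)\<close>; upper negation turns its
  generalized coefficients into ordinary ones.\<close>

lemma negative_binomial_sums:
  fixes r :: real
  assumes "\<bar>r\<bar> < 1"
  shows "(\<lambda>j. of_nat ((j + M) choose j) * r ^ j) sums (1 / (1 - r) ^ (M + 1))"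
proof -
  have "(\<lambda>j. ((- real (M + 1)) gchoose j) * (- r) ^ j) sums (1 + (- r)) powr (- real (M + 1))"
    by (rule gen_binomial_real) (use assms in simp)
  moreover have "((- real (M + 1)) gchoose j) * (- r) ^ j = of_nat ((j + M) choose j) * r ^ j" for j
  proof -
    have "(- real (M + 1)) gchoose j = (- 1) ^ j * (real (j + M) gchoose j)"
      by (subst gbinomial_minus) (simp add: algebra_simps)
    also have "real (j + M) gchoose j = of_nat ((j + M) choose j)"
      by (simp add: binomial_gbinomial)
    finally show ?thesis
      by (simp add: power_minus[of r])
  qed
  moreover have "(1 + (- r)) powr (- real (M + 1)) = 1 / (1 - r) ^ (M + 1)"
    using assms powr_realpow[of "1 - r" "M + 1"] by (simp only: powr_minus) (simp add: divide_inverse)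
  ultimately show ?thesis by (simp only:)
qed

text \<open>Inserting the explicit polynomials gives a double series. Summed over \<open>j\<close>
  at fixed \<open>i\<close> it is a negative binomial series, and the sum over \<open>i\<close> is
  then an exponential series; absolute convergence allows regrouping along the diagonals
  \<open>k = i + j\<close>.\<close>

lemma laguerre_generating_sums:
  fixes r x :: real
  assumes "\<bar>r\<bar> < 1"
  shows "(\<lambda>k. poly (laguerre k (real m)) x * r ^ k) sums (exp (- (x * r / (1 - r))) / (1 - r) ^ (m + 1))"
proof -
  \<comment> \<open>\<open>T (- x) r (i, j)\<close> is the term with \<open>x ^ i\<close> in the
    summand \<open>k = i + j\<close>. The sign of \<open>x\<close> is kept as an argument so that
    \<open>T\<close> also describes the series of absolute values.\<close>
  define T where "T x r = (\<lambda>(i, j). of_nat ((i + j + m) choose j) * r ^ j * (x ^ i / fact i * r ^ i))"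
    for x r :: real
  have inner: "((\<lambda>j. T x r (i, j)) has_sum (x * r / (1 - r)) ^ i / fact i / (1 - r) ^ (m + 1)) UNIV"
    if r: "\<bar>r\<bar> < 1" for x r :: real and i
  proof -
    have "((\<lambda>j. of_nat ((j + (i + m)) choose j) * r ^ j) has_sum 1 / (1 - r) ^ (i + m + 1)) UNIV"
    proof (rule norm_summable_imp_has_sum)
      show "summable (\<lambda>j. norm (real ((j + (i + m)) choose j) * r ^ j))"
        using negative_binomial_sums[of "\<bar>r\<bar>" "i + m"] r
        by (simp add: sums_iff abs_mult power_abs)
    qed (rule negative_binomial_sums[OF r])
    from has_sum_cmult_left[OF this, of "x ^ i / fact i * r ^ i"]
    show ?thesis
      using r by (simp add: T_def ac_simps power_add power_divide power_mult_distrib)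
  qed
  have outer: "((\<lambda>i. (x * r / (1 - r)) ^ i / fact i / (1 - r) ^ (m + 1)) has_sum
      exp (x * r / (1 - r)) / (1 - r) ^ (m + 1)) UNIV" for x r :: real
  proof -
    have "((\<lambda>i. (x * r / (1 - r)) ^ i / fact i) has_sum exp (x * r / (1 - r))) UNIV"
    proof (rule norm_summable_imp_has_sum)
      show "summable (\<lambda>i. norm ((x * r / (1 - r)) ^ i / fact i))"
        using summable_norm_exp[of "x * r / (1 - r)"] by (simp add: field_simps)
      show "(\<lambda>i. (x * r / (1 - r)) ^ i / fact i) sums exp (x * r / (1 - r))"
        using exp_converges[of "x * r / (1 - r)"] by (simp add: field_simps)
    qed
    from has_sum_cmult_left[OF this, of "1 / (1 - r) ^ (m + 1)"] show ?thesis by simp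
  qed
  \<comment> \<open>The absolute values of the terms of \<open>T (- x) r\<close> are the terms of
    \<open>T \<bar>x\<bar> \<bar>r\<bar>\<close>, so the same two summations prove absolute
    convergence.\<close>
  have "T \<bar>x\<bar> \<bar>r\<bar> summable_on UNIV \<times> UNIV"
  proof (rule summable_on_SigmaI)
    show "((\<lambda>j. T \<bar>x\<bar> \<bar>r\<bar> (i, j)) has_sum (\<bar>x\<bar> * \<bar>r\<bar> / (1 - \<bar>r\<bar>)) ^ i / fact i / (1 - \<bar>r\<bar>) ^ (m + 1)) UNIV" for i
      by (rule inner) (use assms in simp)
    show "(\<lambda>i. (\<bar>x\<bar> * \<bar>r\<bar> / (1 - \<bar>r\<bar>)) ^ i / fact i / (1 - \<bar>r\<bar>) ^ (m + 1)) summable_on UNIV"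
      using outer by (rule has_sum_imp_summable)
  qed (simp add: T_def)
  moreover have "norm (T (- x) r z) = T \<bar>x\<bar> \<bar>r\<bar> z" for z
    by (cases z) (simp add: T_def abs_mult power_abs)
  ultimately have "(\<lambda>z. norm (T (- x) r z)) summable_on UNIV \<times> UNIV"
    by (simp only:)
  then have "T (- x) r summable_on UNIV \<times> UNIV"
    by (rule abs_summable_summable)
  then have "(T (- x) r has_sum exp (- x * r / (1 - r)) / (1 - r) ^ (m + 1)) (UNIV \<times> UNIV)"
    by (intro has_sum_SigmaI[OF inner[OF assms] outer]) simp_all
  also have "?this \<longleftrightarrow> ((\<lambda>(k, i). T (- x) r (i, k - i)) has_sum exp (- x * r / (1 - r)) / (1 - r) ^ (m + 1))
      (SIGMA k:UNIV. {..k})"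
    by (rule has_sum_reindex_bij_witness[of _ "\<lambda>(k, i). (i, k - i)" "\<lambda>(i, j). (i + j, i)"]) auto
  finally have "((\<lambda>k. poly (laguerre k (real m)) x * r ^ k) has_sum
      exp (- x * r / (1 - r)) / (1 - r) ^ (m + 1)) UNIV"
  proof (rule has_sum_Sigma')
    fix k :: nat
    show "((\<lambda>i. (\<lambda>(k, i). T (- x) r (i, k - i)) (k, i)) has_sum poly (laguerre k (real m)) x * r ^ k) {..k}"
      by (rule has_sum_finiteI)
        (auto simp: T_def poly_laguerre_nat sum_distrib_right power_add[symmetric] intro!: sum.cong)
  qed
  from has_sum_imp_sums[OF this] show ?thesis by simp
qed

text \<open>At \<open>- x\<close> every term of the explicit sum is nonnegative and equals the
  absolute value of the corresponding term at \<open>x\<close>.\<close>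

lemma abs_laguerre_le: "0 \<le> x \<Longrightarrow> \<bar>poly (laguerre k (real m)) x\<bar> \<le> poly (laguerre k (real m)) (- x)"
  unfolding poly_laguerre_nat
  by (rule order_trans[OF sum_abs]) (auto intro!: sum_mono simp: abs_mult power_abs)


section \<open>Laguerre kernels and the Mehler kernel\<close>

text \<open>Dominated convergence for partial sums. The bound is placed on finite sums of norms
  because \<open>sum_abs_laguerre_fun_le\<close> delivers it in that form.\<close>

lemma sums_integral_dominated:
  fixes g :: "nat \<Rightarrow> 'a \<Rightarrow> 'b::{banach,second_countable_topology}"
  assumes g[measurable]: "\<And>j. g j \<in> borel_measurable M"
    and D: "integrable M D"
    and le: "\<And>x N. x \<in> space M \<Longrightarrow> (\<Sum>j<N. norm (g j x)) \<le> D x"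
    and S: "\<And>x. x \<in> space M \<Longrightarrow> (\<lambda>j. g j x) sums S x"
  shows "integrable M (g j)" and "(\<lambda>j. \<integral>x. g j x \<partial>M) sums (\<integral>x. S x \<partial>M)" and "integrable M S"
proof -
  have int: "integrable M (g j)" for j
  proof (rule Bochner_Integration.integrable_bound[OF D g], rule AE_I2)
    fix x assume x: "x \<in> space M"
    have "norm (g j x) \<le> (\<Sum>j<Suc j. norm (g j x))"
      by (rule member_le_sum) auto
    also have "\<dots> \<le> D x" by (rule le[OF x])
    finally show "norm (g j x) \<le> norm (D x)" by simp
  qed
  then show "integrable M (g j)" .
  have [measurable]: "S \<in> borel_measurable M"
  proof (rule borel_measurable_LIMSEQ_metric[where f="\<lambda>N x. \<Sum>j<N. g j x"])
    show "(\<lambda>x. \<Sum>j<N. g j x) \<in> borel_measurable M" for N by measurable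
    show "(\<lambda>N. \<Sum>j<N. g j x) \<longlonglongrightarrow> S x" if "x \<in> space M" for x
      using S[OF that] by (simp add: sums_def)
  qed
  have "(\<lambda>N. \<integral>x. (\<Sum>j<N. g j x) \<partial>M) \<longlonglongrightarrow> (\<integral>x. S x \<partial>M)"
  proof (rule integral_dominated_convergence[OF _ _ D])
    show "AE x in M. (\<lambda>N. \<Sum>j<N. g j x) \<longlonglongrightarrow> S x"
      using S by (auto simp: sums_def)
    show "AE x in M. norm (\<Sum>j<N. g j x) \<le> D x" for N
      using le by (intro AE_I2) (rule order_trans[OF norm_sum])
  qed measurable
  then show "(\<lambda>j. \<integral>x. g j x \<partial>M) sums (\<integral>x. S x \<partial>M)"
    by (simp add: sums_def int)
  show "integrable M S"
  proof (rule integrable_dominated_convergence[OF _ _ D])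
    show "AE x in M. (\<lambda>N. \<Sum>j<N. g j x) \<longlonglongrightarrow> S x"
      using S by (auto simp: sums_def)
    show "AE x in M. norm (\<Sum>j<N. g j x) \<le> D x" for N
      using le by (intro AE_I2) (rule order_trans[OF norm_sum])
  qed measurable
qed

text \<open>By strong induction the coefficients before \<open>n\<close> vanish; dividing the series
  by \<open>r ^ n\<close> and letting \<open>r\<close> tend to 0 from the right isolates
  \<open>a n\<close>. Only real positive \<open>r\<close> enter because the Mehler kernels are
  composed for such parameters.\<close>

lemma powser_coeff_zero:
  fixes a :: "nat \<Rightarrow> complex"
  assumes \<rho>: "0 < \<rho>"
    and sums: "\<And>r::real. 0 < r \<Longrightarrow> r < \<rho> \<Longrightarrow> (\<lambda>n. a n * of_real r ^ n) sums 0"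
  shows "a n = 0"
proof (induction n rule: less_induct)
  case (less n)
  have s: "(\<lambda>j. a (j + n) * of_real r ^ j) sums 0" if r: "0 < r" "r < \<rho>" for r
  proof -
    have "(\<lambda>j. a (j + n) * of_real r ^ (j + n)) sums (0 - (\<Sum>i<n. a i * of_real r ^ i))"
      by (rule sums_split_initial_segment[OF sums[OF r]])
    then have "(\<lambda>j. a (j + n) * of_real r ^ (j + n)) sums 0"
      by (simp add: less)
    from sums_mult2[OF this, of "1 / of_real r ^ n"] show ?thesis
      using r by (simp add: power_add)
  qed
  define f where "f x = (\<Sum>j. a (j + n) * x ^ j)" for x
  have "(f \<longlongrightarrow> a (0 + n)) (at 0)"
  proof (rule powser_limit_0)
    \<comment> \<open>Convergence at the single real point \<open>\<rho> / 2\<close> gives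
      convergence in the complex disc of that radius, which the limit at 0 requires.\<close>
    show "0 < \<rho> / 2" using \<rho> by simp
    fix x :: complex assume "norm x < \<rho> / 2"
    then have x: "norm x < norm (complex_of_real (\<rho> / 2))" using \<rho> by simp
    have "summable (\<lambda>j. a (j + n) * of_real (\<rho> / 2) ^ j)"
      using s[of "\<rho> / 2"] \<rho> by (intro sums_summable) simp
    from powser_inside[OF this x] have "summable (\<lambda>j. a (j + n) * x ^ j)" .
    then show "(\<lambda>j. a (j + n) * x ^ j) sums f x" by (simp add: f_def summable_sums)
  qed
  moreover have "filterlim (\<lambda>r. complex_of_real r) (at 0) (at_right 0)"
    unfolding filterlim_at
    by (auto intro!: tendsto_eq_intros simp: eventually_at_filter)
  ultimately have "((\<lambda>r. f (of_real r)) \<longlongrightarrow> a (0 + n)) (at_right 0)"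
    by (rule filterlim_compose)
  moreover have "((\<lambda>r. f (of_real r)) \<longlongrightarrow> 0) (at_right 0)"
  proof (rule tendsto_eventually)
    show "\<forall>\<^sub>F r in at_right 0. f (of_real r) = 0"
      unfolding eventually_at_right_field
      by (rule exI[of _ \<rho>]) (use \<rho> s in \<open>auto simp: f_def sums_iff\<close>)
  qed
  ultimately show ?case
    using tendsto_unique[OF trivial_limit_at_right_real] by fastforce
qed

lemma powser_coeff_unique:
  fixes a b :: "nat \<Rightarrow> complex"
  assumes "0 < \<rho>"
    and "\<And>r::real. 0 < r \<Longrightarrow> r < \<rho> \<Longrightarrow> (\<lambda>n. a n * of_real r ^ n) sums f r"
    and "\<And>r::real. 0 < r \<Longrightarrow> r < \<rho> \<Longrightarrow> (\<lambda>n. b n * of_real r ^ n) sums f r"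
  shows "a n = b n"
proof -
  have "a n - b n = 0"
  proof (rule powser_coeff_zero[OF assms(1), where a="\<lambda>n. a n - b n"])
    fix r :: real assume "0 < r" "r < \<rho>"
    from sums_diff[OF assms(2,3)[OF this]]
    show "(\<lambda>n. (a n - b n) * of_real r ^ n) sums 0" by (simp add: left_diff_distrib)
  qed
  then show ?thesis by simp
qed

section \<open>The symplectic phase, twisted kernels and their generating function\<close>

definition symp :: "complex ^ 'n::finite \<Rightarrow> complex ^ 'n \<Rightarrow> real"
  where "symp z w = Im (\<Sum>i\<in>UNIV. z $ i * cnj (w $ i))"

text \<open>Multiplication by \<open>- \<i>\<close> is an isometry that turns the symplectic form
  into the real inner product. The twisted phases thereby become the characters
  \<open>exp (\<i> * of_real (k \<bullet> w))\<close> of the Gaussian integrals.\<close>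

definition symp_dual :: "complex ^ 'n::finite \<Rightarrow> complex ^ 'n"
  where "symp_dual z = (\<chi> i. - \<i> * z $ i)"

lemma symp_eq_inner: "symp z w = symp_dual z \<bullet> w"
  by (simp add: symp_def symp_dual_def inner_vec_def inner_complex_def sum_negf[symmetric] algebra_simps flip: sum.distrib sum_subtractf)

lemma norm_symp_dual: "norm (symp_dual z) = norm z"
  by (simp add: symp_dual_def norm_vec_def norm_mult)

lemma symp_self [simp]: "symp z z = 0"
  by (simp add: symp_def complex_mult_cnj)

lemma symp_commute: "symp z w = - symp w z"
  by (simp add: symp_def sum_negf[symmetric] mult_ac)

lemma symp_diff_left: "symp (z - z') w = symp z w - symp z' w"
  by (simp add: symp_def ring_distribs sum_subtractf)

lemma continuous_on_symp [continuous_intros]: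
  "continuous_on S f \<Longrightarrow> continuous_on S g \<Longrightarrow> continuous_on S (\<lambda>x. symp (f x) (g x))"
  unfolding symp_def by (intro continuous_intros)

text \<open>With the phase \<open>exp (- \<i> l t)\<close> split off, this is the kernel of the Strichartz transform on
  the ray \<open>k\<close>, at fixed \<open>l\<close>.\<close>

definition heis_kernel :: "nat \<Rightarrow> real \<Rightarrow> complex ^ 'n::finite \<Rightarrow> complex ^ 'n \<Rightarrow> complex"
  where "heis_kernel k l w z = exp (- (\<i> * of_real (l / 2 * symp z w))) * of_real (laguerre_fun k l (w - z))"

lemma heis_e_kernel:
  "heis_e k l (heis_mult (heis_inv (z, t)) (w, 0)) = exp (- (\<i> * of_real (l * t))) * heis_kernel k l w z"
proof -
  have "l * (- t - symp z w / 2) = - (l * t) - l / 2 * symp z w"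
    by (simp add: algebra_simps)
  then have "\<i> * complex_of_real (l * (- t - symp z w / 2)) =
      - (\<i> * of_real (l * t)) + - (\<i> * of_real (l / 2 * symp z w))"
    by (simp only: of_real_diff of_real_minus) (simp add: algebra_simps)
  moreover have "snd (heis_mult (heis_inv (z, t)) (w, 0)) = - t - symp z w / 2"
    by (simp add: heis_mult_def heis_inv_def symp_def sum_negf)
  moreover have "fst (heis_mult (heis_inv (z, t)) (w, 0)) = w - z"
    by (simp add: heis_mult_def heis_inv_def)
  ultimately show ?thesis
    by (simp only: heis_e_def heis_kernel_def exp_add mult.assoc)
qed

lemma continuous_on_laguerre_fun [continuous_intros]:
  "continuous_on S f \<Longrightarrow> continuous_on S g \<Longrightarrow> continuous_on S (\<lambda>x. laguerre_fun k (f x) (g x))"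
  unfolding laguerre_fun_def by (intro continuous_intros)

lemma continuous_on_heis_kernel [continuous_intros]:
  "continuous_on S f \<Longrightarrow> continuous_on S g \<Longrightarrow> continuous_on S h \<Longrightarrow>
    continuous_on S (\<lambda>x. heis_kernel k (f x) (g x) (h x))"
  unfolding heis_kernel_def by (intro continuous_intros) auto

lemma norm_heis_kernel: "norm (heis_kernel k l w z) = \<bar>laguerre_fun k l (w - z)\<bar>"
  by (simp add: heis_kernel_def norm_mult)

text \<open>Conjugation and exchange of the arguments both reverse the phase, and the remaining
  factor is radial. The integral operators are thus formally self-adjoint, which lets a kernel
  change sides in \<open>heis_proj_inner\<close>.\<close>

lemma cnj_heis_kernel: "cnj (heis_kernel k l w z) = heis_kernel k l z w"
  by (simp add: heis_kernel_def exp_cnj symp_commute[of z w] laguerre_fun_def norm_minus_commute)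

text \<open>The closed form of the generating function in \<open>laguerre_fun_generating\<close>.
  With \<open>r = exp (- 2 * \<bar>l\<bar> * s)\<close> it is, up to constant factors, the heat
  kernel of the special Hermite operator at time \<open>s\<close>, since
  \<open>(1 + r) / (1 - r)\<close> is then the hyperbolic cotangent of
  \<open>\<bar>l\<bar> * s\<close>.\<close>

definition mehler :: "real \<Rightarrow> real \<Rightarrow> complex ^ 'n::finite \<Rightarrow> real"
  where "mehler l r z = exp (- (\<bar>l\<bar> / 4 * ((1 + r) / (1 - r)) * (norm z)\<^sup>2)) / (1 - r) ^ CARD('n)"

text \<open>For \<open>r \<ge> 0\<close>, this is the generating function with each Laguerre polynomial \<open>L\<^sub>k(x)\<close> replaced by
  \<open>L\<^sub>k(- x)\<close>, whose coefficients are non-negative; it decays only if \<open>r < 1/3\<close>.\<close>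

definition mehler_majorant :: "real \<Rightarrow> real \<Rightarrow> complex ^ 'n::finite \<Rightarrow> real"
  where "mehler_majorant l r z = exp (- (\<bar>l\<bar> / 4 * ((1 - 3 * r) / (1 - r)) * (norm z)\<^sup>2)) / (1 - r) ^ CARD('n)"

lemma laguerre_fun_generating:
  fixes z :: "complex ^ 'n::finite"
  assumes r: "\<bar>r\<bar> < 1"
  shows "(\<lambda>k. laguerre_fun k l z * r ^ k) sums mehler l r z"
proof -
  define x where "x = 1 / 2 * \<bar>l\<bar> * (norm z)\<^sup>2"
  have n: "real CARD('n) - 1 = real (CARD('n) - 1)" "CARD('n) - 1 + 1 = CARD('n)"
    using zero_less_card_finite[where 'a='n] by linarith+
  have "exp (- (x * r / (1 - r))) / (1 - r) ^ CARD('n) * exp (- (x / 2)) = mehler l r z"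
  proof -
    have "- (x * r / (1 - r)) + - (x / 2) = - (\<bar>l\<bar> / 4 * ((1 + r) / (1 - r)) * (norm z)\<^sup>2)"
      using r by (simp add: x_def field_simps)
    then show ?thesis by (simp add: mehler_def exp_add[symmetric])
  qed
  with sums_mult2[OF laguerre_generating_sums[OF r, of "CARD('n) - 1" x], of "exp (- (x / 2))"]
  show ?thesis
    unfolding laguerre_fun_def n by (simp add: x_def mult_ac)
qed

text \<open>Passing to \<open>- x\<close> makes all terms nonnegative, so partial sums lie below the
  full generating function. Its exponent together with that of \<open>exp (- (x / 2))\<close> is
  \<open>x * r / (1 - r) - x / 2\<close>, the source of the factor \<open>1 - 3 * r\<close>.\<close>

lemma sum_abs_laguerre_fun_le:
  fixes z :: "complex ^ 'n::finite"
  assumes r: "0 \<le> r" "r < 1"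
  shows "(\<Sum>k<N. \<bar>laguerre_fun k l z\<bar> * r ^ k) \<le> mehler_majorant l r z"
proof -
  define x where "x = 1 / 2 * \<bar>l\<bar> * (norm z)\<^sup>2"
  have x: "x \<ge> 0" by (simp add: x_def)
  have n: "real CARD('n) - 1 = real (CARD('n) - 1)" "CARD('n) - 1 + 1 = CARD('n)"
    using zero_less_card_finite[where 'a='n] by linarith+
  have r': "\<bar>r\<bar> < 1" using r by simp
  have "\<bar>laguerre_fun k l z\<bar> * r ^ k =
      \<bar>poly (laguerre k (real (CARD('n) - 1))) x\<bar> * r ^ k * exp (- (x / 2))" for k
    unfolding laguerre_fun_def n by (simp add: x_def abs_mult mult_ac)
  then have "(\<Sum>k<N. \<bar>laguerre_fun k l z\<bar> * r ^ k) =
      (\<Sum>k<N. \<bar>poly (laguerre k (real (CARD('n) - 1))) x\<bar> * r ^ k) * exp (- (x / 2))"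
    by (simp only: sum_distrib_right)
  also have "(\<Sum>k<N. \<bar>poly (laguerre k (real (CARD('n) - 1))) x\<bar> * r ^ k) \<le>
      (\<Sum>k<N. poly (laguerre k (real (CARD('n) - 1))) (- x) * r ^ k)"
    using r by (intro sum_mono mult_right_mono abs_laguerre_le x) auto
  also have "\<dots> \<le> exp (- (- x * r / (1 - r))) / (1 - r) ^ CARD('n)"
  proof -
    note S = laguerre_generating_sums[OF r', of "CARD('n) - 1" "- x", unfolded n(2)]
    show ?thesis
      unfolding sums_unique[OF S]
      by (rule sum_le_suminf[OF sums_summable[OF S]])
        (use r order_trans[OF abs_ge_zero abs_laguerre_le[OF x]] in \<open>auto intro!: mult_nonneg_nonneg simp del: of_nat_diff\<close>)
  qed
  also have "exp (- (- x * r / (1 - r))) / (1 - r) ^ CARD('n) * exp (- (x / 2)) = mehler_majorant l r z"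
  proof -
    have "- (- x * r / (1 - r)) + - (x / 2) = - (\<bar>l\<bar> / 4 * ((1 - 3 * r) / (1 - r)) * (norm z)\<^sup>2)"
      using r by (simp add: x_def field_simps)
    then show ?thesis by (simp add: mehler_majorant_def exp_add[symmetric])
  qed
  finally show ?thesis by (simp add: mult_right_mono)
qed

text \<open>One term of a nonnegative series is at most its sum. For any fixed
  \<open>r < 1/3\<close> and nonzero \<open>l\<close> this yields Gaussian decay of each individual
  \<open>laguerre_fun k l\<close>.\<close>

lemma abs_laguerre_fun_le:
  assumes "0 < r" "r < 1"
  shows "\<bar>laguerre_fun k l z\<bar> \<le> mehler_majorant l r z / r ^ k"
proof -
  have "\<bar>laguerre_fun k l z\<bar> * r ^ k \<le> (\<Sum>k<Suc k. \<bar>laguerre_fun k l z\<bar> * r ^ k)"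
    by (rule member_le_sum[where f="\<lambda>k. \<bar>laguerre_fun k l z\<bar> * r ^ k"]) (use assms in auto)
  also have "\<dots> \<le> mehler_majorant l r z"
    by (rule sum_abs_laguerre_fun_le) (use assms in auto)
  finally show ?thesis using assms by (simp add: field_simps)
qed

lemma mehler_majorant_nonneg: "r < 1 \<Longrightarrow> 0 \<le> mehler_majorant l r z"
  by (simp add: mehler_majorant_def)

lemma mehler_majorant_le:
  fixes z :: "complex ^ 'n::finite"
  assumes "0 < r" "r < 1/3"
  shows "mehler_majorant l r z \<le> 1 / (1 - r) ^ CARD('n)"
  using assms by (simp add: mehler_majorant_def divide_right_mono)

lemma integrable_mehler_majorant:
  fixes z :: "complex ^ 'n::finite"
  assumes "l \<noteq> 0" "0 < r" "r < 1/3"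
  shows "integrable lborel (\<lambda>w. mehler_majorant l r (w - z))"
proof -
  define a where "a = \<bar>l\<bar> / 4 * ((1 - 3 * r) / (1 - r))"
  have a: "a > 0" using assms by (simp add: a_def)
  have "has_bochner_integral lborel
      (\<lambda>x::complex^'n. complex_of_real (exp (- (a * (norm x)\<^sup>2))) * exp (\<i> * of_real (0 \<bullet> x)))
    (of_real (sqrt (pi / a) ^ DIM(complex^'n) * exp (- (norm (0::complex^'n))\<^sup>2 / (4 * a))))"
    by (rule has_bochner_integral_gaussian[OF a])
  from lborel_has_bochner_integral_translate[OF this, of "- z"]
  have "integrable lborel (\<lambda>w. complex_of_real (exp (- (a * (norm (w - z))\<^sup>2))))"
    by (simp add: has_bochner_integral_iff)
  then have "integrable lborel (\<lambda>w. exp (- (a * (norm (w - z))\<^sup>2)))"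
    by (simp only: complex_of_real_integrable_eq)
  then show ?thesis
    by (simp add: mehler_majorant_def a_def)
qed

definition mehler_kernel :: "real \<Rightarrow> real \<Rightarrow> complex ^ 'n::finite \<Rightarrow> complex ^ 'n \<Rightarrow> complex"
  where "mehler_kernel l r w z = exp (- (\<i> * of_real (l / 2 * symp z w))) * of_real (mehler l r (w - z))"

lemma norm_mehler_kernel: "norm (mehler_kernel l r w z) = \<bar>mehler l r (w - z)\<bar>"
  by (simp add: mehler_kernel_def norm_mult)

lemma mehler_bounds:
  fixes z :: "complex ^ 'n::finite"
  assumes "0 < r" "r < 1"
  shows "0 \<le> mehler l r z" and "mehler l r z \<le> 1 / (1 - r) ^ CARD('n)"
  using assms by (simp_all add: mehler_def divide_right_mono)

lemma heis_kernel_generating: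
  assumes "\<bar>r\<bar> < 1"
  shows "(\<lambda>k. heis_kernel k l w z * of_real r ^ k) sums mehler_kernel l r w z"
  using sums_mult[OF sums_of_real[OF laguerre_fun_generating[OF assms]]]
  unfolding heis_kernel_def mehler_kernel_def by (simp add: mult.assoc)

lemma sum_norm_heis_kernel_le:
  assumes "0 \<le> r" "r < 1"
  shows "(\<Sum>k<N. norm (heis_kernel k l w z * of_real r ^ k)) \<le> mehler_majorant l r (w - z)"
  using sum_abs_laguerre_fun_le[OF assms] assms by (simp add: norm_mult norm_heis_kernel norm_power)

text \<open>The semigroup law, with parameters multiplying. The integrand is a product of Gaussians
  of rates \<open>a\<close> and \<open>b\<close> centred at \<open>z'\<close> and \<open>z\<close>,
  and the two phases combine to a character with frequency \<open>k\<close>, so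
  \<open>has_bochner_integral_two_gaussians\<close> evaluates it.\<close>

lemma mehler_kernel_compose:
  fixes z z' :: "complex ^ 'n::finite"
  assumes l: "l \<noteq> 0" and r: "0 < r" "r < 1" and s: "0 < s" "s < 1"
  shows "(\<integral>w. cnj (mehler_kernel l r w z') * mehler_kernel l s w z \<partial>lborel) =
    of_real ((2 * pi / \<bar>l\<bar>) ^ CARD('n)) * mehler_kernel l (r * s) z' z"
proof -
  define L where "L = \<bar>l\<bar> / 4"
  define a where "a = L * ((1 + r) / (1 - r))"
  define b where "b = L * ((1 + s) / (1 - s))"
  define k where "k = (l / 2) *\<^sub>R symp_dual (z' - z)"
  define c where "c = complex_of_real (1 / ((1 - r) ^ CARD('n) * (1 - s) ^ CARD('n)))"
  have L: "L > 0" using l by (simp add: L_def)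
  have rs: "r * s < 1" using mult_strict_mono[of r 1 s 1] r s by simp
  have ab: "a > 0" "b > 0" using L r s by (simp_all add: a_def b_def)
  have apb: "a + b = 2 * L * (1 - r * s) / ((1 - r) * (1 - s))"
    using r s by (simp add: a_def b_def field_simps)
  have kw: "k \<bullet> w = l / 2 * (symp z' w - symp z w)" for w
    by (simp add: k_def symp_eq_inner[symmetric] symp_diff_left)
  \<comment> \<open>\<open>k\<close> has the same inner product with both centres because
    \<open>symp\<close> is alternating, so the weighted mean does not depend on the weights.\<close>
  have phase: "(a * (k \<bullet> z') + b * (k \<bullet> z)) / (a + b) = - (l / 2 * symp z z')"
  proof -
    have "a * (k \<bullet> z') + b * (k \<bullet> z) = (a + b) * (- (l / 2 * symp z z'))"
      by (simp add: kw symp_commute[of z' z] algebra_simps)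
    then show ?thesis using ab by (simp add: field_simps)
  qed
  have decay: "- (a * b / (a + b) * (norm (z' - z))\<^sup>2) - (norm k)\<^sup>2 / (4 * (a + b)) =
      - (L * ((1 + r * s) / (1 - r * s)) * (norm (z' - z))\<^sup>2)"
  proof -
    have "(norm k)\<^sup>2 / (4 * (a + b)) = L\<^sup>2 / (a + b) * (norm (z' - z))\<^sup>2"
      by (simp add: k_def norm_symp_dual L_def power_mult_distrib power_divide)
    \<comment> \<open>With \<open>a / L\<close> and \<open>b / L\<close> read as hyperbolic
      cotangents this is their addition formula. The term with \<open>L\<^sup>2\<close> is the decay
      contributed by the frequency \<open>k\<close>.\<close>
    moreover have "a * b / (a + b) + L\<^sup>2 / (a + b) = L * ((1 + r * s) / (1 - r * s))"
    proof -
      have "a * b + L\<^sup>2 = 2 * L\<^sup>2 * (1 + r * s) / ((1 - r) * (1 - s))"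
      proof -
        have "a * b = L\<^sup>2 * ((1 + r) * (1 + s)) / ((1 - r) * (1 - s))"
          by (simp add: a_def b_def power2_eq_square)
        moreover have "L\<^sup>2 = L\<^sup>2 * ((1 - r) * (1 - s)) / ((1 - r) * (1 - s))"
          using r s by simp
        moreover have "L\<^sup>2 * ((1 + r) * (1 + s)) + L\<^sup>2 * ((1 - r) * (1 - s)) = 2 * L\<^sup>2 * (1 + r * s)"
          by (simp add: algebra_simps)
        ultimately show ?thesis by (metis add_divide_distrib)
      qed
      then have "(a * b + L\<^sup>2) / (a + b) = L * ((1 + r * s) / (1 - r * s))"
        unfolding apb using L r s rs by (simp add: power2_eq_square)
      then show ?thesis by (simp add: add_divide_distrib)
    qed
    ultimately show ?thesis
      by (metis (no_types, lifting) diff_conv_add_uminus distrib_right minus_add_distrib)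
  qed
  \<comment> \<open>The real dimension is \<open>2 * CARD('n)\<close>, so the square root
    disappears; the denominators \<open>(1 - r) * (1 - s)\<close> of \<open>c\<close> cancel against
    those in \<open>a + b\<close>.\<close>
  have const: "c * of_real (sqrt (pi / (a + b)) ^ DIM(complex ^ 'n)) =
      of_real ((2 * pi / \<bar>l\<bar>) ^ CARD('n)) * of_real (1 / (1 - r * s) ^ CARD('n))"
  proof -
    have "sqrt (pi / (a + b)) ^ DIM(complex ^ 'n) = (pi / (a + b)) ^ CARD('n)"
    proof -
      have dim: "DIM(complex ^ 'n) = 2 * CARD('n)" by simp
      show ?thesis unfolding dim power_mult using ab by simp
    qed
    moreover have "1 / ((1 - r) * (1 - s)) * (pi / (a + b)) = 2 * pi / \<bar>l\<bar> * (1 / (1 - r * s))"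
    proof -
      have "1 / X * (pi / (2 * L * T / X)) = 2 * pi / \<bar>l\<bar> * (1 / T)" if "X \<noteq> 0" "T \<noteq> 0" for X T
        using that l by (simp add: L_def)
      from this[of "(1 - r) * (1 - s)" "1 - r * s"] show ?thesis unfolding apb using r s rs by simp
    qed
    then have "(1 / ((1 - r) * (1 - s)) * (pi / (a + b))) ^ CARD('n) = (2 * pi / \<bar>l\<bar> * (1 / (1 - r * s))) ^ CARD('n)"
      by (rule arg_cong)
    ultimately show ?thesis
      unfolding c_def of_real_mult[symmetric]
      by (simp only: power_mult_distrib power_one_over of_real_eq_iff)
  qed
  have "(\<integral>w. cnj (mehler_kernel l r w z') * mehler_kernel l s w z \<partial>lborel) =
     (\<integral>w. c * (of_real (exp (- (a * (norm (w - z'))\<^sup>2) - b * (norm (w - z))\<^sup>2)) * exp (\<i> * of_real (k \<bullet> w))) \<partial>lborel)"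
  proof (rule Bochner_Integration.integral_cong[OF refl])
    fix w
    have "exp (\<i> * complex_of_real (l / 2 * symp z' w)) * exp (- (\<i> * of_real (l / 2 * symp z w))) = exp (\<i> * of_real (k \<bullet> w))"
      by (simp add: kw mult_exp_exp algebra_simps)
    moreover have "mehler l r (w - z') * mehler l s (w - z) =
        (1 / ((1 - r) ^ CARD('n) * (1 - s) ^ CARD('n))) * exp (- (a * (norm (w - z'))\<^sup>2) - b * (norm (w - z))\<^sup>2)"
      by (simp add: mehler_def a_def b_def L_def exp_diff exp_minus field_simps)
    moreover have "cnj (mehler_kernel l r w z') * mehler_kernel l s w z =
       (exp (\<i> * complex_of_real (l / 2 * symp z' w)) * exp (- (\<i> * of_real (l / 2 * symp z w)))) *
       of_real (mehler l r (w - z') * mehler l s (w - z))"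
      by (simp add: mehler_kernel_def exp_cnj)
    ultimately show "cnj (mehler_kernel l r w z') * mehler_kernel l s w z =
       c * (of_real (exp (- (a * (norm (w - z'))\<^sup>2) - b * (norm (w - z))\<^sup>2)) * exp (\<i> * of_real (k \<bullet> w)))"
      by (simp only: c_def of_real_mult mult_ac)
  qed
  also have "\<dots> = c * (of_real (sqrt (pi / (a + b)) ^ DIM(complex ^ 'n) *
       exp (- (a * b / (a + b) * (norm (z' - z))\<^sup>2) - (norm k)\<^sup>2 / (4 * (a + b))))
     * exp (\<i> * of_real ((a * (k \<bullet> z') + b * (k \<bullet> z)) / (a + b))))"
    using has_bochner_integral_two_gaussians[of a b z' z k] ab
    by (intro has_bochner_integral_integral_eq has_bochner_integral_mult_right) simp
  also have "\<dots> = (c * of_real (sqrt (pi / (a + b)) ^ DIM(complex ^ 'n))) *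
     (of_real (exp (- (L * ((1 + r * s) / (1 - r * s)) * (norm (z' - z))\<^sup>2))) * exp (\<i> * of_real (- (l / 2 * symp z z'))))"
    unfolding phase decay by (simp only: of_real_mult mult.assoc)
  also have "\<dots> = of_real ((2 * pi / \<bar>l\<bar>) ^ CARD('n)) * mehler_kernel l (r * s) z' z"
    unfolding const by (simp add: mehler_kernel_def mehler_def L_def)
  finally show ?thesis .
qed

text \<open>Both sides are the coefficient of \<open>r\<^sup>k s\<^sup>k\<close> in the composition law for Mehler kernels.\<close>

lemma heis_kernel_compose:
  fixes z z' :: "complex ^ 'n::finite"
  assumes l: "l \<noteq> 0"
  shows "(\<integral>w. cnj (heis_kernel k l w z') * heis_kernel k l w z \<partial>lborel) =
    of_real ((2 * pi / \<bar>l\<bar>) ^ CARD('n)) * heis_kernel k l z' z"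
proof -
  define C where "C = complex_of_real ((2 * pi / \<bar>l\<bar>) ^ CARD('n))"
  have meas: "(\<lambda>w. heis_kernel k l w z) \<in> borel_measurable borel" for k and z :: "complex ^ 'n"
    by (intro borel_measurable_continuous_onI continuous_intros)
  have meas': "(\<lambda>w. cnj (heis_kernel k l w z)) \<in> borel_measurable borel" for k and z :: "complex ^ 'n"
    unfolding cnj_heis_kernel by (intro borel_measurable_continuous_onI continuous_intros)
  have measM: "(\<lambda>w. mehler_kernel l s w z) \<in> borel_measurable borel" for s and z :: "complex ^ 'n"
  proof -
    have [measurable]: "(\<lambda>w. exp (- (\<i> * complex_of_real (l / 2 * symp z w)))) \<in> borel_measurable borel"
      by (intro borel_measurable_continuous_onI continuous_intros) auto
    have [measurable]: "(\<lambda>w. mehler l s (w - z)) \<in> borel_measurable borel"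
      unfolding mehler_def by measurable
    show ?thesis unfolding mehler_kernel_def by measurable
  qed
  have norm_le: "norm (mehler_kernel l s w z) \<le> 1 / (1 - s) ^ CARD('n)" if "0 < s" "s < 1" for s w and z :: "complex ^ 'n"
    using that mehler_bounds[of s l "w - z"] by (simp add: norm_mehler_kernel)
  define b where "b j s = (\<integral>w. cnj (heis_kernel j l w z') * mehler_kernel l s w z \<partial>lborel)" for j s
  \<comment> \<open>Comparison of coefficients of \<open>r ^ j\<close> with \<open>s\<close> fixed.
    The radius \<open>1/3\<close> is the range in which the majorant is integrable.\<close>
  have 1: "b j s = C * heis_kernel j l z' z * of_real s ^ j" if s: "0 < s" "s < 1/3" for j s
  proof (rule powser_coeff_unique[where \<rho>="1/3"])
    fix r :: real assume r: "0 < r" "r < 1/3"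
    have rs: "\<bar>r * s\<bar> < 1" using mult_strict_mono[of r 1 s 1] r s by (simp add: abs_mult)
    have "(\<lambda>j. \<integral>w. cnj (heis_kernel j l w z' * of_real r ^ j) * mehler_kernel l s w z \<partial>lborel) sums
        (\<integral>w. cnj (mehler_kernel l r w z') * mehler_kernel l s w z \<partial>lborel)"
    proof (rule sums_integral_dominated(2))
      show "integrable lborel (\<lambda>w. mehler_majorant l r (w - z') * (1 / (1 - s) ^ CARD('n)))"
        using integrable_mehler_majorant[OF l r] by (rule integrable_mult_left)
      show "(\<Sum>j<N. norm (cnj (heis_kernel j l w z' * of_real r ^ j) * mehler_kernel l s w z))
          \<le> mehler_majorant l r (w - z') * (1 / (1 - s) ^ CARD('n))" for w N
        unfolding norm_mult[of "cnj _"] complex_mod_cnj sum_distrib_right[symmetric]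
        using r s by (intro mult_mono sum_norm_heis_kernel_le norm_le mehler_majorant_nonneg sum_nonneg) auto
      show "(\<lambda>j. cnj (heis_kernel j l w z' * of_real r ^ j) * mehler_kernel l s w z) sums
          (cnj (mehler_kernel l r w z') * mehler_kernel l s w z)" for w
        using r by (intro sums_mult2 sums_cnj[THEN iffD2] heis_kernel_generating) auto
      show "(\<lambda>w. cnj (heis_kernel j l w z' * of_real r ^ j) * mehler_kernel l s w z) \<in> borel_measurable lborel" for j
        using meas' measM by simp
    qed
    then show "(\<lambda>j. b j s * of_real r ^ j) sums (C * mehler_kernel l (r * s) z' z)"
      using mehler_kernel_compose[OF l, of r s z' z] r s
      by (simp add: b_def C_def mult_ac)
    show "(\<lambda>j. C * heis_kernel j l z' z * of_real s ^ j * of_real r ^ j) sums (C * mehler_kernel l (r * s) z' z)"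
      using sums_mult[OF heis_kernel_generating[OF rs], of C l z' z] by (simp add: power_mult_distrib mult_ac)
  qed simp
  \<comment> \<open>A second comparison, now in \<open>s\<close> with \<open>j = k\<close> fixed.
    Since \<open>1\<close> has a single monomial on the right, the coefficients with
    \<open>i \<noteq> k\<close> vanish, so different kernels are orthogonal.\<close>
  have "(\<integral>w. cnj (heis_kernel k l w z') * heis_kernel i l w z \<partial>lborel) =
      (if i = k then C * heis_kernel k l z' z else 0)" for i
  proof (rule powser_coeff_unique[where \<rho>="1/3" and n=i
        and a="\<lambda>i. \<integral>w. cnj (heis_kernel k l w z') * heis_kernel i l w z \<partial>lborel"
        and b="\<lambda>i. if i = k then C * heis_kernel k l z' z else 0"])
    fix s :: real assume s: "0 < s" "s < 1/3"
    have "(\<lambda>i. \<integral>w. cnj (heis_kernel k l w z') * (heis_kernel i l w z * of_real s ^ i) \<partial>lborel) sums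
        (\<integral>w. cnj (heis_kernel k l w z') * mehler_kernel l s w z \<partial>lborel)"
    proof (rule sums_integral_dominated(2))
      show "integrable lborel (\<lambda>w. mehler_majorant l s (w - z') / s ^ k * (1 / (1 - s) ^ CARD('n)))"
        using integrable_mehler_majorant[OF l s] by (intro integrable_mult_left integrable_divide)
      show "(\<Sum>i<N. norm (cnj (heis_kernel k l w z') * (heis_kernel i l w z * of_real s ^ i)))
          \<le> mehler_majorant l s (w - z') / s ^ k * (1 / (1 - s) ^ CARD('n))" for w N
        unfolding norm_mult[of "cnj _"] complex_mod_cnj sum_distrib_left[symmetric] norm_heis_kernel[of k]
        using s by (intro mult_mono abs_laguerre_fun_le divide_nonneg_nonneg
            order_trans[OF sum_norm_heis_kernel_le mehler_majorant_le] mehler_majorant_nonneg sum_nonneg) auto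
      show "(\<lambda>i. cnj (heis_kernel k l w z') * (heis_kernel i l w z * of_real s ^ i)) sums
          (cnj (heis_kernel k l w z') * mehler_kernel l s w z)" for w
        using s by (intro sums_mult heis_kernel_generating) auto
      show "(\<lambda>w. cnj (heis_kernel k l w z') * (heis_kernel i l w z * of_real s ^ i)) \<in> borel_measurable lborel" for i
        using meas meas' by simp
    qed
    then show "(\<lambda>i. (\<integral>w. cnj (heis_kernel k l w z') * heis_kernel i l w z \<partial>lborel) * of_real s ^ i) sums
        (C * heis_kernel k l z' z * of_real s ^ k)"
      using 1[OF s, of k] by (simp add: b_def mult.assoc[symmetric])
    have "(\<lambda>i. if i = k then C * heis_kernel k l z' z * of_real s ^ i else 0) sums (C * heis_kernel k l z' z * of_real s ^ k)"
      by (rule sums_single)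
    then show "(\<lambda>i. (if i = k then C * heis_kernel k l z' z else 0) * of_real s ^ i) sums
        (C * heis_kernel k l z' z * of_real s ^ k)"
      by (rule sums_cong[THEN iffD1, rotated]) auto
  qed simp
  then show ?thesis by (simp add: C_def)
qed


section \<open>The spectral inequality at a fixed frequency\<close>

lemma integrable_pair_bound:
  fixes f :: "'a::euclidean_space \<times> 'b::euclidean_space \<Rightarrow> 'c::{banach,second_countable_topology}"
  assumes f: "f \<in> borel_measurable borel"
    and u: "integrable lborel u" and v: "integrable lborel v"
    and le: "\<And>x y. norm (f (x, y)) \<le> u x * v y"
  shows "integrable (lborel \<Otimes>\<^sub>M lborel) f"
proof (rule Bochner_Integration.integrable_bound[where f="\<lambda>(x, y). u x * v y"])
  have [measurable]: "u \<in> borel_measurable borel" "v \<in> borel_measurable borel"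
    using u v by auto
  have m: "(\<lambda>(x, y). u x * v y) \<in> borel_measurable (lborel \<Otimes>\<^sub>M lborel)"
    by measurable
  show "integrable (lborel \<Otimes>\<^sub>M lborel) (\<lambda>(x, y). u x * v y)"
  proof (rule lborel_pair.Fubini_integrable[OF m])
    show "integrable lborel (\<lambda>x. \<integral>y. norm (case (x, y) of (x, y) \<Rightarrow> u x * v y) \<partial>lborel)"
      using u v by (simp add: abs_mult)
    show "AE x in lborel. integrable lborel (\<lambda>y. case (x, y) of (x, y) \<Rightarrow> u x * v y)"
      using v by simp
  qed
  show "f \<in> borel_measurable (lborel \<Otimes>\<^sub>M lborel)"
    using f by (simp add: lborel_prod)
  show "AE x in lborel \<Otimes>\<^sub>M lborel. norm (f x) \<le> norm (case x of (x, y) \<Rightarrow> u x * v y)"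
    using le by (auto intro!: AE_I2 order_trans[OF _ abs_ge_self])
qed

lemma lborel_integral_affine:
  fixes f :: "'a::euclidean_space \<Rightarrow> 'b::{banach,second_countable_topology}"
  assumes f[measurable]: "f \<in> borel_measurable borel" and c: "c \<noteq> 0"
  shows "(\<integral>x. f x \<partial>lborel) = \<bar>c\<bar> ^ DIM('a) *\<^sub>R (\<integral>x. f (t + c *\<^sub>R x) \<partial>lborel)"
proof -
  have "(\<integral>x. f x \<partial>lborel) = (\<integral>x. f x \<partial>density (distr lborel borel (\<lambda>x. t + c *\<^sub>R x)) (\<lambda>_. ennreal (\<bar>c\<bar> ^ DIM('a))))"
    using lborel_affine[OF c, of t] by (simp add: ennreal_power)
  also have "\<dots> = (\<integral>x. \<bar>c\<bar> ^ DIM('a) *\<^sub>R f x \<partial>distr lborel borel (\<lambda>x. t + c *\<^sub>R x))"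
    by (rule integral_density) auto
  also have "\<dots> = \<bar>c\<bar> ^ DIM('a) *\<^sub>R (\<integral>x. f (t + c *\<^sub>R x) \<partial>lborel)"
    by (subst integral_distr) auto
  finally show ?thesis .
qed

lemma has_bochner_integral_exp_neg_norm:
  assumes "0 < a"
  shows "has_bochner_integral lborel (\<lambda>x::'a::euclidean_space. exp (- (a * (norm (x - y))\<^sup>2))) (sqrt (pi / a) ^ DIM('a))"
proof -
  have "has_bochner_integral lborel (\<lambda>x::'a. complex_of_real (exp (- (a * (norm x)\<^sup>2))) * exp (\<i> * of_real (0 \<bullet> x)))
    (of_real (sqrt (pi / a) ^ DIM('a) * exp (- (norm (0::'a))\<^sup>2 / (4 * a))))"
    by (rule has_bochner_integral_gaussian[OF assms])
  from lborel_has_bochner_integral_translate[OF this, of "- y"]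
  have "has_bochner_integral lborel (\<lambda>x::'a. complex_of_real (exp (- (a * (norm (x - y))\<^sup>2))))
    (of_real (sqrt (pi / a) ^ DIM('a)))" by simp
  then show ?thesis
    unfolding has_bochner_integral_iff complex_of_real_integrable_eq integral_complex_of_real of_real_eq_iff .
qed

text \<open>The substitution \<open>z = w + (1 / sqrt (\<beta> n)) *\<^sub>R v\<close> moves the
  dependence on \<open>n\<close> from the Gaussian into \<open>g\<close>. Boundedness of
  \<open>g\<close> then gives the dominating function, and continuity at \<open>w\<close> the
  pointwise limit.\<close>

lemma gaussian_approximate_identity:
  fixes g :: "'a::euclidean_space \<Rightarrow> complex"
  assumes g[measurable]: "g \<in> borel_measurable borel"
    and B: "\<And>x. norm (g x) \<le> B" and cont: "isCont g w"
    and \<beta>: "filterlim \<beta> at_top sequentially" and pos: "\<And>n. 0 < \<beta> n"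
  shows "(\<lambda>n. of_real (sqrt (\<beta> n / pi) ^ DIM('a)) * (\<integral>z. of_real (exp (- (\<beta> n * (norm (z - w))\<^sup>2))) * g z \<partial>lborel))
    \<longlonglongrightarrow> g w"
proof -
  define E where "E v = exp (- (norm v)\<^sup>2)" for v :: 'a
  have E: "has_bochner_integral lborel E (sqrt pi ^ DIM('a))"
    using has_bochner_integral_exp_neg_norm[of 1 "0::'a"] by (simp add: E_def[abs_def])
  have [measurable]: "E \<in> borel_measurable borel" by (simp add: E_def[abs_def])
  have eq: "of_real (sqrt (\<beta> n / pi) ^ DIM('a)) * (\<integral>z. of_real (exp (- (\<beta> n * (norm (z - w))\<^sup>2))) * g z \<partial>lborel)
     = of_real (1 / sqrt pi ^ DIM('a)) * (\<integral>v. of_real (E v) * g (w + (1 / sqrt (\<beta> n)) *\<^sub>R v) \<partial>lborel)" for n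
  proof -
    have "(\<integral>z. of_real (exp (- (\<beta> n * (norm (z - w))\<^sup>2))) * g z \<partial>lborel) =
       \<bar>1 / sqrt (\<beta> n)\<bar> ^ DIM('a) *\<^sub>R (\<integral>v. of_real (exp (- (\<beta> n * (norm ((w + (1 / sqrt (\<beta> n)) *\<^sub>R v) - w))\<^sup>2))) * g (w + (1 / sqrt (\<beta> n)) *\<^sub>R v) \<partial>lborel)"
      by (rule lborel_integral_affine) (use pos[of n] in auto)
    also have "(\<integral>v. of_real (exp (- (\<beta> n * (norm ((w + (1 / sqrt (\<beta> n)) *\<^sub>R v) - w))\<^sup>2))) * g (w + (1 / sqrt (\<beta> n)) *\<^sub>R v) \<partial>lborel)
       = (\<integral>v. of_real (E v) * g (w + (1 / sqrt (\<beta> n)) *\<^sub>R v) \<partial>lborel)"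
      using pos[of n] by (intro Bochner_Integration.integral_cong refl)
        (simp add: E_def power_mult_distrib power_divide)
    finally show ?thesis
      using pos[of n] by (simp add: scaleR_conv_of_real power_divide real_sqrt_divide)
  qed
  have "(\<lambda>n. \<integral>v. of_real (E v) * g (w + (1 / sqrt (\<beta> n)) *\<^sub>R v) \<partial>lborel) \<longlonglongrightarrow>
      (\<integral>v. of_real (E v) * g w \<partial>lborel)"
  proof (rule integral_dominated_convergence)
    show "integrable lborel (\<lambda>v. E v * B)"
      using E by (intro integrable_mult_left) (simp add: has_bochner_integral_iff)
    have "(\<lambda>n. 1 / sqrt (\<beta> n)) \<longlonglongrightarrow> 0"
      by (intro tendsto_divide_0[OF tendsto_const] filterlim_at_top_imp_at_infinity
          filterlim_compose[OF sqrt_at_top \<beta>])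
    from tendsto_add[OF tendsto_const tendsto_scaleR[OF this tendsto_const]]
    have "(\<lambda>n. w + (1 / sqrt (\<beta> n)) *\<^sub>R v) \<longlonglongrightarrow> w" for v
      by force
    from isCont_tendsto_compose[OF cont this]
    show "AE v in lborel. (\<lambda>n. of_real (E v) * g (w + (1 / sqrt (\<beta> n)) *\<^sub>R v)) \<longlonglongrightarrow> of_real (E v) * g w"
      by (intro AE_I2 tendsto_mult tendsto_const)
    show "AE v in lborel. norm (of_real (E v) * g (w + (1 / sqrt (\<beta> n)) *\<^sub>R v)) \<le> E v * B" for n
      using B by (intro AE_I2) (simp add: norm_mult E_def)
  qed measurable
  also have "(\<integral>v. of_real (E v) * g w \<partial>lborel) = of_real (sqrt pi ^ DIM('a)) * g w"
    using E by (simp add: has_bochner_integral_iff)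
  finally have "(\<lambda>n. of_real (1 / sqrt pi ^ DIM('a)) * (\<integral>v. of_real (E v) * g (w + (1 / sqrt (\<beta> n)) *\<^sub>R v) \<partial>lborel))
      \<longlonglongrightarrow> of_real (1 / sqrt pi ^ DIM('a)) * (of_real (sqrt pi ^ DIM('a)) * g w)"
    by (intro tendsto_mult tendsto_const)
  then show ?thesis unfolding eq by simp
qed

lemma borel_measurable_cnj [measurable (raw)]:
  "f \<in> borel_measurable M \<Longrightarrow> (\<lambda>x. cnj (f x)) \<in> borel_measurable M"
  by (rule measurable_compose[OF _ borel_measurable_continuous_onI]) (auto intro!: continuous_intros)

section \<open>Continuous functions of compact support\<close>

definition Cc :: "('a::euclidean_space \<Rightarrow> complex) set"
  where "Cc = {f. continuous_on UNIV f \<and> (\<exists>K. compact K \<and> (\<forall>x. x \<notin> K \<longrightarrow> f x = 0))}"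

lemma CcI: "continuous_on UNIV f \<Longrightarrow> compact K \<Longrightarrow> (\<And>x. x \<notin> K \<Longrightarrow> f x = 0) \<Longrightarrow> f \<in> Cc"
  by (auto simp: Cc_def)

lemma Cc_isCont: "f \<in> Cc \<Longrightarrow> isCont f x"
  by (simp add: Cc_def continuous_on_eq_continuous_at)

lemma Cc_measurable: "f \<in> Cc \<Longrightarrow> f \<in> borel_measurable borel"
  by (auto simp: Cc_def intro: borel_measurable_continuous_onI)

lemma Cc_integrable:
  assumes "f \<in> Cc"
  shows "integrable lborel f"
proof -
  obtain K where K: "compact K" "\<And>x. x \<notin> K \<Longrightarrow> f x = 0" "continuous_on UNIV f"
    using assms by (auto simp: Cc_def)
  have "integrable lborel (\<lambda>x. indicator K x *\<^sub>R f x)"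
    by (rule borel_integrable_compact[OF K(1)]) (rule continuous_on_subset[OF K(3)], simp)
  moreover have "(\<lambda>x. indicator K x *\<^sub>R f x) = f"
    using K(2) by (auto simp: fun_eq_iff indicator_def)
  ultimately show ?thesis by simp
qed

lemma Cc_bounded:
  assumes "f \<in> Cc"
  obtains B where "0 \<le> B" "\<And>x. norm (f x) \<le> B"
proof -
  obtain K where K: "compact K" "\<And>x. x \<notin> K \<Longrightarrow> f x = 0" "continuous_on UNIV f"
    using assms by (auto simp: Cc_def)
  have "bounded (f ` K)"
    by (intro compact_imp_bounded compact_continuous_image K continuous_on_subset[OF K(3)]) simp
  then obtain B where B: "\<And>x. x \<in> K \<Longrightarrow> norm (f x) \<le> B" by (auto simp: bounded_iff)
  have "norm (f x) \<le> max 0 B" for x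
    using B[of x] K(2)[of x] by (cases "x \<in> K") auto
  then show ?thesis by (intro that[of "max 0 B"]) auto
qed

lemma Cc_support:
  assumes "f \<in> Cc"
  obtains R where "0 < R" "\<And>x. R < norm x \<Longrightarrow> f x = 0"
proof -
  obtain K where K: "compact K" "\<And>x. x \<notin> K \<Longrightarrow> f x = 0"
    using assms by (auto simp: Cc_def)
  obtain R where "R > 0" "\<And>x. x \<in> K \<Longrightarrow> norm x \<le> R"
    using compact_imp_bounded[OF K(1)] by (auto simp: bounded_pos)
  then show ?thesis using K(2) by (intro that[of R]) (auto simp: not_le[symmetric])
qed

section \<open>The operators given by the Laguerre kernels\<close>

text \<open>For \<open>l \<noteq> 0\<close>, \<open>(\<bar>l\<bar> / (2 * pi)) ^ CARD('n)\<close>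
  times this operator is the spectral projection of the special Hermite operator for the eigenvalue
  \<open>(2k + n)|l|\<close>, where \<open>n = CARD('n)\<close>. The factor is left out because the
  Strichartz transform uses the bare kernel.\<close>

definition heis_proj :: "nat \<Rightarrow> real \<Rightarrow> (complex ^ 'n::finite \<Rightarrow> complex) \<Rightarrow> complex ^ 'n \<Rightarrow> complex"
  where "heis_proj k l H w = (\<integral>z. heis_kernel k l w z * H z \<partial>lborel)"

lemma heis_kernel_bounds:
  fixes l :: real
  assumes l: "l \<noteq> 0"
  obtains B and D :: "complex ^ 'n::finite \<Rightarrow> real"
  where "0 \<le> B" "\<And>w z. norm (heis_kernel k l w z :: complex) \<le> D (w - z)" "\<And>z. D z \<le> B" "\<And>z. 0 \<le> D z"
    "\<And>z. integrable lborel (\<lambda>w. D (w - z))"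
proof
  \<comment> \<open>The value \<open>1/6\<close> is an arbitrary choice between 0 and
    \<open>1/3\<close>.\<close>
  let ?D = "\<lambda>z::complex ^ 'n. mehler_majorant l (1/6) z / (1/6) ^ k"
  show "norm (heis_kernel k l w z :: complex) \<le> ?D (w - z)" for w z
    unfolding norm_heis_kernel by (rule abs_laguerre_fun_le) auto
  show "?D z \<le> 1 / (1 - 1/6) ^ CARD('n) / (1/6) ^ k" for z
    by (intro divide_right_mono mehler_majorant_le) auto
  show "0 \<le> ?D z" for z by (simp add: mehler_majorant_nonneg)
  show "integrable lborel (\<lambda>w. ?D (w - z))" for z
    by (intro integrable_divide integrable_mehler_majorant l) auto
  show "0 \<le> 1 / (1 - 1/6 :: real) ^ CARD('n) / (1/6) ^ k" by simp
qed

lemma measurable_heis_kernel_pair: "(\<lambda>(w, z). heis_kernel k l w z) \<in> borel_measurable borel"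
  by (intro borel_measurable_continuous_onI) (auto simp: case_prod_beta intro!: continuous_intros)

lemma measurable_heis_kernel_compose [measurable (raw)]:
  assumes f: "f \<in> M \<rightarrow>\<^sub>M borel" and g: "g \<in> M \<rightarrow>\<^sub>M borel"
  shows "(\<lambda>x. heis_kernel k l (f x) (g x)) \<in> borel_measurable M"
proof -
  have "(\<lambda>x. (f x, g x)) \<in> M \<rightarrow>\<^sub>M borel"
    unfolding borel_prod[symmetric] using f g by measurable
  from measurable_compose[OF this measurable_heis_kernel_pair] show ?thesis by simp
qed

text \<open>The envelope \<open>D\<close> depends on \<open>w - z\<close> only, so by translation
  invariance the kernel has \<open>w\<close>-integrals bounded uniformly in \<open>z\<close>; Fubini
  in the order \<open>w\<close>, then \<open>z\<close>, gives integrability as for a convolution of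
  integrable functions.\<close>

lemma heis_proj_integrable:
  fixes H :: "complex ^ 'n::finite \<Rightarrow> complex"
  assumes l: "l \<noteq> 0" and H: "H \<in> Cc"
  shows "integrable lborel (heis_proj k l H)"
    and "integrable lborel (\<lambda>z. heis_kernel k l w z * H z)"
proof -
  obtain B D where B: "0 \<le> B" and D: "\<And>w z :: complex ^ 'n. norm (heis_kernel k l w z :: complex) \<le> D (w - z)"
    "\<And>z. D z \<le> B" "\<And>z. 0 \<le> D z" "\<And>z. integrable lborel (\<lambda>w. D (w - z))"
    using heis_kernel_bounds[OF l] by metis
  note [measurable] = Cc_measurable[OF H]
  have KB: "norm (heis_kernel k l w z) \<le> B" for w z :: "complex ^ 'n"
    using D(1,2) by (rule order_trans)
  show "integrable lborel (\<lambda>z. heis_kernel k l w z * H z)" for w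
  proof (rule Bochner_Integration.integrable_bound)
    show "integrable lborel (\<lambda>z. B * norm (H z))"
      by (intro integrable_mult_right integrable_norm Cc_integrable H)
    show "AE z in lborel. norm (heis_kernel k l w z * H z) \<le> norm (B * norm (H z))"
      using KB B by (auto simp: norm_mult abs_mult intro!: AE_I2 mult_right_mono)
  qed measurable
  have K: "integrable lborel (\<lambda>w. heis_kernel k l w z)" for z :: "complex ^ 'n"
    by (rule Bochner_Integration.integrable_bound[OF D(4)[of z]])
      (auto intro!: AE_I2 order_trans[OF D(1) abs_ge_self])
  have "integrable (lborel \<Otimes>\<^sub>M lborel) (\<lambda>(z, w). heis_kernel k l w z * H z)"
  proof (rule lborel_pair.Fubini_integrable)
    have le: "(\<integral>w. norm (heis_kernel k l w z) \<partial>lborel) \<le> (\<integral>w. D w \<partial>lborel)" for z :: "complex ^ 'n"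
    proof -
      have "(\<integral>w. norm (heis_kernel k l w z) \<partial>lborel) \<le> (\<integral>w. D (w - z) \<partial>lborel)"
        by (rule integral_mono[OF integrable_norm[OF K] D(4)]) (rule D(1))
      also have "\<dots> = (\<integral>w. D w \<partial>lborel)"
      proof -
        have "has_bochner_integral lborel D (\<integral>w. D w \<partial>lborel)"
          using D(4)[of 0] by (simp add: has_bochner_integral_iff)
        from lborel_has_bochner_integral_translate[OF this, of "- z"] show ?thesis
          by (simp add: has_bochner_integral_iff)
      qed
      finally show ?thesis .
    qed
    show "integrable lborel (\<lambda>z. \<integral>w. norm (case (z, w) of (z, w) \<Rightarrow> heis_kernel k l w z * H z) \<partial>lborel)"
    proof (rule Bochner_Integration.integrable_bound)
      show "integrable lborel (\<lambda>z. (\<integral>w. D w \<partial>lborel) * norm (H z))"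
        by (intro integrable_mult_right integrable_norm Cc_integrable H)
      show "AE z in lborel. norm (\<integral>w. norm (case (z, w) of (z, w) \<Rightarrow> heis_kernel k l w z * H z) \<partial>lborel)
          \<le> norm ((\<integral>w. D w \<partial>lborel) * norm (H z))"
        using le D(3) by (intro AE_I2) (auto simp: norm_mult abs_mult integral_nonneg_AE intro!: mult_right_mono)
    qed measurable
    show "AE z in lborel. integrable lborel (\<lambda>w. case (z, w) of (z, w) \<Rightarrow> heis_kernel k l w z * H z)"
      using K by (intro AE_I2) simp
  qed measurable
  then show "integrable lborel (heis_proj k l H)"
    using lborel_pair.integrable_snd[of "\<lambda>z w. heis_kernel k l w z * H z"]
    by (simp add: heis_proj_def[abs_def])
qed

text \<open>The reproducing law \<open>heis_kernel_compose\<close> puts a second kernel in front of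
  \<open>heis_proj k l H\<close> (step \<open>1\<close>), and Fubini with Hermitian symmetry moves
  that kernel onto \<open>G\<close>.\<close>

lemma heis_proj_inner:
  fixes H G :: "complex ^ 'n::finite \<Rightarrow> complex"
  assumes l: "l \<noteq> 0" and H: "H \<in> Cc" and G: "G \<in> Cc"
  shows "of_real ((2 * pi / \<bar>l\<bar>) ^ CARD('n)) * (\<integral>w. heis_proj k l H w * cnj (G w) \<partial>lborel) =
    (\<integral>x. heis_proj k l H x * cnj (heis_proj k l G x) \<partial>lborel)"
proof -
  obtain B D where B: "0 \<le> B" and D: "\<And>w z :: complex ^ 'n. norm (heis_kernel k l w z :: complex) \<le> D (w - z)"
    "\<And>z. D z \<le> B" "\<And>z. 0 \<le> D z" "\<And>z. integrable lborel (\<lambda>w. D (w - z))"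
    using heis_kernel_bounds[OF l] by metis
  note [measurable] = Cc_measurable[OF H] Cc_measurable[OF G]
  have KB: "norm (heis_kernel k l w z) \<le> B" for w z :: "complex ^ 'n"
    using D(1,2) by (rule order_trans)
  have [measurable]: "heis_proj k l H \<in> borel_measurable borel"
    using heis_proj_integrable(1)[OF l H] by (auto dest: borel_measurable_integrable)
  define C where "C = complex_of_real ((2 * pi / \<bar>l\<bar>) ^ CARD('n))"
  have 1: "C * heis_proj k l H z' = (\<integral>x. heis_kernel k l z' x * heis_proj k l H x \<partial>lborel)" for z'
  proof -
    have "C * heis_proj k l H z' = (\<integral>z. C * heis_kernel k l z' z * H z \<partial>lborel)"
      by (simp add: heis_proj_def mult.assoc)
    also have "\<dots> = (\<integral>z. (\<integral>x. heis_kernel k l z' x * heis_kernel k l x z * H z \<partial>lborel) \<partial>lborel)"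
      unfolding C_def heis_kernel_compose[OF l, symmetric] cnj_heis_kernel by simp
    also have "\<dots> = (\<integral>x. (\<integral>z. heis_kernel k l z' x * heis_kernel k l x z * H z \<partial>lborel) \<partial>lborel)"
    proof (rule lborel_pair.Fubini_integral, rule integrable_pair_bound)
      show "(\<lambda>(x, z). heis_kernel k l z' x * heis_kernel k l x z * H z) \<in> borel_measurable borel"
        unfolding borel_prod[symmetric] by measurable
      show "integrable lborel (\<lambda>x. D (x - z'))" by (rule D(4))
      show "integrable lborel (\<lambda>z. B * norm (H z))"
        by (intro integrable_mult_right integrable_norm Cc_integrable H)
      fix x z
      have "norm (heis_kernel k l z' x) \<le> D (x - z')"
        using D(1)[of x z'] by (simp add: cnj_heis_kernel[of _ _ x z', symmetric])
      then have "norm (heis_kernel k l z' x) * norm (heis_kernel k l x z) * norm (H z) \<le> D (x - z') * B * norm (H z)"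
        using KB D(3) by (intro mult_right_mono mult_mono) auto
      then show "norm (case (x, z) of (x, z) \<Rightarrow> heis_kernel k l z' x * heis_kernel k l x z * H z) \<le> D (x - z') * (B * norm (H z))"
        by (simp add: norm_mult mult.assoc)
    qed
    also have "\<dots> = (\<integral>x. heis_kernel k l z' x * heis_proj k l H x \<partial>lborel)"
      by (simp add: heis_proj_def mult.assoc)
    finally show ?thesis .
  qed
  have "C * (\<integral>w. heis_proj k l H w * cnj (G w) \<partial>lborel) = (\<integral>w. C * heis_proj k l H w * cnj (G w) \<partial>lborel)"
    by (simp add: mult.assoc)
  also have "\<dots> = (\<integral>w. (\<integral>x. heis_kernel k l w x * heis_proj k l H x * cnj (G w) \<partial>lborel) \<partial>lborel)"
    unfolding 1 by simp
  also have "\<dots> = (\<integral>x. (\<integral>w. heis_kernel k l w x * heis_proj k l H x * cnj (G w) \<partial>lborel) \<partial>lborel)"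
  proof (rule lborel_pair.Fubini_integral, rule integrable_pair_bound)
    show "(\<lambda>(x, w). heis_kernel k l w x * heis_proj k l H x * cnj (G w)) \<in> borel_measurable borel"
      unfolding borel_prod[symmetric] by measurable
    show "integrable lborel (\<lambda>x. norm (heis_proj k l H x))"
      by (intro integrable_norm heis_proj_integrable l H)
    show "integrable lborel (\<lambda>w. B * norm (G w))"
      by (intro integrable_mult_right integrable_norm Cc_integrable G)
    fix x w
    have "norm (heis_kernel k l w x) * (norm (heis_proj k l H x) * norm (G w)) \<le> B * (norm (heis_proj k l H x) * norm (G w))"
      using KB by (intro mult_right_mono) auto
    then show "norm (case (x, w) of (x, w) \<Rightarrow> heis_kernel k l w x * heis_proj k l H x * cnj (G w)) \<le> norm (heis_proj k l H x) * (B * norm (G w))"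
      by (simp add: norm_mult mult_ac)
  qed
  also have "\<dots> = (\<integral>x. heis_proj k l H x * cnj (heis_proj k l G x) \<partial>lborel)"
  proof (rule Bochner_Integration.integral_cong[OF refl])
    fix x
    have "(\<integral>w. cnj (heis_kernel k l x w * G w) \<partial>lborel) = cnj (heis_proj k l G x)"
      unfolding heis_proj_def by (rule Bochner_Integration.integral_cnj)
    then have "cnj (heis_proj k l G x) = (\<integral>w. heis_kernel k l w x * cnj (G w) \<partial>lborel)"
      by (simp add: cnj_heis_kernel)
    then show "(\<integral>w. heis_kernel k l w x * heis_proj k l H x * cnj (G w) \<partial>lborel) = heis_proj k l H x * cnj (heis_proj k l G x)"
      by (simp add: mult_ac flip: integral_mult_right_zero)
  qed
  finally show ?thesis by (simp add: C_def)
qed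

section \<open>Abel means of these operators and the spectral inequality\<close>

definition mehler_op :: "real \<Rightarrow> real \<Rightarrow> (complex ^ 'n::finite \<Rightarrow> complex) \<Rightarrow> complex ^ 'n \<Rightarrow> complex"
  where "mehler_op l r H w = (\<integral>z. mehler_kernel l r w z * H z \<partial>lborel)"

lemma ennreal_norm_suminf_le:
  fixes a :: "nat \<Rightarrow> 'a::banach"
  assumes "a sums s"
  shows "ennreal (norm s) \<le> (\<Sum>n. ennreal (norm (a n)))"
proof (cases "(\<Sum>n. ennreal (norm (a n))) = \<infinity>")
  case False
  then have "summable (\<lambda>n. norm (a n))"
    by (intro summable_suminf_not_top) auto
  moreover from summable_norm[OF this] have "norm s \<le> (\<Sum>n. norm (a n))"
    using assms by (simp add: sums_iff)
  ultimately show ?thesis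
    by (simp add: suminf_ennreal2 ennreal_leI)
qed simp

text \<open>The majorant grows for \<open>r > 1/3\<close>, but the supports of \<open>H\<close> and
  \<open>G\<close> confine \<open>w - z\<close> to a bounded set, on which it stays below a
  constant. Dominated summation is then available for every \<open>r < 1\<close>, first in the
  \<open>z\<close>-integral and then in the \<open>w\<close>-integral.\<close>

lemma mehler_op_expansion:
  fixes H G :: "complex ^ 'n::finite \<Rightarrow> complex"
  assumes l: "l \<noteq> 0" and r: "0 < r" "r < 1" and H: "H \<in> Cc" and G: "G \<in> Cc"
  shows "(\<lambda>k. of_real r ^ k * (\<integral>w. heis_proj k l H w * cnj (G w) \<partial>lborel)) sums
    (\<integral>w. mehler_op l r H w * cnj (G w) \<partial>lborel)"
proof -
  note [measurable] = Cc_measurable[OF H] Cc_measurable[OF G]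
  have [measurable]: "heis_proj k l H \<in> borel_measurable borel" for k
    using heis_proj_integrable(1)[OF l H] by (auto dest: borel_measurable_integrable)
  obtain R1 where R1: "0 < R1" "\<And>z. R1 < norm z \<Longrightarrow> H z = 0" using Cc_support[OF H] by blast
  obtain R2 where R2: "0 < R2" "\<And>z. R2 < norm z \<Longrightarrow> G z = 0" using Cc_support[OF G] by blast
  \<comment> \<open>Obtained from the majorant by \<open>norm (w - z) \<le> R1 + R2\<close> on the
    supports and \<open>3 * r - 1 \<le> 2\<close>.\<close>
  define M where "M = exp (\<bar>l\<bar> / 4 * (2 / (1 - r)) * (R1 + R2)\<^sup>2) / (1 - r) ^ CARD('n)"
  have M: "mehler_majorant l r (w - z) \<le> M" if "norm z \<le> R1" "norm w \<le> R2" for w z :: "complex ^ 'n"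
  proof -
    have nwz: "norm (w - z) \<le> R1 + R2" using norm_triangle_ineq4[of w z] that by simp
    have "- (\<bar>l\<bar> / 4 * ((1 - 3 * r) / (1 - r)) * (norm (w - z))\<^sup>2) = \<bar>l\<bar> / 4 * ((3 * r - 1) / (1 - r)) * (norm (w - z))\<^sup>2"
      by (simp add: minus_divide_left[symmetric] algebra_simps diff_divide_distrib)
    also have "\<dots> \<le> \<bar>l\<bar> / 4 * (2 / (1 - r)) * (R1 + R2)\<^sup>2"
    proof (rule order_trans)
      show "\<bar>l\<bar> / 4 * ((3 * r - 1) / (1 - r)) * (norm (w - z))\<^sup>2 \<le> \<bar>l\<bar> / 4 * (2 / (1 - r)) * (norm (w - z))\<^sup>2"
        using r by (intro mult_right_mono mult_left_mono divide_right_mono) auto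
      show "\<bar>l\<bar> / 4 * (2 / (1 - r)) * (norm (w - z))\<^sup>2 \<le> \<bar>l\<bar> / 4 * (2 / (1 - r)) * (R1 + R2)\<^sup>2"
        using r nwz by (intro mult_left_mono power_mono) auto
    qed
    finally show ?thesis
      using r unfolding mehler_majorant_def M_def by (intro divide_right_mono) auto
  qed
  have inner: "(\<Sum>k<N. norm ((heis_kernel k l w z * of_real r ^ k) * H z)) \<le> M * norm (H z)"
    if w: "norm w \<le> R2" for w z N
  proof (cases "norm z \<le> R1")
    case True
    have "(\<Sum>k<N. norm ((heis_kernel k l w z * of_real r ^ k) * H z)) =
        (\<Sum>k<N. norm (heis_kernel k l w z * of_real r ^ k)) * norm (H z)"
      by (simp add: norm_mult[of _ "H z"] sum_distrib_right)
    also have "\<dots> \<le> M * norm (H z)"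
      using sum_norm_heis_kernel_le[of r l w z N] M[OF True w] r by (intro mult_right_mono) auto
    finally show ?thesis .
  next
    case False
    then show ?thesis using R1(2)[of z] by simp
  qed
  have intH: "integrable lborel (\<lambda>z. M * norm (H z))"
    by (intro integrable_mult_right integrable_norm Cc_integrable H)
  have termeq: "(\<integral>z. (heis_kernel k l w z * of_real r ^ k) * H z \<partial>lborel) = of_real r ^ k * heis_proj k l H w" for k w
  proof -
    have "(\<integral>z. (heis_kernel k l w z * of_real r ^ k) * H z \<partial>lborel) = (\<integral>z. of_real r ^ k * (heis_kernel k l w z * H z) \<partial>lborel)"
      by (simp add: mult_ac)
    then show ?thesis by (simp add: heis_proj_def)
  qed
  \<comment> \<open>The restriction to \<open>norm w \<le> R2\<close> is what makes \<open>M\<close>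
    applicable; elsewhere the factor \<open>cnj (G w)\<close> is 0.\<close>
  have sums: "(\<lambda>k. of_real r ^ k * heis_proj k l H w) sums mehler_op l r H w" if w: "norm w \<le> R2" for w
    unfolding termeq[symmetric] mehler_op_def
  proof (rule sums_integral_dominated(2)[OF _ intH])
    show "(\<lambda>z. heis_kernel k l w z * of_real r ^ k * H z) \<in> borel_measurable lborel" for k
      by measurable
    show "(\<lambda>k. heis_kernel k l w z * of_real r ^ k * H z) sums (mehler_kernel l r w z * H z)" for z
      using r by (intro sums_mult2 heis_kernel_generating) auto
  qed (rule inner[OF w])
  have bnd: "(\<Sum>k<N. norm (of_real r ^ k * heis_proj k l H w)) \<le> M * (\<integral>z. norm (H z) \<partial>lborel)"
    if w: "norm w \<le> R2" for w N
  proof -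
    have int: "integrable lborel (\<lambda>z. (heis_kernel k l w z * of_real r ^ k) * H z)" for k
      using integrable_mult_right[OF heis_proj_integrable(2)[OF l H, of k w], of "of_real r ^ k"] by (simp add: mult_ac)
    have "(\<Sum>k<N. norm (of_real r ^ k * heis_proj k l H w)) \<le> (\<Sum>k<N. \<integral>z. norm ((heis_kernel k l w z * of_real r ^ k) * H z) \<partial>lborel)"
      unfolding termeq[symmetric] by (intro sum_mono integral_norm_bound)
    also have "\<dots> = (\<integral>z. (\<Sum>k<N. norm ((heis_kernel k l w z * of_real r ^ k) * H z)) \<partial>lborel)"
      using int by (intro Bochner_Integration.integral_sum[symmetric] integrable_norm)
    also have "\<dots> \<le> (\<integral>z. M * norm (H z) \<partial>lborel)"
      by (rule integral_mono[OF _ intH inner[OF w]]) (intro Bochner_Integration.integrable_sum integrable_norm int)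
    finally show ?thesis by simp
  qed
  have "(\<lambda>k. \<integral>w. (of_real r ^ k * heis_proj k l H w) * cnj (G w) \<partial>lborel) sums (\<integral>w. mehler_op l r H w * cnj (G w) \<partial>lborel)"
  proof (rule sums_integral_dominated(2))
    show "integrable lborel (\<lambda>w. M * (\<integral>z. norm (H z) \<partial>lborel) * norm (G w))"
      by (intro integrable_mult_right integrable_norm Cc_integrable G)
    fix w
    show "(\<lambda>k. of_real r ^ k * heis_proj k l H w * cnj (G w)) sums (mehler_op l r H w * cnj (G w))"
      using sums_mult2[OF sums[of w]] R2(2)[of w] by (cases "norm w \<le> R2") auto
    show "(\<Sum>k<N. norm (of_real r ^ k * heis_proj k l H w * cnj (G w))) \<le> M * (\<integral>z. norm (H z) \<partial>lborel) * norm (G w)" for N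
    proof (cases "norm w \<le> R2")
      case True
      then show ?thesis
        using mult_right_mono[OF bnd[OF True, of N] norm_ge_zero[of "G w"]]
        by (simp add: norm_mult[of _ "cnj _"] sum_distrib_right)
    next
      case False
      then show ?thesis using R2(2)[of w] by simp
    qed
  qed measurable
  then show ?thesis by (simp add: mult.assoc)
qed

text \<open>The Mehler kernel splits into its mass \<open>e n\<close>, a normalized Gaussian of rate
  \<open>\<beta> n\<close> and the phase \<open>P\<close>. The Gaussian concentrates at
  \<open>w\<close>, where the phase is 1, and the uniform bound \<open>opbound\<close> dominates the
  outer integral against \<open>G\<close>.\<close>

lemma mehler_op_tendsto:
  fixes H G :: "complex ^ 'n::finite \<Rightarrow> complex"
  assumes l: "l \<noteq> 0" and H: "H \<in> Cc" and G: "G \<in> Cc"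
    and \<rho>: "\<rho> \<longlonglongrightarrow> 1" "\<And>n. 0 < \<rho> n" "\<And>n. \<rho> n < 1"
  shows "(\<lambda>n. \<integral>w. mehler_op l (\<rho> n) H w * cnj (G w) \<partial>lborel) \<longlonglongrightarrow>
    of_real ((2 * pi / \<bar>l\<bar>) ^ CARD('n)) * (\<integral>w. H w * cnj (G w) \<partial>lborel)"
proof -
  note [measurable] = Cc_measurable[OF H] Cc_measurable[OF G]
  obtain B where B: "0 \<le> B" "\<And>z. norm (H z) \<le> B" using Cc_bounded[OF H] by blast
  define \<beta> where "\<beta> n = \<bar>l\<bar> / 4 * ((1 + \<rho> n) / (1 - \<rho> n))" for n
  \<comment> \<open>The integral of \<open>mehler l (\<rho> n)\<close>, as \<open>norm_const\<close>
    shows. It stays below \<open>(4 * pi / \<bar>l\<bar>) ^ CARD('n)\<close> and its limit is the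
    constant of the lemma.\<close>
  define e where "e n = complex_of_real ((4 * pi / (\<bar>l\<bar> * (1 + \<rho> n))) ^ CARD('n))" for n
  have \<beta>pos: "\<beta> n > 0" for n using l \<rho>(2,3)[of n] by (simp add: \<beta>_def)
  have \<beta>lim: "filterlim \<beta> at_top sequentially"
  proof -
    have "filterlim (\<lambda>n. (\<bar>l\<bar> / 4 * (1 + \<rho> n)) / (1 - \<rho> n)) at_top sequentially"
    proof (rule LIM_at_top_divide)
      show "(\<lambda>n. \<bar>l\<bar> / 4 * (1 + \<rho> n)) \<longlonglongrightarrow> \<bar>l\<bar> / 4 * (1 + 1)" by (intro tendsto_intros \<rho>)
      show "(\<lambda>n. 1 - \<rho> n) \<longlonglongrightarrow> 0" using tendsto_diff[OF tendsto_const \<rho>(1), of 1] by simp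
    qed (use l \<rho>(3) in \<open>auto intro!: always_eventually\<close>)
    then show ?thesis by (simp add: \<beta>_def[abs_def])
  qed
  have norm_const: "1 / (1 - \<rho> n) ^ CARD('n) = (4 * pi / (\<bar>l\<bar> * (1 + \<rho> n))) ^ CARD('n) * sqrt (\<beta> n / pi) ^ DIM(complex ^ 'n)" for n
  proof -
    have dim: "DIM(complex ^ 'n) = 2 * CARD('n)" by simp
    have "4 * pi / (\<bar>l\<bar> * (1 + \<rho> n)) * (\<beta> n / pi) = 1 / (1 - \<rho> n)"
    proof -
      have "1 + \<rho> n \<noteq> 0" using \<rho>(2)[of n] by simp
      have "4 * pi / (L * a) * (L / 4 * (a / b) / pi) = 1 / b" if "L \<noteq> 0" "a \<noteq> 0" for L a b :: real
        using that by simp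
      then show ?thesis unfolding \<beta>_def by this (use l \<open>1 + \<rho> n \<noteq> 0\<close> in auto)
    qed
    then show ?thesis
      unfolding dim power_mult using \<beta>pos[of n] by (simp add: power_mult_distrib[symmetric] power_one_over[symmetric])
  qed
  define P where "P w z = exp (- (\<i> * complex_of_real (l / 2 * symp z w)))" for w z :: "complex ^ 'n"
  have P: "continuous_on UNIV (P w)" for w
    unfolding P_def by (intro continuous_intros) auto
  have P2: "norm (P w z) = 1" "P w w = 1" for w z by (simp_all add: P_def)
  have [measurable]: "P w \<in> borel_measurable borel" for w
    by (rule borel_measurable_continuous_onI[OF P])
  have op: "mehler_op l (\<rho> n) H w = e n * (of_real (sqrt (\<beta> n / pi) ^ DIM(complex ^ 'n)) *
     (\<integral>z. of_real (exp (- (\<beta> n * (norm (z - w))\<^sup>2))) * (P w z * H z) \<partial>lborel))" for n w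
  proof -
    have "mehler_kernel l (\<rho> n) w z * H z =
       (e n * of_real (sqrt (\<beta> n / pi) ^ DIM(complex ^ 'n))) * (of_real (exp (- (\<beta> n * (norm (z - w))\<^sup>2))) * (P w z * H z))" for z
    proof -
      have "mehler l (\<rho> n) (w - z) = ((4 * pi / (\<bar>l\<bar> * (1 + \<rho> n))) ^ CARD('n) * sqrt (\<beta> n / pi) ^ DIM(complex ^ 'n)) * exp (- (\<beta> n * (norm (z - w))\<^sup>2))"
        unfolding norm_const[symmetric] by (simp add: mehler_def \<beta>_def norm_minus_commute)
      then show ?thesis
        unfolding mehler_kernel_def P_def e_def by (simp only: of_real_mult mult_ac)
    qed
    then show ?thesis
      unfolding mehler_op_def by (simp only: integral_mult_right_zero mult.assoc)
  qed
  have "e \<longlonglongrightarrow> of_real ((4 * pi / (\<bar>l\<bar> * (1 + 1))) ^ CARD('n))"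
    unfolding e_def[abs_def] using l by (intro tendsto_intros \<rho>) auto
  then have e: "e \<longlonglongrightarrow> of_real ((2 * pi / \<bar>l\<bar>) ^ CARD('n))"
    by (simp add: field_simps)
  have lim: "(\<lambda>n. mehler_op l (\<rho> n) H w) \<longlonglongrightarrow> of_real ((2 * pi / \<bar>l\<bar>) ^ CARD('n)) * H w" for w
  proof -
    have "(\<lambda>n. of_real (sqrt (\<beta> n / pi) ^ DIM(complex ^ 'n)) *
       (\<integral>z. of_real (exp (- (\<beta> n * (norm (z - w))\<^sup>2))) * (P w z * H z) \<partial>lborel)) \<longlonglongrightarrow> P w w * H w"
    proof (rule gaussian_approximate_identity[OF _ _ _ \<beta>lim \<beta>pos])
      show "norm (P w z * H z) \<le> B" for z using B(2) by (simp add: norm_mult P2)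
      show "isCont (\<lambda>z. P w z * H z) w"
        using P Cc_isCont[OF H] by (auto simp: continuous_on_eq_continuous_at intro!: continuous_intros)
    qed measurable
    from tendsto_mult[OF e this] show ?thesis unfolding op P2 by simp
  qed
  have opbound: "norm (mehler_op l (\<rho> n) H w) \<le> (4 * pi / \<bar>l\<bar>) ^ CARD('n) * B" for n w
  proof -
    have g: "has_bochner_integral lborel (\<lambda>z::complex ^ 'n. exp (- (\<beta> n * (norm (z - w))\<^sup>2))) (sqrt (pi / \<beta> n) ^ DIM(complex ^ 'n))"
      by (rule has_bochner_integral_exp_neg_norm[OF \<beta>pos])
    have gB: "integrable lborel (\<lambda>z. exp (- (\<beta> n * (norm (z - w))\<^sup>2)) * B)"
      using g by (intro integrable_mult_left) (simp add: has_bochner_integral_iff)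
    have le: "norm (of_real (exp (- (\<beta> n * (norm (z - w))\<^sup>2))) * (P w z * H z)) \<le> exp (- (\<beta> n * (norm (z - w))\<^sup>2)) * B" for z
      unfolding norm_mult norm_of_real P2 using B(2) by (simp add: mult_left_mono)
    have "norm (\<integral>z. of_real (exp (- (\<beta> n * (norm (z - w))\<^sup>2))) * (P w z * H z) \<partial>lborel) \<le>
        (\<integral>z. exp (- (\<beta> n * (norm (z - w))\<^sup>2)) * B \<partial>lborel)"
    proof (rule Bochner_Integration.integral_norm_bound_integral[OF _ gB le])
      show "integrable lborel (\<lambda>z. of_real (exp (- (\<beta> n * (norm (z - w))\<^sup>2))) * (P w z * H z))"
        by (rule Bochner_Integration.integrable_bound[OF gB])
          (measurable, intro AE_I2 order_trans[OF le], simp)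
    qed
    also have "\<dots> = sqrt (pi / \<beta> n) ^ DIM(complex ^ 'n) * B"
      using g by (simp add: has_bochner_integral_iff)
    finally have "norm (mehler_op l (\<rho> n) H w) \<le> norm (e n) * (\<bar>sqrt (\<beta> n / pi)\<bar> ^ DIM(complex ^ 'n) * (sqrt (pi / \<beta> n) ^ DIM(complex ^ 'n) * B))"
      unfolding op norm_mult norm_of_real power_abs by (intro mult_left_mono) auto
    also have "\<bar>sqrt (\<beta> n / pi)\<bar> ^ DIM(complex ^ 'n) * (sqrt (pi / \<beta> n) ^ DIM(complex ^ 'n) * B) = B"
    proof -
      have "sqrt (\<beta> n / pi) * sqrt (pi / \<beta> n) = 1"
        using \<beta>pos[of n] by (simp add: real_sqrt_mult[symmetric])
      then have "sqrt (\<beta> n / pi) ^ DIM(complex ^ 'n) * sqrt (pi / \<beta> n) ^ DIM(complex ^ 'n) = 1"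
        by (simp only: power_mult_distrib[symmetric] power_one)
      then show ?thesis using \<beta>pos[of n] by (simp add: mult.assoc[symmetric])
    qed
    also have "norm (e n) \<le> (4 * pi / \<bar>l\<bar>) ^ CARD('n)"
    proof -
      have "norm (e n) = (4 * pi / (\<bar>l\<bar> * (1 + \<rho> n))) ^ CARD('n)"
        unfolding e_def norm_of_real using \<rho>(2)[of n] by simp
      also have "\<dots> \<le> (4 * pi / \<bar>l\<bar>) ^ CARD('n)"
        using \<rho>(2)[of n] l by (intro power_mono divide_left_mono) auto
      finally show ?thesis .
    qed
    finally show ?thesis using B(1) by (simp add: mult_right_mono)
  qed
  have [measurable]: "(\<lambda>w. mehler_op l (\<rho> n) H w) \<in> borel_measurable borel" for n
  proof -
    have "continuous_on UNIV (\<lambda>p::(complex ^ 'n) \<times> (complex ^ 'n). exp (- (\<i> * of_real (l / 2 * symp (snd p) (fst p)))))"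
      by (intro continuous_intros) auto
    from borel_measurable_continuous_onI[OF this]
    have [measurable]: "(\<lambda>p::(complex ^ 'n) \<times> (complex ^ 'n). exp (- (\<i> * of_real (l / 2 * symp (snd p) (fst p)))))
        \<in> borel_measurable (borel \<Otimes>\<^sub>M borel)" by (simp add: borel_prod)
    have "(\<lambda>p. mehler_kernel l (\<rho> n) (fst p) (snd p) * H (snd p)) \<in> borel_measurable (borel \<Otimes>\<^sub>M lborel)"
      unfolding mehler_kernel_def mehler_def by measurable
    then have "(\<lambda>(w, z). mehler_kernel l (\<rho> n) w z * H z) \<in> borel_measurable (borel \<Otimes>\<^sub>M lborel)"
      by (simp add: case_prod_beta)
    from lborel.borel_measurable_lebesgue_integral[OF this] show ?thesis
      by (simp add: mehler_op_def)
  qed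
  have "(\<lambda>n. \<integral>w. mehler_op l (\<rho> n) H w * cnj (G w) \<partial>lborel) \<longlonglongrightarrow>
      (\<integral>w. of_real ((2 * pi / \<bar>l\<bar>) ^ CARD('n)) * H w * cnj (G w) \<partial>lborel)"
  proof (rule integral_dominated_convergence)
    show "integrable lborel (\<lambda>w. (4 * pi / \<bar>l\<bar>) ^ CARD('n) * B * norm (G w))"
      by (intro integrable_mult_right integrable_norm Cc_integrable G)
    show "AE w in lborel. (\<lambda>n. mehler_op l (\<rho> n) H w * cnj (G w)) \<longlonglongrightarrow> of_real ((2 * pi / \<bar>l\<bar>) ^ CARD('n)) * H w * cnj (G w)"
      by (intro AE_I2 tendsto_mult lim tendsto_const)
    show "AE w in lborel. norm (mehler_op l (\<rho> n) H w * cnj (G w)) \<le> (4 * pi / \<bar>l\<bar>) ^ CARD('n) * B * norm (G w)" for n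
      unfolding norm_mult complex_mod_cnj by (intro AE_I2 mult_right_mono opbound) auto
  qed measurable
  then show ?thesis by (simp add: mult.assoc)
qed

text \<open>Each Abel term equals \<open>1 / c\<close> times a pairing of two transforms
  (\<open>J\<close>), and the Abel limit is \<open>c\<close> times the integral on the left;
  together this gives the factor \<open>1 / c\<close> squared. The powers \<open>r ^ k\<close> are
  bounded by 1 before \<open>r \<rightarrow> 1\<close>, so no limit is exchanged with the
  sum.\<close>

lemma spectral_inequality:
  fixes H G :: "complex ^ 'n::finite \<Rightarrow> complex"
  assumes l: "l \<noteq> 0" and H: "H \<in> Cc" and G: "G \<in> Cc"
  shows "ennreal (norm (\<integral>z. H z * cnj (G z) \<partial>lborel)) \<le> ennreal ((\<bar>l\<bar> / (2 * pi)) ^ (2 * CARD('n))) *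
    (\<Sum>k. \<integral>\<^sup>+w. ennreal (norm (heis_proj k l H w) * norm (heis_proj k l G w)) \<partial>lborel)"
proof -
  define c where "c = (2 * pi / \<bar>l\<bar>) ^ CARD('n)"
  define S where "S = (\<Sum>k. \<integral>\<^sup>+w. ennreal (norm (heis_proj k l H w) * norm (heis_proj k l G w)) \<partial>lborel)"
  have c: "c > 0" using l by (simp add: c_def)
  have J: "ennreal (norm (\<integral>w. heis_proj k l H w * cnj (G w) \<partial>lborel)) \<le>
     ennreal (1 / c) * (\<integral>\<^sup>+w. ennreal (norm (heis_proj k l H w) * norm (heis_proj k l G w)) \<partial>lborel)" for k
  proof -
    have "(\<integral>w. heis_proj k l H w * cnj (G w) \<partial>lborel) = of_real (1 / c) * (\<integral>x. heis_proj k l H x * cnj (heis_proj k l G x) \<partial>lborel)"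
      unfolding heis_proj_inner[OF l H G, symmetric] c_def[symmetric] using c by simp
    then have "ennreal (norm (\<integral>w. heis_proj k l H w * cnj (G w) \<partial>lborel)) =
        ennreal (1 / c) * ennreal (norm (\<integral>x. heis_proj k l H x * cnj (heis_proj k l G x) \<partial>lborel))"
      using c by (simp add: norm_mult ennreal_mult norm_divide ennreal_mult[symmetric])
    also have "\<dots> \<le> ennreal (1 / c) * (\<integral>\<^sup>+w. ennreal (norm (heis_proj k l H w) * norm (heis_proj k l G w)) \<partial>lborel)"
    proof (rule mult_left_mono)
      show "ennreal (norm (\<integral>x. heis_proj k l H x * cnj (heis_proj k l G x) \<partial>lborel)) \<le>
          (\<integral>\<^sup>+w. ennreal (norm (heis_proj k l H w) * norm (heis_proj k l G w)) \<partial>lborel)"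
      \<comment> \<open>A Bochner integral that does not exist has the value 0, so the other case is
        trivial.\<close>
      proof (cases "integrable lborel (\<lambda>x. heis_proj k l H x * cnj (heis_proj k l G x))")
        case True
        from integral_norm_bound_ennreal[OF this] show ?thesis by (simp add: norm_mult)
      qed (simp add: not_integrable_integral_eq)
    qed simp
    finally show ?thesis .
  qed
  have I: "ennreal (norm (\<integral>w. mehler_op l r H w * cnj (G w) \<partial>lborel)) \<le> ennreal (1 / c) * S" if r: "0 < r" "r < 1" for r
  proof -
    have "ennreal (norm (\<integral>w. mehler_op l r H w * cnj (G w) \<partial>lborel)) \<le>
        (\<Sum>k. ennreal (norm (of_real r ^ k * (\<integral>w. heis_proj k l H w * cnj (G w) \<partial>lborel))))"
      by (rule ennreal_norm_suminf_le[OF mehler_op_expansion[OF l r H G]])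
    also have "\<dots> \<le> (\<Sum>k. ennreal (1 / c) * (\<integral>\<^sup>+w. ennreal (norm (heis_proj k l H w) * norm (heis_proj k l G w)) \<partial>lborel))"
    proof (rule suminf_le)
      fix k
      have "norm (of_real r ^ k * (\<integral>w. heis_proj k l H w * cnj (G w) \<partial>lborel)) \<le> norm (\<integral>w. heis_proj k l H w * cnj (G w) \<partial>lborel)"
        using r by (simp add: norm_mult norm_power mult_left_le_one_le power_le_one)
      from order_trans[OF ennreal_leI[OF this] J]
      show "ennreal (norm (of_real r ^ k * (\<integral>w. heis_proj k l H w * cnj (G w) \<partial>lborel))) \<le>
        ennreal (1 / c) * (\<integral>\<^sup>+w. ennreal (norm (heis_proj k l H w) * norm (heis_proj k l G w)) \<partial>lborel)" .
    qed auto
    also have "\<dots> = ennreal (1 / c) * S" by (simp add: S_def ennreal_suminf_cmult)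
    finally show ?thesis .
  qed
  \<comment> \<open>Two successors, because \<open>1 - inverse 1\<close> is 0 and \<open>I\<close>
    asks for a positive parameter.\<close>
  define \<rho> where "\<rho> n = 1 - inverse (real (Suc (Suc n)))" for n
  have \<rho>: "\<rho> \<longlonglongrightarrow> 1" "\<And>n. 0 < \<rho> n" "\<And>n. \<rho> n < 1"
  proof -
    from tendsto_diff[OF tendsto_const LIMSEQ_Suc[OF LIMSEQ_inverse_real_of_nat], of 1]
    show "\<rho> \<longlonglongrightarrow> 1" by (simp add: \<rho>_def[abs_def])
  qed (auto simp: \<rho>_def field_simps)
  have "(\<lambda>n. ennreal (norm (\<integral>w. mehler_op l (\<rho> n) H w * cnj (G w) \<partial>lborel))) \<longlonglongrightarrow>
      ennreal (norm (of_real c * (\<integral>w. H w * cnj (G w) \<partial>lborel)))"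
    unfolding c_def by (intro tendsto_ennrealI tendsto_norm mehler_op_tendsto l H G \<rho>)
  then have "ennreal (norm (of_real c * (\<integral>w. H w * cnj (G w) \<partial>lborel))) \<le> ennreal (1 / c) * S"
    by (rule LIMSEQ_le_const2) (use I \<rho> in auto)
  then have "ennreal (1 / c) * ennreal (norm (of_real c * (\<integral>w. H w * cnj (G w) \<partial>lborel))) \<le> ennreal (1 / c) * (ennreal (1 / c) * S)"
    by (rule mult_left_mono) simp
  moreover have "ennreal (1 / c) * ennreal (norm (of_real c * (\<integral>w. H w * cnj (G w) \<partial>lborel))) = ennreal (norm (\<integral>z. H z * cnj (G z) \<partial>lborel))"
    using c by (simp add: ennreal_mult[symmetric] norm_mult)
  moreover have "ennreal (1 / c) * (ennreal (1 / c) * S) = ennreal ((\<bar>l\<bar> / (2 * pi)) ^ (2 * CARD('n))) * S"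
  proof -
    have "1 / c = (\<bar>l\<bar> / (2 * pi)) ^ CARD('n)"
      by (simp add: c_def power_divide)
    then have "1 / c * (1 / c) = (\<bar>l\<bar> / (2 * pi)) ^ (2 * CARD('n))"
      by (simp only: mult_2 power_add)
    moreover have "ennreal (1 / c) * ennreal (1 / c) = ennreal (1 / c * (1 / c))"
      using c by (intro ennreal_mult[symmetric]) auto
    ultimately show ?thesis by (simp only: mult.assoc[symmetric])
  qed
  ultimately show ?thesis by (simp add: S_def)
qed


section \<open>The Fourier transform in the central variable\<close>

text \<open>The negative sign comes from the group inverse in
  \<open>e\<^sub>a((z,t)\<^sup>-\<^sup>1(w,0))\<close>; see \<open>heis_e_kernel\<close>.\<close>

definition fourier_t :: "('a::euclidean_space \<times> real \<Rightarrow> complex) \<Rightarrow> real \<Rightarrow> 'a \<Rightarrow> complex"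
  where "fourier_t h l z = (\<integral>t. h (z, t) * exp (- (\<i> * of_real (l * t))) \<partial>lborel)"

lemma Cc_section:
  fixes h :: "'a::euclidean_space \<times> 'b::euclidean_space \<Rightarrow> complex"
  assumes h: "h \<in> Cc"
  shows "(\<lambda>t. h (z, t)) \<in> Cc"
proof -
  obtain R where R: "0 < R" "\<And>x. R < norm x \<Longrightarrow> h x = 0" using Cc_support[OF h] by blast
  have cont: "continuous_on UNIV h" using h by (simp add: Cc_def)
  show ?thesis
  proof (rule CcI)
    show "continuous_on UNIV (\<lambda>t. h (z, t))"
      by (intro continuous_on_compose2[OF cont] continuous_intros) auto
    show "compact (cball (0::'b) R)" by simp
    show "h (z, t) = 0" if "t \<notin> cball 0 R" for t
      using that norm_snd_le[of t z] by (intro R(2)) auto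
  qed
qed

text \<open>The envelope is independent of \<open>z\<close>, as dominated convergence along a
  sequence of points \<open>z\<close> in \<open>fourier_t_Cc\<close> demands.\<close>

lemma Cc_section_bound:
  fixes h :: "'a::euclidean_space \<times> real \<Rightarrow> complex"
  assumes h: "h \<in> Cc"
  obtains D where "integrable lborel D" "\<And>z t. norm (h (z, t)) \<le> D t"
proof -
  obtain R where R: "0 < R" "\<And>x. R < norm x \<Longrightarrow> h x = 0" using Cc_support[OF h] by blast
  obtain B where B: "0 \<le> B" "\<And>x. norm (h x) \<le> B" using Cc_bounded[OF h] by blast
  show ?thesis
  proof
    show "integrable lborel (\<lambda>t. indicator {-R..R} t * B)"
      by (intro integrable_mult_left) (simp add: integrable_indicator_iff emeasure_lborel_Icc_eq)
    show "norm (h (z, t)) \<le> indicator {-R..R} t * B" for z t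
    proof (cases "t \<in> {-R..R}")
      case False
      then have "R < norm (z, t)" using norm_snd_le[of t z] by auto
      then show ?thesis using R(2)[of "(z, t)"] False by simp
    qed (use B in simp)
  qed
qed

lemma measurable_fourier_t:
  fixes h :: "'a::euclidean_space \<times> real \<Rightarrow> complex"
  assumes [measurable]: "h \<in> borel_measurable borel"
  shows "(\<lambda>(l, z). fourier_t h l z) \<in> borel_measurable borel"
proof -
  have "(\<lambda>(p, t). h (snd p, t) * exp (- (\<i> * of_real (fst p * t)))) \<in> borel_measurable (borel \<Otimes>\<^sub>M lborel)"
  proof -
    have "(\<lambda>(p::real \<times> 'a, t::real). (snd p, t)) \<in> borel_measurable (borel \<Otimes>\<^sub>M lborel)"
      unfolding borel_prod[symmetric] by measurable
    from measurable_compose[OF this assms]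
    have [measurable]: "(\<lambda>(p::real \<times> 'a, t). h (snd p, t)) \<in> borel_measurable (borel \<Otimes>\<^sub>M lborel)"
      by (simp add: case_prod_beta)
    have "(\<lambda>q. (case q of (p::real \<times> 'a, t) \<Rightarrow> h (snd p, t)) * exp (- (\<i> * of_real (fst (fst q) * snd q)))) \<in> borel_measurable (borel \<Otimes>\<^sub>M lborel)"
      unfolding borel_prod[symmetric] by measurable
    then show ?thesis by (simp add: case_prod_beta)
  qed
  from lborel.borel_measurable_lebesgue_integral[OF this] show ?thesis
    by (simp add: fourier_t_def case_prod_beta)
qed

lemma measurable_fourier_t_compose:
  fixes h :: "'a::euclidean_space \<times> real \<Rightarrow> complex"
  assumes "h \<in> borel_measurable borel" "p \<in> borel_measurable M" "q \<in> borel_measurable M"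
  shows "(\<lambda>x. fourier_t h (p x) (q x)) \<in> borel_measurable M"
proof -
  have "(\<lambda>x. (p x, q x)) \<in> M \<rightarrow>\<^sub>M borel"
    using assms(2,3) unfolding borel_prod[symmetric] by measurable
  from measurable_compose[OF this measurable_fourier_t[OF assms(1)]] show ?thesis by simp
qed

lemma measurable_borel_fst [measurable (raw)]:
  "f \<in> M \<rightarrow>\<^sub>M borel \<Longrightarrow> (\<lambda>x. fst (f x)) \<in> M \<rightarrow>\<^sub>M borel"
  for f :: "'c \<Rightarrow> 'a::second_countable_topology \<times> 'b::second_countable_topology"
  unfolding borel_prod[symmetric] by (rule measurable_compose[OF _ measurable_fst])

lemma measurable_borel_snd [measurable (raw)]:
  "f \<in> M \<rightarrow>\<^sub>M borel \<Longrightarrow> (\<lambda>x. snd (f x)) \<in> M \<rightarrow>\<^sub>M borel"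
  for f :: "'c \<Rightarrow> 'a::second_countable_topology \<times> 'b::second_countable_topology"
  unfolding borel_prod[symmetric] by (rule measurable_compose[OF _ measurable_snd])

lemma fourier_t_integrable:
  fixes h :: "'a::euclidean_space \<times> real \<Rightarrow> complex"
  assumes h: "h \<in> Cc"
  shows "integrable lborel (\<lambda>t. h (z, t) * exp (- (\<i> * of_real (l * t))))"
proof -
  note [measurable] = Cc_measurable[OF Cc_section[OF h]]
  from Cc_integrable[OF Cc_section[OF h, of z]] show ?thesis
    by (rule Bochner_Integration.integrable_bound) (measurable, simp add: norm_mult)
qed

lemma fourier_t_bounded:
  fixes h :: "'a::euclidean_space \<times> real \<Rightarrow> complex"
  assumes h: "h \<in> Cc"
  obtains B where "0 \<le> B" "\<And>l z. norm (fourier_t h l z) \<le> B"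
proof -
  obtain D where D: "integrable lborel D" "\<And>z t. norm (h (z, t)) \<le> D t" using Cc_section_bound[OF h] by blast
  have "norm (fourier_t h l z) \<le> (\<integral>t. D t \<partial>lborel)" for l z
    unfolding fourier_t_def
    by (rule Bochner_Integration.integral_norm_bound_integral[OF fourier_t_integrable[OF h] D(1)])
      (use D(2) in \<open>simp add: norm_mult\<close>)
  moreover have "0 \<le> (\<integral>t. D t \<partial>lborel)"
    by (intro integral_nonneg_AE AE_I2 order_trans[OF norm_ge_zero D(2)])
  ultimately show ?thesis using that by blast
qed

lemma fourier_t_Cc:
  fixes h :: "'a::euclidean_space \<times> real \<Rightarrow> complex"
  assumes h: "h \<in> Cc"
  shows "fourier_t h l \<in> Cc"
proof -
  obtain R where R: "0 < R" "\<And>x. R < norm x \<Longrightarrow> h x = 0" using Cc_support[OF h] by blast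
  obtain D where D: "integrable lborel D" "\<And>z t. norm (h (z, t)) \<le> D t" using Cc_section_bound[OF h] by blast
  show ?thesis
  proof (rule CcI)
    show "compact (cball (0::'a) R)" by simp
    show "fourier_t h l z = 0" if "z \<notin> cball 0 R" for z
    proof -
      have "h (z, t) = 0" for t
        using that norm_fst_le[of z t] by (intro R(2)) auto
      then show ?thesis by (simp add: fourier_t_def)
    qed
    show "continuous_on UNIV (fourier_t h l)"
      unfolding continuous_on_sequentially
    proof (intro allI ballI impI)
      fix X :: "nat \<Rightarrow> 'a" and z assume "(\<forall>n. X n \<in> UNIV) \<and> X \<longlonglongrightarrow> z"
      then have X: "X \<longlonglongrightarrow> z" by simp
      have "(\<lambda>n. \<integral>t. h (X n, t) * exp (- (\<i> * of_real (l * t))) \<partial>lborel) \<longlonglongrightarrow> (\<integral>t. h (z, t) * exp (- (\<i> * of_real (l * t))) \<partial>lborel)"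
      proof (rule integral_dominated_convergence[OF _ _ D(1)])
        show "AE t in lborel. (\<lambda>n. h (X n, t) * exp (- (\<i> * of_real (l * t)))) \<longlonglongrightarrow> h (z, t) * exp (- (\<i> * of_real (l * t)))"
          by (intro AE_I2 tendsto_mult tendsto_const isCont_tendsto_compose[OF Cc_isCont[OF h]] tendsto_Pair X)
        show "AE t in lborel. norm (h (X n, t) * exp (- (\<i> * of_real (l * t)))) \<le> D t" for n
          using D(2) by (simp add: norm_mult)
      qed (use fourier_t_integrable[OF h] in \<open>auto dest: borel_measurable_integrable\<close>)
      then show "(fourier_t h l \<circ> X) \<longlonglongrightarrow> fourier_t h l z"
        by (simp add: fourier_t_def o_def)
    qed
  qed
qed

text \<open>The factor \<open>E n\<close> makes the \<open>l\<close>-integral absolutely convergent,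
  and Fubini turns it into \<open>2 * pi\<close> times the pairing of \<open>h\<close> with the
  Gaussian smoothing \<open>m n\<close> of \<open>cnj g\<close> in \<open>t\<close>. Dropping
  \<open>E n \<le> 1\<close> enlarges the right-hand side, so the limit is taken on the left
  alone.\<close>

lemma parseval_inequality:
  fixes h g :: "'a::euclidean_space \<times> real \<Rightarrow> complex"
  assumes h: "h \<in> Cc" and g: "g \<in> Cc"
  shows "ennreal (norm (\<integral>x. h x * cnj (g x) \<partial>lborel)) \<le> ennreal (1 / (2 * pi)) *
    (\<integral>\<^sup>+l. ennreal (norm (\<integral>z. fourier_t h l z * cnj (fourier_t g l z) \<partial>lborel)) \<partial>lborel)"
proof -
  note [measurable] = Cc_measurable[OF h] Cc_measurable[OF g]
  define \<Psi> where "\<Psi> l = (\<integral>z. fourier_t h l z * cnj (fourier_t g l z) \<partial>lborel)" for l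
  define e where "e t = exp (- (\<i> * complex_of_real t))" for t
  have e_norm [simp]: "norm (e t) = 1" for t by (simp add: e_def)
  have [measurable]: "e \<in> borel_measurable borel" by (simp add: e_def[abs_def])
  obtain Bg where Bg: "0 \<le> Bg" "\<And>l z. norm (fourier_t g l z) \<le> Bg" using fourier_t_bounded[OF g] by blast
  obtain B where B: "0 \<le> B" "\<And>x. norm (g x) \<le> B" using Cc_bounded[OF g] by blast
  note [measurable] = measurable_fourier_t_compose[OF Cc_measurable[OF g]]
  have \<Psi>: "\<Psi> l = (\<integral>x. h x * e (l * snd x) * cnj (fourier_t g l (fst x)) \<partial>lborel)" for l
  proof -
    have int: "integrable (lborel \<Otimes>\<^sub>M lborel) (\<lambda>x. h x * e (l * snd x) * cnj (fourier_t g l (fst x)))"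
    proof (rule Bochner_Integration.integrable_bound)
      show "integrable (lborel \<Otimes>\<^sub>M lborel) (\<lambda>x. Bg * norm (h x))"
        unfolding lborel_prod by (intro integrable_mult_right integrable_norm Cc_integrable h)
      show "(\<lambda>x. h x * e (l * snd x) * cnj (fourier_t g l (fst x))) \<in> borel_measurable (lborel \<Otimes>\<^sub>M lborel)"
        unfolding lborel_prod by measurable
      show "AE x in lborel \<Otimes>\<^sub>M lborel. norm (h x * e (l * snd x) * cnj (fourier_t g l (fst x))) \<le> norm (Bg * norm (h x))"
        using mult_right_mono[OF Bg(2) norm_ge_zero] Bg(1) by (intro AE_I2) (simp add: norm_mult abs_mult mult.commute)
    qed
    have "(\<integral>x. h x * e (l * snd x) * cnj (fourier_t g l (fst x)) \<partial>lborel) =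
       (\<integral>z. (\<integral>t. h (z, t) * e (l * t) * cnj (fourier_t g l z) \<partial>lborel) \<partial>lborel)"
      unfolding lborel_prod[symmetric] using lborel_pair.integral_fst'[OF int] by simp
    also have "\<dots> = \<Psi> l"
      by (simp add: \<Psi>_def fourier_t_def e_def)
    finally show ?thesis ..
  qed
  define \<beta> where "\<beta> n = real (Suc n)" for n
  \<comment> \<open>Chosen so that the Fourier transform of \<open>E n\<close> is a Gaussian of rate
    exactly \<open>\<beta> n\<close>.\<close>
  define \<epsilon> where "\<epsilon> n = 1 / (4 * \<beta> n)" for n
  have \<beta>pos: "\<beta> n > 0" and \<epsilon>pos: "\<epsilon> n > 0" for n by (simp_all add: \<beta>_def \<epsilon>_def)
  have \<beta>lim: "filterlim \<beta> at_top sequentially"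
    unfolding \<beta>_def by (rule filterlim_compose[OF filterlim_real_sequentially filterlim_Suc])
  define E where "E n l = exp (- (\<epsilon> n * l\<^sup>2))" for n and l :: real
  have E: "integrable lborel (E n)" for n
    using has_bochner_integral_exp_neg_norm[OF \<epsilon>pos, of n "0::real"]
    by (simp add: E_def[abs_def] has_bochner_integral_iff)
  have E01: "0 \<le> E n l" "E n l \<le> 1" for n l
    using \<epsilon>pos[of n] by (simp_all add: E_def)
  have [measurable]: "E n \<in> borel_measurable borel" for n by (simp add: E_def[abs_def])
  define m where "m n x = of_real (sqrt (\<beta> n / pi)) * (\<integral>s. of_real (exp (- (\<beta> n * (norm (s - snd x))\<^sup>2))) * cnj (g (fst x, s)) \<partial>lborel)"
    for n and x :: "'a \<times> real"
  have inner: "(\<integral>l. of_real (E n l) * e (l * snd x) * cnj (fourier_t g l (fst x)) \<partial>lborel) = of_real (2 * pi) * m n x" for n x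
  proof -
    have gs: "(\<lambda>s. g (fst x, s)) \<in> Cc" by (rule Cc_section[OF g])
    note [measurable] = Cc_measurable[OF gs]
    have "(\<integral>l. of_real (E n l) * e (l * snd x) * cnj (fourier_t g l (fst x)) \<partial>lborel) =
       (\<integral>l. (\<integral>s. of_real (E n l) * e (l * snd x) * cnj (g (fst x, s) * e (l * s)) \<partial>lborel) \<partial>lborel)"
      unfolding fourier_t_def e_def Bochner_Integration.integral_cnj[symmetric] by (simp only: integral_mult_right_zero)
    also have "\<dots> = (\<integral>s. (\<integral>l. of_real (E n l) * e (l * snd x) * cnj (g (fst x, s) * e (l * s)) \<partial>lborel) \<partial>lborel)"
    proof (rule lborel_pair.Fubini_integral, rule integrable_pair_bound)
      show "(\<lambda>(s, l). of_real (E n l) * e (l * snd x) * cnj (g (fst x, s) * e (l * s))) \<in> borel_measurable borel"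
        unfolding borel_prod[symmetric] by measurable
      show "integrable lborel (\<lambda>s. norm (g (fst x, s)))" by (intro integrable_norm Cc_integrable gs)
      show "norm (case (s, l) of (s, l) \<Rightarrow> of_real (E n l) * e (l * snd x) * cnj (g (fst x, s) * e (l * s))) \<le> norm (g (fst x, s)) * E n l" for s l
        using E01 by (simp add: norm_mult)
    qed (rule E)
    also have "\<dots> = (\<integral>s. of_real (2 * pi * sqrt (\<beta> n / pi)) * (of_real (exp (- (\<beta> n * (norm (s - snd x))\<^sup>2))) * cnj (g (fst x, s))) \<partial>lborel)"
    proof (rule Bochner_Integration.integral_cong[OF refl])
      fix s
      have "(\<integral>l. of_real (E n l) * e (l * snd x) * cnj (g (fst x, s) * e (l * s)) \<partial>lborel) =
         (\<integral>l. (of_real (exp (- (\<epsilon> n * l\<^sup>2))) * exp (\<i> * of_real ((s - snd x) * l))) * cnj (g (fst x, s)) \<partial>lborel)"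
      proof (rule Bochner_Integration.integral_cong[OF refl])
        fix l
        have "e (l * snd x) * cnj (e (l * s)) = exp (\<i> * of_real ((s - snd x) * l))"
          by (simp add: e_def exp_cnj mult_exp_exp algebra_simps)
        moreover have "of_real (E n l) * e (l * snd x) * cnj (g (fst x, s) * e (l * s)) =
            of_real (E n l) * (e (l * snd x) * cnj (e (l * s))) * cnj (g (fst x, s))"
          by (simp add: mult_ac)
        ultimately show "of_real (E n l) * e (l * snd x) * cnj (g (fst x, s) * e (l * s)) =
            (of_real (exp (- (\<epsilon> n * l\<^sup>2))) * exp (\<i> * of_real ((s - snd x) * l))) * cnj (g (fst x, s))"
          by (simp only: E_def)
      qed
      also have "\<dots> = of_real (sqrt (pi / \<epsilon> n) * exp (- (s - snd x)\<^sup>2 / (4 * \<epsilon> n))) * cnj (g (fst x, s))"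
        by (rule has_bochner_integral_integral_eq, rule has_bochner_integral_mult_left,
            rule has_bochner_integral_gaussian_real[OF \<epsilon>pos])
      \<comment> \<open>This rewrites the mass of the cut-off through the normalization
        \<open>sqrt (\<beta> n / pi)\<close> of the approximate identity; the leftover
        \<open>2 * pi\<close> is the Parseval constant.\<close>
      also have "sqrt (pi / \<epsilon> n) = 2 * pi * sqrt (\<beta> n / pi)"
      proof -
        have "pi / \<epsilon> n = (2 * pi)\<^sup>2 * (\<beta> n / pi)"
          using \<beta>pos[of n] by (simp add: \<epsilon>_def power2_eq_square)
        then show ?thesis by (simp only: real_sqrt_mult real_sqrt_abs) simp
      qed
      also have "- (s - snd x)\<^sup>2 / (4 * \<epsilon> n) = - (\<beta> n * (norm (s - snd x))\<^sup>2)"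
        using \<beta>pos[of n] by (simp add: \<epsilon>_def)
      finally show "(\<integral>l. of_real (E n l) * e (l * snd x) * cnj (g (fst x, s) * e (l * s)) \<partial>lborel) =
         of_real (2 * pi * sqrt (\<beta> n / pi)) * (of_real (exp (- (\<beta> n * (norm (s - snd x))\<^sup>2))) * cnj (g (fst x, s)))"
        by (simp only: of_real_mult mult.assoc)
    qed
    also have "\<dots> = of_real (2 * pi) * m n x"
      by (simp only: m_def integral_mult_right_zero of_real_mult mult.assoc)
    finally show ?thesis .
  qed
  have A: "(\<integral>l. of_real (E n l) * \<Psi> l \<partial>lborel) = of_real (2 * pi) * (\<integral>x. h x * m n x \<partial>lborel)" for n
  proof -
    have "(\<integral>l. of_real (E n l) * \<Psi> l \<partial>lborel) =
      (\<integral>l. (\<integral>x. of_real (E n l) * (h x * e (l * snd x) * cnj (fourier_t g l (fst x))) \<partial>lborel) \<partial>lborel)"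
      unfolding \<Psi> by (simp only: integral_mult_right_zero)
    also have "\<dots> = (\<integral>x. (\<integral>l. of_real (E n l) * (h x * e (l * snd x) * cnj (fourier_t g l (fst x))) \<partial>lborel) \<partial>lborel)"
    proof (rule lborel_pair.Fubini_integral, rule integrable_pair_bound)
      show "(\<lambda>(x, l). of_real (E n l) * (h x * e (l * snd x) * cnj (fourier_t g l (fst x)))) \<in> borel_measurable borel"
      proof -
        have [measurable]: "(\<lambda>p. h (fst p)) \<in> borel_measurable (borel \<Otimes>\<^sub>M (borel :: real measure))"
          by measurable
        have [measurable]: "(\<lambda>p. snd (fst p)) \<in> borel_measurable ((borel :: ('a \<times> real) measure) \<Otimes>\<^sub>M (borel :: real measure))"
          "(\<lambda>p. fst (fst p)) \<in> borel_measurable ((borel :: ('a \<times> real) measure) \<Otimes>\<^sub>M (borel :: real measure))"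
          by (auto simp: borel_prod[symmetric])
        have "(\<lambda>p. of_real (E n (snd p)) * (h (fst p) * e (snd p * snd (fst p)) * cnj (fourier_t g (snd p) (fst (fst p)))))
            \<in> borel_measurable ((borel :: ('a \<times> real) measure) \<Otimes>\<^sub>M (borel :: real measure))"
          by measurable
        then show ?thesis by (simp add: case_prod_beta borel_prod)
      qed
      show "integrable lborel (\<lambda>x. norm (h x) * Bg)"
        by (intro integrable_mult_left integrable_norm Cc_integrable h)
      fix x l
      have "E n l * norm (h x) * norm (fourier_t g l (fst x)) \<le> E n l * norm (h x) * Bg"
        using Bg E01 by (intro mult_left_mono) auto
      then show "norm (case (x, l) of (x, l) \<Rightarrow> of_real (E n l) * (h x * e (l * snd x) * cnj (fourier_t g l (fst x)))) \<le> norm (h x) * Bg * E n l"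
        using E01 by (simp add: norm_mult mult_ac)
    qed (rule E)
    also have "\<dots> = (\<integral>x. h x * (\<integral>l. of_real (E n l) * e (l * snd x) * cnj (fourier_t g l (fst x)) \<partial>lborel) \<partial>lborel)"
      by (simp only: integral_mult_right_zero[symmetric] mult_ac)
    also have "\<dots> = (\<integral>x. of_real (2 * pi) * (h x * m n x) \<partial>lborel)"
      unfolding inner by (simp only: mult_ac)
    finally show ?thesis by (simp only: integral_mult_right_zero)
  qed
  have mlim: "(\<lambda>n. m n x) \<longlonglongrightarrow> cnj (g x)" for x
  proof -
    have gs: "(\<lambda>s. g (fst x, s)) \<in> Cc" by (rule Cc_section[OF g])
    note [measurable] = Cc_measurable[OF gs]
    have "(\<lambda>n. of_real (sqrt (\<beta> n / pi) ^ DIM(real)) * (\<integral>s. of_real (exp (- (\<beta> n * (norm (s - snd x))\<^sup>2))) * cnj (g (fst x, s)) \<partial>lborel))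
        \<longlonglongrightarrow> cnj (g (fst x, snd x))"
    proof (rule gaussian_approximate_identity[where g="\<lambda>s. cnj (g (fst x, s))", OF _ _ _ \<beta>lim \<beta>pos])
      show "norm (cnj (g (fst x, s))) \<le> B" for s using B(2) by simp
      show "isCont (\<lambda>s. cnj (g (fst x, s))) (snd x)"
        using Cc_isCont[OF gs] by (intro continuous_intros)
    qed measurable
    then show ?thesis by (simp add: m_def)
  qed
  have mbound: "norm (m n x) \<le> B" for n x
  proof -
    have gauss: "has_bochner_integral lborel (\<lambda>s. exp (- (\<beta> n * (norm (s - snd x))\<^sup>2))) (sqrt (pi / \<beta> n) ^ DIM(real))"
      by (rule has_bochner_integral_exp_neg_norm[OF \<beta>pos])
    then have gB: "integrable lborel (\<lambda>s. exp (- (\<beta> n * (norm (s - snd x))\<^sup>2)) * B)"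
      by (intro integrable_mult_left) (simp add: has_bochner_integral_iff)
    have gs: "(\<lambda>s. g (fst x, s)) \<in> Cc" by (rule Cc_section[OF g])
    note [measurable] = Cc_measurable[OF gs]
    have le: "norm (of_real (exp (- (\<beta> n * (norm (s - snd x))\<^sup>2))) * cnj (g (fst x, s))) \<le> exp (- (\<beta> n * (norm (s - snd x))\<^sup>2)) * B" for s
      unfolding norm_mult norm_of_real using B(2) by (simp add: mult_left_mono)
    have "norm (\<integral>s. of_real (exp (- (\<beta> n * (norm (s - snd x))\<^sup>2))) * cnj (g (fst x, s)) \<partial>lborel) \<le>
        (\<integral>s. exp (- (\<beta> n * (norm (s - snd x))\<^sup>2)) * B \<partial>lborel)"
    proof (rule Bochner_Integration.integral_norm_bound_integral[OF _ gB le])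
      show "integrable lborel (\<lambda>s. of_real (exp (- (\<beta> n * (norm (s - snd x))\<^sup>2))) * cnj (g (fst x, s)))"
        by (rule Bochner_Integration.integrable_bound[OF gB])
          (measurable, intro AE_I2 order_trans[OF le], simp)
    qed
    also have "\<dots> = sqrt (pi / \<beta> n) * B"
      using gauss by (simp add: has_bochner_integral_iff)
    finally have "norm (m n x) \<le> sqrt (\<beta> n / pi) * (sqrt (pi / \<beta> n) * B)"
      unfolding m_def norm_mult norm_of_real using \<beta>pos[of n] by (simp add: mult_left_mono)
    also have "\<dots> = B"
    proof -
      have "sqrt (\<beta> n / pi) * sqrt (pi / \<beta> n) = 1"
        using \<beta>pos[of n] by (simp add: real_sqrt_mult[symmetric])
      then show ?thesis by (simp add: mult.assoc[symmetric])
    qed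
    finally show ?thesis .
  qed
  have [measurable]: "m n \<in> borel_measurable borel" for n
  proof -
    have "(\<lambda>p. (fst (fst p), snd p)) \<in> borel_measurable ((borel :: ('a \<times> real) measure) \<Otimes>\<^sub>M (lborel :: real measure))"
      unfolding borel_prod[symmetric] by measurable
    from measurable_compose[OF this Cc_measurable[OF g]]
    have [measurable]: "(\<lambda>p. g (fst (fst p), snd p)) \<in> borel_measurable ((borel :: ('a \<times> real) measure) \<Otimes>\<^sub>M (lborel :: real measure))" .
    have [measurable]: "(\<lambda>p. snd (fst p)) \<in> borel_measurable ((borel :: ('a \<times> real) measure) \<Otimes>\<^sub>M (lborel :: real measure))"
      by (auto simp: borel_prod[symmetric])
    have "(\<lambda>p. of_real (exp (- (\<beta> n * (norm (snd p - snd (fst p)))\<^sup>2))) * cnj (g (fst (fst p), snd p)))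
        \<in> borel_measurable ((borel :: ('a \<times> real) measure) \<Otimes>\<^sub>M (lborel :: real measure))"
      by measurable
    then have "(\<lambda>(x, s). of_real (exp (- (\<beta> n * (norm (s - snd x))\<^sup>2))) * cnj (g (fst x, s)))
        \<in> borel_measurable ((borel :: ('a \<times> real) measure) \<Otimes>\<^sub>M (lborel :: real measure))"
      by (simp add: case_prod_beta)
    from lborel.borel_measurable_lebesgue_integral[OF this]
    show ?thesis unfolding m_def[abs_def] by (intro borel_measurable_times) auto
  qed
  have "(\<lambda>n. \<integral>x. h x * m n x \<partial>lborel) \<longlonglongrightarrow> (\<integral>x. h x * cnj (g x) \<partial>lborel)"
  proof (rule integral_dominated_convergence)
    show "integrable lborel (\<lambda>x. norm (h x) * B)"
      by (intro integrable_mult_left integrable_norm Cc_integrable h)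
    show "AE x in lborel. (\<lambda>n. h x * m n x) \<longlonglongrightarrow> h x * cnj (g x)"
      by (intro AE_I2 tendsto_mult tendsto_const mlim)
    show "AE x in lborel. norm (h x * m n x) \<le> norm (h x) * B" for n
      unfolding norm_mult by (intro AE_I2 mult_left_mono mbound) auto
  qed measurable
  then have "(\<lambda>n. ennreal (norm (\<integral>l. of_real (E n l) * \<Psi> l \<partial>lborel))) \<longlonglongrightarrow>
      ennreal (norm (of_real (2 * pi) * (\<integral>x. h x * cnj (g x) \<partial>lborel)))"
    unfolding A by (intro tendsto_ennrealI tendsto_norm tendsto_mult tendsto_const)
  then have "ennreal (norm (of_real (2 * pi) * (\<integral>x. h x * cnj (g x) \<partial>lborel))) \<le> (\<integral>\<^sup>+l. ennreal (norm (\<Psi> l)) \<partial>lborel)"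
  proof (rule LIMSEQ_le_const2, intro exI allI impI)
    fix n
    show "ennreal (norm (\<integral>l. of_real (E n l) * \<Psi> l \<partial>lborel)) \<le> (\<integral>\<^sup>+l. ennreal (norm (\<Psi> l)) \<partial>lborel)"
    proof (cases "integrable lborel (\<lambda>l. of_real (E n l) * \<Psi> l)")
      case True
      note integral_norm_bound_ennreal[OF this]
      also have "(\<integral>\<^sup>+l. ennreal (norm (of_real (E n l) * \<Psi> l)) \<partial>lborel) \<le> (\<integral>\<^sup>+l. ennreal (norm (\<Psi> l)) \<partial>lborel)"
        using E01 by (intro nn_integral_mono ennreal_leI) (simp add: norm_mult mult_left_le_one_le)
      finally show ?thesis .
    qed (simp add: not_integrable_integral_eq)
  qed
  then have "ennreal (1 / (2 * pi)) * ennreal (norm (of_real (2 * pi) * (\<integral>x. h x * cnj (g x) \<partial>lborel))) \<le>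
      ennreal (1 / (2 * pi)) * (\<integral>\<^sup>+l. ennreal (norm (\<Psi> l)) \<partial>lborel)"
    by (rule mult_left_mono) simp
  moreover have "ennreal (1 / (2 * pi)) * ennreal (norm (of_real (2 * pi) * (\<integral>x. h x * cnj (g x) \<partial>lborel))) =
      ennreal (norm (\<integral>x. h x * cnj (g x) \<partial>lborel))"
  proof -
    have "1 / (2 * pi) * norm (of_real (2 * pi) * z) = norm z" for z :: complex
      by (simp add: norm_mult)
    then show ?thesis by (subst ennreal_mult[symmetric]) simp_all
  qed
  ultimately show ?thesis by (simp add: \<Psi>_def)
qed


section \<open>Smooth functions of compact support\<close>

text \<open>Induction on the list of directions keeps all iterated derivatives inside
  \<open>X\<close>. A closed class of functions thus replaces any Leibniz formula for iterated
  derivatives of products.\<close>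

lemma smooth_coinduct:
  assumes "f \<in> X" and step: "\<And>g. g \<in> X \<Longrightarrow> g differentiable_on UNIV"
    "\<And>g b. g \<in> X \<Longrightarrow> b \<in> Basis \<Longrightarrow> partial_deriv b g \<in> X"
  shows "smooth f"
proof -
  have "iter_partial bs f \<in> X" if "bs \<in> lists Basis" for bs
    using that by induction (use assms in auto)
  then show ?thesis unfolding smooth_def using step(1) by blast
qed

lemma smooth_differentiable: "smooth f \<Longrightarrow> f differentiable (at x)"
  using bspec[of "lists Basis" "\<lambda>bs. iter_partial bs f differentiable_on UNIV" "[]"]
  by (auto simp: smooth_def differentiable_on_def)

lemma smooth_has_derivative:
  "smooth f \<Longrightarrow> (f has_derivative frechet_derivative f (at x)) (at x)"
  using smooth_differentiable frechet_derivative_works by blast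

lemma smooth_continuous_on: "smooth f \<Longrightarrow> continuous_on UNIV f"
  using smooth_differentiable by (auto simp: continuous_on_eq_continuous_at intro: differentiable_imp_continuous_within)

lemma smooth_iter_partial:
  assumes f: "smooth f" and cs: "cs \<in> lists Basis"
  shows "smooth (iter_partial cs f)"
  unfolding smooth_def
proof
  fix bs :: "'a list" assume "bs \<in> lists Basis"
  then have "iter_partial (bs @ cs) f differentiable_on UNIV"
    using f cs unfolding smooth_def by (metis append_in_lists_conv)
  then show "iter_partial bs (iter_partial cs f) differentiable_on UNIV" by simp
qed

lemma smooth_partial_deriv: "smooth f \<Longrightarrow> b \<in> Basis \<Longrightarrow> smooth (partial_deriv b f)"
  using smooth_iter_partial[of f "[b]"] by simp

lemma smooth_cmult_add:
  fixes f g :: "'a::euclidean_space \<Rightarrow> complex"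
  assumes "smooth f" "smooth g"
  shows "smooth (\<lambda>x. c * f x + g x)"
proof (rule smooth_coinduct)
  let ?X = "{\<lambda>x. c * f x + g x | f g. smooth f \<and> smooth g}"
  show "(\<lambda>x. c * f x + g x) \<in> ?X" using assms by blast
  fix h :: "'a \<Rightarrow> complex" assume "h \<in> ?X"
  then obtain f g where h: "h = (\<lambda>x. c * f x + g x)" "smooth f" "smooth g" by blast
  have D: "(h has_derivative (\<lambda>v. c * frechet_derivative f (at x) v + frechet_derivative g (at x) v)) (at x)" for x
    unfolding h(1) by (intro has_derivative_add has_derivative_mult_right smooth_has_derivative h)
  then show "h differentiable_on UNIV"
    by (auto simp: differentiable_on_def differentiable_def)
  fix b :: 'a assume b: "b \<in> Basis"
  have "partial_deriv b h = (\<lambda>x. c * partial_deriv b f x + partial_deriv b g x)"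
    by (auto simp: partial_deriv_def frechet_derivative_at[OF D, symmetric])
  then show "partial_deriv b h \<in> ?X"
    using smooth_partial_deriv[OF h(2) b] smooth_partial_deriv[OF h(3) b] by blast
qed

lemma smooth_inner_mult:
  fixes f :: "'a::euclidean_space \<Rightarrow> complex"
  assumes "smooth f"
  shows "smooth (\<lambda>x. of_real (x \<bullet> e) * f x)"
proof (rule smooth_coinduct)
  \<comment> \<open>The products alone are not closed under differentiation: the derivative in
    direction \<open>b\<close> adds \<open>of_real (b \<bullet> e) * f x\<close>, which the free
    summand \<open>g\<close> absorbs.\<close>
  let ?X = "{\<lambda>x. of_real (x \<bullet> e) * f x + g x | f g. smooth f \<and> smooth g}"
  have "smooth (\<lambda>x. 0 * f x + (\<lambda>_. 0) x)"
    by (rule smooth_coinduct[where X="{\<lambda>_. 0}"]) (auto simp: partial_deriv_def[abs_def])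
  then have "smooth (\<lambda>x::'a. 0 :: complex)" by simp
  then show "(\<lambda>x. of_real (x \<bullet> e) * f x) \<in> ?X" using assms by force
  fix h :: "'a \<Rightarrow> complex" assume "h \<in> ?X"
  then obtain f g where h: "h = (\<lambda>x. of_real (x \<bullet> e) * f x + g x)" "smooth f" "smooth g" by blast
  have D: "(h has_derivative (\<lambda>v. (of_real (x \<bullet> e) * frechet_derivative f (at x) v + of_real (v \<bullet> e) * f x)
      + frechet_derivative g (at x) v)) (at x)" for x
    unfolding h(1)
    by (intro has_derivative_add has_derivative_mult has_derivative_of_real has_derivative_inner_left
        has_derivative_ident smooth_has_derivative h)
  then show "h differentiable_on UNIV"
    by (auto simp: differentiable_on_def differentiable_def)
  fix b :: 'a assume b: "b \<in> Basis"
  have "partial_deriv b h = (\<lambda>x. of_real (x \<bullet> e) * partial_deriv b f x + (of_real (b \<bullet> e) * f x + partial_deriv b g x))"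
    by (auto simp: partial_deriv_def frechet_derivative_at[OF D, symmetric])
  then show "partial_deriv b h \<in> ?X"
    using smooth_partial_deriv[OF h(2) b] smooth_cmult_add[OF h(2) smooth_partial_deriv[OF h(3) b], of "of_real (b \<bullet> e)"]
    by (intro CollectI exI[of _ "partial_deriv b f"] exI[of _ "\<lambda>x. of_real (b \<bullet> e) * f x + partial_deriv b g x"] conjI)
qed

text \<open>The strict inequality describes an open set, so \<open>f\<close> vanishes in a whole
  neighbourhood of \<open>x\<close>.\<close>

lemma partial_deriv_support:
  assumes "\<And>x. R < norm x \<Longrightarrow> f x = 0" and "R < norm x"
  shows "partial_deriv b f x = 0"
proof -
  have "open {y. R < norm y}" by (intro open_Collect_less continuous_intros)
  then have "(f has_derivative (\<lambda>_. 0)) (at x)"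
    by (rule has_derivative_transform_within_open[OF has_derivative_const[of 0]]) (use assms in auto)
  from frechet_derivative_at[OF this] show ?thesis by (simp add: partial_deriv_def fun_eq_iff)
qed

lemma iter_partial_support:
  assumes "\<And>x. R < norm x \<Longrightarrow> f x = 0" and "R < norm x"
  shows "iter_partial bs f x = 0"
  using assms(2) by (induction bs arbitrary: x) (auto intro: assms(1) partial_deriv_support)

lemma smooth_supported_Cc:
  fixes f :: "'a::euclidean_space \<Rightarrow> complex"
  assumes "smooth f" and "\<And>x. R < norm x \<Longrightarrow> f x = 0"
  shows "f \<in> Cc"
  by (rule CcI[of _ "cball 0 R"]) (use assms smooth_continuous_on in auto)

lemma smooth_supported_schwartz:
  fixes f :: "'a::euclidean_space \<Rightarrow> complex"
  assumes f: "smooth f" and R: "0 < R" "\<And>x. R < norm x \<Longrightarrow> f x = 0"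
  shows "f \<in> schwartz"
  unfolding schwartz_def
proof (intro CollectI conjI ballI allI f)
  fix bs :: "'a list" and N :: nat assume bs: "bs \<in> lists Basis"
  have supp: "\<And>x. R < norm x \<Longrightarrow> iter_partial bs f x = 0"
    by (rule iter_partial_support[OF R(2)])
  have "iter_partial bs f \<in> Cc"
    by (rule smooth_supported_Cc[OF smooth_iter_partial[OF f bs] supp])
  then obtain B where B: "0 \<le> B" "\<And>x. norm (iter_partial bs f x) \<le> B" using Cc_bounded by blast
  have "(1 + norm x) ^ N * norm (iter_partial bs f x) \<le> (1 + R) ^ N * B" for x
  proof (cases "norm x \<le> R")
    case True
    then show ?thesis using B R by (intro mult_mono power_mono) auto
  next
    case False
    then show ?thesis using supp[of x] B R by simp
  qed
  then show "\<exists>B. \<forall>x. (1 + norm x) ^ N * norm (iter_partial bs f x) \<le> B" by blast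
qed

lemma test_function_support:
  fixes f :: "'a::euclidean_space \<Rightarrow> complex"
  assumes "f \<in> test_functions"
  obtains R where "0 < R" "\<And>x. R < norm x \<Longrightarrow> f x = 0"
proof -
  have "bounded (closure {x. f x \<noteq> 0})"
    using assms by (auto simp: test_functions_def intro: compact_imp_bounded)
  then obtain R where R: "R > 0" "\<And>x. x \<in> closure {x. f x \<noteq> 0} \<Longrightarrow> norm x \<le> R"
    by (auto simp: bounded_pos)
  show ?thesis
  proof (rule that[OF R(1)])
    fix x :: 'a assume "R < norm x"
    then have "x \<notin> closure {x. f x \<noteq> 0}" using R(2)[of x] by auto
    then show "f x = 0" using closure_subset[of "{x. f x \<noteq> 0}"] by auto
  qed
qed

lemma Cc_mult:
  fixes f :: "'a::euclidean_space \<Rightarrow> complex"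
  shows "continuous_on UNIV c \<Longrightarrow> f \<in> Cc \<Longrightarrow> (\<lambda>x. c x * f x) \<in> Cc"
  by (auto simp: Cc_def intro!: continuous_intros)

lemma Cc_add:
  fixes f g :: "'a::euclidean_space \<Rightarrow> complex"
  assumes "f \<in> Cc" "g \<in> Cc"
  shows "(\<lambda>x. f x + g x) \<in> Cc"
proof -
  obtain K L where "compact K" "\<And>x. x \<notin> K \<Longrightarrow> f x = 0" "compact L" "\<And>x. x \<notin> L \<Longrightarrow> g x = 0"
    using assms by (auto simp: Cc_def)
  then show ?thesis
    using assms by (intro CcI[of _ "K \<union> L"] continuous_on_add) (auto simp: Cc_def)
qed

section \<open>Differentiation and multiplication in the central variable\<close>

lemma integral_derivative_Cc:
  fixes F F' :: "real \<Rightarrow> complex"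
  assumes D: "\<And>t. (F has_vector_derivative F' t) (at t)" and F: "F \<in> Cc" and F': "F' \<in> Cc"
  shows "(\<integral>t. F' t \<partial>lborel) = 0"
proof -
  obtain R1 where R1: "0 < R1" "\<And>x. R1 < norm x \<Longrightarrow> F x = 0" using Cc_support[OF F] by blast
  obtain R2 where R2: "0 < R2" "\<And>x. R2 < norm x \<Longrightarrow> F' x = 0" using Cc_support[OF F'] by blast
  \<comment> \<open>The added 1 makes \<open>F\<close> and \<open>F'\<close> vanish at the end
    points \<open>R\<close> and \<open>- R\<close> themselves, not only beyond them.\<close>
  define R where "R = max R1 R2 + 1"
  have R: "R > 0" "\<And>x. R \<le> \<bar>x\<bar> \<Longrightarrow> F x = 0" "\<And>x. R \<le> \<bar>x\<bar> \<Longrightarrow> F' x = 0"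
    using R1 R2 by (auto simp: R_def)
  have "(\<integral>t. indicator {-R..R} t *\<^sub>R F' t \<partial>lborel) = F R - F (-R)"
  proof (rule integral_FTC_atLeastAtMost)
    show "continuous_on {-R..R} F'"
      using F' by (auto simp: Cc_def intro: continuous_on_subset)
  qed (use R(1) D in \<open>auto intro: has_vector_derivative_at_within\<close>)
  also have "F R - F (-R) = 0" using R by simp
  also have "(\<lambda>t. indicator {-R..R} t *\<^sub>R F' t) = F'"
    using R(3) by (auto simp: fun_eq_iff indicator_def)
  finally show ?thesis .
qed

abbreviation time_deriv :: "('a::euclidean_space \<times> real \<Rightarrow> complex) \<Rightarrow> 'a \<times> real \<Rightarrow> complex"
  where "time_deriv \<equiv> partial_deriv (0, 1)"

lemma time_Basis: "(0 :: 'a::euclidean_space, 1 :: real) \<in> Basis"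
  by (simp add: Basis_prod_def)

lemma has_vector_derivative_time_deriv:
  fixes f :: "'a::euclidean_space \<times> real \<Rightarrow> complex"
  assumes f: "smooth f"
  shows "((\<lambda>s. f (z, s)) has_vector_derivative time_deriv f (z, t)) (at t)"
proof -
  let ?D = "frechet_derivative f (at (z, t))"
  have D: "(f has_derivative ?D) (at (z, t))" by (rule smooth_has_derivative[OF f])
  have "((\<lambda>s. (z, s)) has_derivative (\<lambda>h. (0, h))) (at t)"
    by (intro has_derivative_Pair has_derivative_const has_derivative_ident)
  from has_derivative_compose[OF this D]
  have "((\<lambda>s. f (z, s)) has_derivative (\<lambda>h. ?D (0, h))) (at t)" .
  moreover have "(\<lambda>h. ?D (0, h)) = (\<lambda>h. h *\<^sub>R ?D (0, 1))"
  proof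
    show "?D (0, h) = h *\<^sub>R ?D (0, 1)" for h
      using linear_scale[OF has_derivative_linear[OF D], of h "(0, 1)"] by simp
  qed
  ultimately show ?thesis unfolding has_vector_derivative_def partial_deriv_def by (simp only:)
qed

lemma time_deriv_Cc:
  fixes f :: "'a::euclidean_space \<times> real \<Rightarrow> complex"
  assumes f: "f \<in> test_functions"
  shows "time_deriv f \<in> Cc"
proof -
  obtain R where R: "0 < R" "\<And>x. R < norm x \<Longrightarrow> f x = 0" using test_function_support[OF f] by blast
  have "smooth f" using f by (simp add: test_functions_def)
  then show ?thesis
    by (intro smooth_supported_Cc[OF smooth_partial_deriv[OF _ time_Basis]] partial_deriv_support[OF R(2)])
qed

lemma test_function_Cc:
  fixes f :: "'a::euclidean_space \<Rightarrow> complex"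
  assumes f: "f \<in> test_functions"
  shows "f \<in> Cc"
proof -
  obtain R where R: "0 < R" "\<And>x. R < norm x \<Longrightarrow> f x = 0" using test_function_support[OF f] by blast
  have "smooth f" using f by (simp add: test_functions_def)
  then show ?thesis by (rule smooth_supported_Cc[OF _ R(2)])
qed

definition time_mult :: "('a::euclidean_space \<times> real \<Rightarrow> complex) \<Rightarrow> 'a \<times> real \<Rightarrow> complex"
  where "time_mult f x = of_real (snd x) * f x"

text \<open>The coordinate \<open>t\<close> is the inner product with \<open>(0, 1)\<close>, so
  \<open>smooth_inner_mult\<close> applies. This makes \<open>time_mult f\<close> an admissible
  function in Pitt's inequality.\<close>

lemma time_mult_schwartz:
  fixes f :: "'a::euclidean_space \<times> real \<Rightarrow> complex"
  assumes f: "f \<in> test_functions"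
  shows "time_mult f \<in> schwartz"
proof -
  obtain R where R: "0 < R" "\<And>x. R < norm x \<Longrightarrow> f x = 0" using test_function_support[OF f] by blast
  have "smooth f" using f by (simp add: test_functions_def)
  from smooth_inner_mult[OF this, of "(0, 1)"] have "smooth (time_mult f)"
    by (simp add: time_mult_def[abs_def] inner_prod_def)
  then show ?thesis
    by (rule smooth_supported_schwartz[OF _ R(1)]) (simp add: time_mult_def R(2))
qed

lemma time_mult_Cc: "f \<in> Cc \<Longrightarrow> time_mult f \<in> Cc"
  unfolding time_mult_def[abs_def] by (intro Cc_mult continuous_intros)

text \<open>The \<open>t\<close>-derivative of \<open>exp (- \<i> l t) f(z, t)\<close> has integral
  0, and the product rule splits it into the two sides.\<close>

lemma fourier_t_time_deriv:
  fixes f :: "'a::euclidean_space \<times> real \<Rightarrow> complex"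
  assumes f: "f \<in> test_functions"
  shows "fourier_t (time_deriv f) l z = \<i> * of_real l * fourier_t f l z"
proof -
  have sf: "smooth f" using f by (simp add: test_functions_def)
  define e where "e t = exp (- (\<i> * complex_of_real (l * t)))" for t
  have e: "(e has_vector_derivative (- (\<i> * of_real l) * e t)) (at t)" for t
  proof -
    have "((\<lambda>z. exp (- (\<i> * of_real l) * z)) has_field_derivative (- (\<i> * of_real l) * exp (- (\<i> * of_real l) * of_real t))) (at (of_real t))"
      by (auto intro!: derivative_eq_intros)
    from has_vector_derivative_real_field[OF this, of UNIV] show ?thesis
      by (simp add: e_def[abs_def] mult.assoc)
  qed
  have ce: "continuous_on UNIV e" unfolding e_def by (intro continuous_intros)
  have c1: "(\<lambda>t. e t * f (z, t)) \<in> Cc" "(\<lambda>t. e t * time_deriv f (z, t)) \<in> Cc"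
    by (intro Cc_mult ce Cc_section test_function_Cc time_deriv_Cc f)+
  have c2: "(\<lambda>t. (- (\<i> * of_real l)) * (e t * f (z, t))) \<in> Cc"
    by (intro Cc_mult c1 continuous_intros)
  have c3: "(\<lambda>t. e t * time_deriv f (z, t) + (- (\<i> * of_real l) * e t) * f (z, t)) \<in> Cc"
    using Cc_add[OF c1(2) c2] by (simp only: mult.assoc)
  have "(\<integral>t. e t * time_deriv f (z, t) + (- (\<i> * of_real l) * e t) * f (z, t) \<partial>lborel) = 0"
    by (rule integral_derivative_Cc[OF has_vector_derivative_mult[OF e has_vector_derivative_time_deriv[OF sf]] c1(1) c3])
  then have "(\<integral>t. e t * time_deriv f (z, t) \<partial>lborel) + (\<integral>t. (- (\<i> * of_real l)) * (e t * f (z, t)) \<partial>lborel) = 0"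
    by (subst Bochner_Integration.integral_add[symmetric]) (use Cc_integrable[OF c1(2)] Cc_integrable[OF c2] in \<open>simp_all add: mult.assoc\<close>)
  then have "(\<integral>t. e t * time_deriv f (z, t) \<partial>lborel) = \<i> * of_real l * (\<integral>t. e t * f (z, t) \<partial>lborel)"
    by (simp add: integral_mult_right_zero)
  then show ?thesis by (simp add: fourier_t_def e_def mult.commute)
qed

text \<open>On each line in direction \<open>t\<close> the function \<open>t |f|\<^sup>2\<close> has
  compact support, so its derivative has integral 0. Integrating over \<open>z\<close> gives
  \<open>\<integral>|f|\<^sup>2 + J + cnj J = 0\<close>, and
  \<open>norm (J + cnj J) \<le> 2 * norm J\<close>.\<close>

lemma integral_norm_square_le:
  fixes f :: "'a::euclidean_space \<times> real \<Rightarrow> complex"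
  assumes f: "f \<in> test_functions"
  shows "(\<integral>x. (norm (f x))\<^sup>2 \<partial>lborel) \<le> 2 * norm (\<integral>x. time_deriv f x * cnj (time_mult f x) \<partial>lborel)"
    and "integrable lborel (\<lambda>x. (norm (f x))\<^sup>2)"
proof -
  have sf: "smooth f" using f by (simp add: test_functions_def)
  note fC = test_function_Cc[OF f] and dC = time_deriv_Cc[OF f] and tC = time_mult_Cc[OF test_function_Cc[OF f]]
  have cont: "continuous_on UNIV f" "continuous_on UNIV (time_deriv f)" "continuous_on UNIV (time_mult f)"
    using fC dC tC by (auto simp: Cc_def)
  have i1: "(\<lambda>x. cnj (f x) * f x) \<in> Cc" by (intro Cc_mult fC continuous_intros cont)
  have i2: "(\<lambda>x. cnj (time_mult f x) * time_deriv f x) \<in> Cc" by (intro Cc_mult dC continuous_intros cont)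
  have i3: "(\<lambda>x. cnj (time_deriv f x) * time_mult f x) \<in> Cc" by (intro Cc_mult tC continuous_intros cont)
  have sq: "cnj (f x) * f x = of_real ((norm (f x))\<^sup>2)" for x
    by (metis complex_norm_square mult.commute of_real_power)
  show int: "integrable lborel (\<lambda>x. (norm (f x))\<^sup>2)"
    using Cc_integrable[OF i1] unfolding sq complex_of_real_integrable_eq .
  have zero: "(\<integral>x. cnj (f x) * f x + (cnj (time_mult f x) * time_deriv f x + cnj (time_deriv f x) * time_mult f x) \<partial>lborel) = 0"
  proof -
    have I: "integrable (lborel \<Otimes>\<^sub>M lborel) (\<lambda>x. cnj (f x) * f x + (cnj (time_mult f x) * time_deriv f x + cnj (time_deriv f x) * time_mult f x))"
      unfolding lborel_prod
      by (intro Bochner_Integration.integrable_add Cc_integrable i1 i2 i3)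
    have "(\<integral>t. cnj (f (z, t)) * f (z, t) + (cnj (time_mult f (z, t)) * time_deriv f (z, t) + cnj (time_deriv f (z, t)) * time_mult f (z, t)) \<partial>lborel) = 0" for z
    proof (rule integral_derivative_Cc)
      let ?F = "\<lambda>t. cnj (f (z, t)) * (of_real t * f (z, t))"
      show "(?F has_vector_derivative (cnj (f (z, t)) * f (z, t) + (cnj (time_mult f (z, t)) * time_deriv f (z, t) + cnj (time_deriv f (z, t)) * time_mult f (z, t)))) (at t)" for t
      proof -
        have d: "((\<lambda>s. f (z, s)) has_vector_derivative time_deriv f (z, t)) (at t)"
          by (rule has_vector_derivative_time_deriv[OF sf])
        have c: "((\<lambda>s. cnj (f (z, s))) has_vector_derivative cnj (time_deriv f (z, t))) (at t)"
          by (rule has_vector_derivative_cnj[OF d])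
        have r: "(complex_of_real has_vector_derivative 1) (at t)"
          using has_vector_derivative_of_real[OF DERIV_ident, where ?'a=complex] by simp
        show ?thesis
          by (rule has_vector_derivative_eq_rhs[OF has_vector_derivative_mult[OF c has_vector_derivative_mult[OF r d]]])
            (simp add: time_mult_def algebra_simps)
      qed
      have cs: "continuous_on UNIV (\<lambda>t. f (z, t))" using Cc_section[OF fC, of z] by (simp add: Cc_def)
      show "?F \<in> Cc" by (intro Cc_mult Cc_section fC continuous_intros cs)
      let ?G = "\<lambda>x. cnj (f x) * f x + (cnj (time_mult f x) * time_deriv f x + cnj (time_deriv f x) * time_mult f x)"
      have "?G \<in> Cc" by (intro Cc_add i1 i2 i3)
      from Cc_section[OF this, of z]
      show "(\<lambda>t. ?G (z, t)) \<in> Cc" .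
    qed
    then show ?thesis
      unfolding lborel_prod[symmetric] using lborel_pair.integral_fst'[OF I] by simp
  qed
  define J where "J = (\<integral>x. time_deriv f x * cnj (time_mult f x) \<partial>lborel)"
  have J: "(\<integral>x. cnj (time_mult f x) * time_deriv f x \<partial>lborel) = J"
    by (simp add: J_def mult.commute)
  have J': "(\<integral>x. cnj (time_deriv f x) * time_mult f x \<partial>lborel) = cnj J"
  proof -
    have "(\<integral>x. cnj (time_deriv f x * cnj (time_mult f x)) \<partial>lborel) = cnj J"
      unfolding J_def by (rule Bochner_Integration.integral_cnj)
    then show ?thesis by simp
  qed
  have "(\<integral>x. cnj (f x) * f x \<partial>lborel) + (J + cnj J) = 0"
    using zero Cc_integrable[OF i1] Cc_integrable[OF i2] Cc_integrable[OF i3] by (simp add: J J')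
  moreover have "(\<integral>x. cnj (f x) * f x \<partial>lborel) = of_real (\<integral>x. (norm (f x))\<^sup>2 \<partial>lborel)"
    unfolding sq by (rule integral_complex_of_real)
  ultimately have "complex_of_real (\<integral>x. (norm (f x))\<^sup>2 \<partial>lborel) + (J + cnj J) = 0" by (simp only:)
  then have "complex_of_real (\<integral>x. (norm (f x))\<^sup>2 \<partial>lborel) = - (J + cnj J)"
    by (rule eq_neg_iff_add_eq_0[THEN iffD2])
  then have "norm (complex_of_real (\<integral>x. (norm (f x))\<^sup>2 \<partial>lborel)) = norm (- (J + cnj J))" by (rule arg_cong)
  also have "\<dots> = norm (J + cnj J)" by (rule norm_minus_cancel)
  also have "\<dots> \<le> 2 * norm J" using norm_triangle_ineq[of J "cnj J"] by simp
  finally show "(\<integral>x. (norm (f x))\<^sup>2 \<partial>lborel) \<le> 2 * norm (\<integral>x. time_deriv f x * cnj (time_mult f x) \<partial>lborel)"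
    by (simp add: J_def)
qed

section \<open>The Strichartz transform\<close>

text \<open>By \<open>heis_e_kernel\<close> the phase in \<open>t\<close> splits off from the
  kernel, so integrating over \<open>t\<close> first leaves the kernel applied to the partial
  Fourier transform.\<close>

lemma strichartz_eq_heis_proj:
  fixes f :: "'n::finite heis \<Rightarrow> complex"
  assumes l: "l \<noteq> 0" and f: "f \<in> Cc"
  shows "strichartz f (l, (2 * real k + real CARD('n)) * \<bar>l\<bar>) w = heis_proj k l (fourier_t f l) w"
proof -
  note [measurable] = Cc_measurable[OF f]
  have idx: "fan_index CARD('n) (l, (2 * real k + real CARD('n)) * \<bar>l\<bar>) = k"
    by (rule fan_index_eq) (use l in \<open>auto simp: fan_ray_def\<close>)
  obtain B and D :: "complex ^ 'n \<Rightarrow> real" where B: "0 \<le> B" and D: "\<And>w z :: complex ^ 'n. norm (heis_kernel k l w z :: complex) \<le> D (w - z)"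
    "\<And>z. D z \<le> B"
    using heis_kernel_bounds[OF l] by metis
  have KB: "norm (heis_kernel k l w z) \<le> B" for z
    using D(1,2) by (rule order_trans)
  define F where "F x = f x * (exp (- (\<i> * of_real (l * snd x))) * heis_kernel k l w (fst x))" for x
  have I: "integrable (lborel \<Otimes>\<^sub>M lborel) F"
    unfolding lborel_prod
  proof (rule Bochner_Integration.integrable_bound)
    show "integrable lborel (\<lambda>x. norm (f x) * B)"
      by (intro integrable_mult_left integrable_norm Cc_integrable f)
    show "F \<in> borel_measurable lborel" unfolding F_def by measurable
    show "AE x in lborel. norm (F x) \<le> norm (norm (f x) * B)"
      using KB B by (intro AE_I2) (simp add: F_def norm_mult mult_left_mono)
  qed
  have "strichartz f (l, (2 * real k + real CARD('n)) * \<bar>l\<bar>) w = (\<integral>x. F x \<partial>lborel)"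
  proof -
    have "heis_e k l (heis_mult (heis_inv x) (w, 0)) = exp (- (\<i> * of_real (l * snd x))) * heis_kernel k l w (fst x)" for x
      using heis_e_kernel[of k l "fst x" "snd x" w] by simp
    then show ?thesis using l by (simp add: strichartz_def idx F_def)
  qed
  also have "\<dots> = (\<integral>z. (\<integral>t. F (z, t) \<partial>lborel) \<partial>lborel)"
    unfolding lborel_prod[symmetric] by (rule lborel_pair.integral_fst'[OF I, symmetric])
  also have "\<dots> = heis_proj k l (fourier_t f l) w"
  proof -
    have "(\<integral>t. F (z, t) \<partial>lborel) = heis_kernel k l w z * fourier_t f l z" for z
    proof -
      have "F (z, t) = heis_kernel k l w z * (f (z, t) * exp (- (\<i> * of_real (l * t))))" for t
        by (simp add: F_def mult_ac)
      then show ?thesis by (simp only: fourier_t_def integral_mult_right_zero)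
    qed
    then show ?thesis by (simp only: heis_proj_def)
  qed
  finally show ?thesis .
qed

lemma normalized_strichartz_eq_heis_proj:
  fixes f :: "'n::finite heis \<Rightarrow> complex"
  assumes l: "l \<noteq> 0" and f: "f \<in> Cc"
  shows "normalized_strichartz f (l, (2 * real k + real CARD('n)) * \<bar>l\<bar>) w =
    heis_proj k l (fourier_t f l) w / of_real (fan_mult CARD('n) k)"
proof -
  have idx: "fan_index CARD('n) (l, (2 * real k + real CARD('n)) * \<bar>l\<bar>) = k"
    by (rule fan_index_eq) (use l in \<open>auto simp: fan_ray_def\<close>)
  show ?thesis using l unfolding normalized_strichartz_def strichartz_eq_heis_proj[OF l f] idx by simp
qed

section \<open>Measurability of the normalized transform\<close>

lemma borel_measurable_heis_integral:
  fixes f :: "'n::finite heis \<Rightarrow> complex" and K :: "(real \<times> real) \<times> (complex ^ 'n) \<Rightarrow> 'n heis \<Rightarrow> complex"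
  assumes [measurable]: "f \<in> borel_measurable borel"
    and K: "(\<lambda>p. K (fst p) (snd p)) \<in> borel_measurable borel"
  shows "(\<lambda>y. \<integral>x. f x * K y x \<partial>lborel) \<in> borel_measurable borel"
proof -
  have [measurable]: "(\<lambda>p. K (fst p) (snd p)) \<in> borel_measurable (borel \<Otimes>\<^sub>M borel)"
    using K by (simp add: borel_prod)
  have "(\<lambda>p. f (snd p) * K (fst p) (snd p)) \<in> borel_measurable (borel \<Otimes>\<^sub>M lborel)"
    by measurable
  then have "(\<lambda>(y, x). f x * K y x) \<in> borel_measurable (borel \<Otimes>\<^sub>M lborel)"
    by (simp add: case_prod_beta)
  from lborel.borel_measurable_lebesgue_integral[OF this] show ?thesis by simp
qed

lemma measurable_bessel_quotient: "bessel_quotient m \<in> borel_measurable borel"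
  unfolding bessel_quotient_def[abs_def] bessel_J_def by measurable

lemma sets_nu2 [measurable_cong]: "sets (nu2 n) = sets (restrict_space borel (fan n))"
  by (simp add: nu2_def)

lemma space_nu2: "space (nu2 n) = fan n"
  by (simp add: nu2_def space_restrict_space)

text \<open>\<open>fan_index\<close> is a definite description, with nothing known off the fan. On
  the fan it coincides with the explicit Borel function \<open>idx\<close>, which has countably many
  values, so the transform is glued from the continuous-kernel integrals \<open>N1 k\<close> and the
  Bessel integral \<open>N2\<close>.\<close>

lemma measurable_normalized_strichartz:
  fixes f :: "'n::finite heis \<Rightarrow> complex"
  assumes [measurable]: "f \<in> borel_measurable borel"
  shows "(\<lambda>(a, w). normalized_strichartz f a w) \<in> borel_measurable (nu2 CARD('n) \<Otimes>\<^sub>M lborel)"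
proof -
  \<comment> \<open>Solves \<open>snd a = (2 * real k + real CARD('n)) * \<bar>fst a\<bar>\<close>
    for \<open>k\<close>; rounding makes it a natural number at every point.\<close>
  define idx where "idx y = nat \<lfloor>(snd (fst y) / \<bar>fst (fst y)\<bar> - real CARD('n)) / 2\<rfloor>"
    for y :: "(real \<times> real) \<times> (complex ^ 'n)"
  define N1 where "N1 k y = (\<integral>x. f x * heis_e k (fst (fst y)) (heis_mult (heis_inv x) (snd y, 0)) \<partial>lborel)
      / of_real (fan_mult CARD('n) k)" for k and y :: "(real \<times> real) \<times> (complex ^ 'n)"
  define N2 where "N2 y = of_real (fact (CARD('n) - 1) * 2 ^ (CARD('n) - 1)) *
       (\<integral>x. f x * of_real (bessel_quotient (CARD('n) - 1) (sqrt (snd (fst y)) * norm (snd y - fst x))) \<partial>lborel)"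
    for y :: "(real \<times> real) \<times> (complex ^ 'n)"
  have N1 [measurable]: "N1 k \<in> borel_measurable borel" for k
  proof -
    have "continuous_on UNIV (\<lambda>p::((real \<times> real) \<times> (complex ^ 'n)) \<times> 'n heis.
        heis_e k (fst (fst (fst p))) (heis_mult (heis_inv (snd p)) (snd (fst p), 0)))"
      unfolding heis_e_def heis_mult_def heis_inv_def by (intro continuous_intros)
    from borel_measurable_heis_integral[OF assms borel_measurable_continuous_onI[OF this]]
    show ?thesis unfolding N1_def[abs_def] by (intro borel_measurable_divide) auto
  qed
  have N2 [measurable]: "N2 \<in> borel_measurable borel"
  proof -
    have "continuous_on UNIV (\<lambda>p::((real \<times> real) \<times> (complex ^ 'n)) \<times> 'n heis.
        sqrt (snd (fst (fst p))) * norm (snd (fst p) - fst (snd p)))"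
      by (intro continuous_intros)
    from measurable_compose[OF borel_measurable_continuous_onI[OF this] measurable_bessel_quotient[of "CARD('n) - 1"]]
    have "(\<lambda>p::((real \<times> real) \<times> (complex ^ 'n)) \<times> 'n heis.
        complex_of_real (bessel_quotient (CARD('n) - 1) (sqrt (snd (fst (fst p))) * norm (snd (fst p) - fst (snd p))))) \<in> borel_measurable borel"
      by (rule measurable_compose[where g=complex_of_real]) simp
    from borel_measurable_heis_integral[OF assms this] show ?thesis
      unfolding N2_def[abs_def] by (intro borel_measurable_times) auto
  qed
  have [measurable]: "idx \<in> measurable borel (count_space UNIV)"
    unfolding idx_def[abs_def] by measurable
  have [measurable]: "(\<lambda>y. N1 (idx y) y) \<in> borel_measurable borel"
    by (rule measurable_compose_countable[where f=N1 and g=idx]) measurable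
  have N: "(\<lambda>y. if fst (fst y) \<noteq> 0 then N1 (idx y) y else N2 y) \<in> borel_measurable borel"
    by measurable
  have "(\<lambda>y. y) \<in> nu2 CARD('n) \<Otimes>\<^sub>M (lborel :: (complex ^ 'n) measure) \<rightarrow>\<^sub>M borel"
  proof -
    have "(\<lambda>x. x) \<in> nu2 CARD('n) \<rightarrow>\<^sub>M borel"
      by (simp add: measurable_cong_sets[OF sets_nu2 refl] measurable_restrict_space1)
    from measurable_compose[OF measurable_fst this]
    have [measurable]: "fst \<in> nu2 CARD('n) \<Otimes>\<^sub>M (lborel :: (complex ^ 'n) measure) \<rightarrow>\<^sub>M borel" .
    have "(\<lambda>x. (fst x, snd x)) \<in> nu2 CARD('n) \<Otimes>\<^sub>M (lborel :: (complex ^ 'n) measure) \<rightarrow>\<^sub>M borel \<Otimes>\<^sub>M borel"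
      by (rule measurable_Pair) auto
    then show ?thesis by (simp add: borel_prod)
  qed
  from measurable_compose[OF this N]
  have "(\<lambda>y. if fst (fst y) \<noteq> 0 then N1 (idx y) y else N2 y) \<in> borel_measurable (nu2 CARD('n) \<Otimes>\<^sub>M lborel)"
    .
  also have "?this \<longleftrightarrow> ?thesis"
  proof (rule measurable_cong)
    fix y :: "(real \<times> real) \<times> (complex ^ 'n)" assume "y \<in> space (nu2 CARD('n) \<Otimes>\<^sub>M lborel)"
    then have "fst y \<in> fan CARD('n)" by (auto simp: space_pair_measure space_nu2)
    moreover have "fan_index CARD('n) (fst y) = idx y" if "fst y \<in> fan_ray CARD('n) k" for k
    proof -
      have "snd (fst y) / \<bar>fst (fst y)\<bar> = 2 * real k + real CARD('n)"
        using that by (auto simp: fan_ray_def)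
      then have "idx y = nat \<lfloor>real k\<rfloor>" by (simp add: idx_def)
      then show ?thesis using fan_index_eq[OF that] by simp
    qed
    ultimately have "fan_index CARD('n) (fst y) = idx y" if "fst (fst y) \<noteq> 0"
      using that by (auto simp: fan_def fan_limit_ray_def)
    then show "(if fst (fst y) \<noteq> 0 then N1 (idx y) y else N2 y) = (case y of (a, w) \<Rightarrow> normalized_strichartz f a w)"
      by (cases y) (auto simp: normalized_strichartz_def strichartz_def N1_def N2_def)
  qed
  finally show ?thesis .
qed

lemma fan_mult_pos: "fan_mult n k > 0"
  by (simp add: fan_mult_def)

lemma measurable_fan_fst: "(\<lambda>(a, w). \<bar>fst a\<bar>) \<in> borel_measurable (nu2 n \<Otimes>\<^sub>M lborel)"
proof -
  have "(\<lambda>x. x) \<in> nu2 n \<rightarrow>\<^sub>M borel"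
    by (simp add: measurable_cong_sets[OF sets_nu2 refl] measurable_restrict_space1)
  then have "(\<lambda>a. \<bar>fst a\<bar>) \<in> borel_measurable (nu2 n)" by measurable
  then show ?thesis unfolding case_prod_beta by (rule measurable_compose[OF measurable_fst])
qed

text \<open>The two normalizations divide by the square of \<open>fan_mult\<close>, which the weight
  in \<open>nu2\<close> restores. The constants \<open>1 / (2 * pi)\<close> from
  \<open>parseval_inequality\<close> and \<open>(\<bar>l\<bar> / (2 * pi)) ^ (2 * CARD('n))\<close>
  from \<open>spectral_inequality\<close> form the rest of the density; the additional
  \<open>\<bar>l\<bar>\<close> comes from the time derivative.\<close>

lemma integral_norm_square_le_fan:
  fixes f :: "'n::finite heis \<Rightarrow> complex"
  assumes f: "f \<in> test_functions"
  shows "(\<integral>\<^sup>+x. ennreal ((norm (f x))\<^sup>2) \<partial>lebesgue) \<le> 2 *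
    (\<integral>\<^sup>+(a, w). ennreal (\<bar>fst a\<bar> * norm (normalized_strichartz f a w) * norm (normalized_strichartz (time_mult f) a w))
      \<partial>fan_measure)"
proof -
  let ?n = "CARD('n)"
  define h where "h = time_deriv f"
  define g where "g = time_mult f"
  have fC: "f \<in> Cc" and hC: "h \<in> Cc" and gC: "g \<in> Cc"
    unfolding h_def g_def by (intro test_function_Cc time_deriv_Cc time_mult_Cc f)+
  define S where "S l = (\<Sum>k. \<integral>\<^sup>+w. ennreal (norm (heis_proj k l (fourier_t f l) w) * norm (heis_proj k l (fourier_t g l) w)) \<partial>lborel)"
    for l
  define \<phi> where "\<phi> = (\<lambda>(a, w). ennreal (\<bar>fst a\<bar> * norm (normalized_strichartz f a w) * norm (normalized_strichartz g a w)))"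
  have \<phi>m: "\<phi> \<in> borel_measurable (nu2 ?n \<Otimes>\<^sub>M lborel)"
    using measurable_normalized_strichartz[OF Cc_measurable[OF fC]]
      measurable_normalized_strichartz[OF Cc_measurable[OF gC]] measurable_fan_fst[of ?n]
    unfolding \<phi>_def case_prod_beta by measurable
  define \<Phi> where "\<Phi> a = (\<integral>\<^sup>+w. \<phi> (a, w) \<partial>lborel)" for a
  have \<Phi>m: "\<Phi> \<in> borel_measurable (restrict_space borel (fan ?n))"
    using lborel.borel_measurable_nn_integral_fst[OF \<phi>m]
    unfolding \<Phi>_def[abs_def] by (simp add: measurable_cong_sets[OF sets_nu2 refl])
  have spec: "ennreal (norm (\<integral>z. fourier_t h l z * cnj (fourier_t g l z) \<partial>lborel)) \<le>
      ennreal ((\<bar>l\<bar> / (2 * pi)) ^ (2 * ?n) * \<bar>l\<bar>) * S l" if l: "l \<noteq> 0" for l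
  proof -
    have hp: "heis_proj k l (fourier_t h l) w = \<i> * of_real l * heis_proj k l (fourier_t f l) w" for k w
    proof -
      have "heis_kernel k l w z * fourier_t h l z = \<i> * of_real l * (heis_kernel k l w z * fourier_t f l z)" for z
        unfolding h_def fourier_t_time_deriv[OF f] by (simp add: mult_ac)
      then show ?thesis by (simp only: heis_proj_def integral_mult_right_zero)
    qed
    have pm: "heis_proj k l (fourier_t f l) \<in> borel_measurable borel" "heis_proj k l (fourier_t g l) \<in> borel_measurable borel" for k
      using heis_proj_integrable(1)[OF l fourier_t_Cc[OF fC]] heis_proj_integrable(1)[OF l fourier_t_Cc[OF gC]]
      by (auto dest: borel_measurable_integrable)
    have "(\<integral>\<^sup>+w. ennreal (norm (heis_proj k l (fourier_t h l) w) * norm (heis_proj k l (fourier_t g l) w)) \<partial>lborel) =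
        ennreal \<bar>l\<bar> * (\<integral>\<^sup>+w. ennreal (norm (heis_proj k l (fourier_t f l) w) * norm (heis_proj k l (fourier_t g l) w)) \<partial>lborel)" for k
      using pm[of k] by (subst nn_integral_cmult[symmetric])
        (auto simp: hp norm_mult mult.assoc ennreal_mult intro!: nn_integral_cong)
    then show ?thesis
      using spectral_inequality[OF l fourier_t_Cc[OF hC, of l] fourier_t_Cc[OF gC, of l]]
      by (simp add: S_def ennreal_suminf_cmult ennreal_mult mult.assoc)
  qed
  have fan_int: "(\<Sum>k. ennreal ((fan_mult ?n k)\<^sup>2) * \<Phi> (l, (2 * real k + real ?n) * \<bar>l\<bar>)) = ennreal \<bar>l\<bar> * S l" if l: "l \<noteq> 0" for l
  proof -
    have pm: "heis_proj k l (fourier_t f l) \<in> borel_measurable borel" "heis_proj k l (fourier_t g l) \<in> borel_measurable borel" for k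
      using heis_proj_integrable(1)[OF l fourier_t_Cc[OF fC]] heis_proj_integrable(1)[OF l fourier_t_Cc[OF gC]]
      by (auto dest: borel_measurable_integrable)
    have "ennreal ((fan_mult ?n k)\<^sup>2) * \<Phi> (l, (2 * real k + real ?n) * \<bar>l\<bar>) =
        ennreal \<bar>l\<bar> * (\<integral>\<^sup>+w. ennreal (norm (heis_proj k l (fourier_t f l) w) * norm (heis_proj k l (fourier_t g l) w)) \<partial>lborel)" for k
    proof -
      define m where "m = fan_mult ?n k"
      have m: "m > 0" by (simp add: m_def fan_mult_pos)
      have "\<phi> ((l, (2 * real k + real ?n) * \<bar>l\<bar>), w) =
          ennreal (\<bar>l\<bar> / m\<^sup>2) * ennreal (norm (heis_proj k l (fourier_t f l) w) * norm (heis_proj k l (fourier_t g l) w))" for w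
        using m unfolding \<phi>_def
        by (simp add: normalized_strichartz_eq_heis_proj[OF l fC] normalized_strichartz_eq_heis_proj[OF l gC]
            m_def[symmetric] norm_divide ennreal_mult[symmetric] power2_eq_square)
      then have "\<Phi> (l, (2 * real k + real ?n) * \<bar>l\<bar>) =
          ennreal (\<bar>l\<bar> / m\<^sup>2) * (\<integral>\<^sup>+w. ennreal (norm (heis_proj k l (fourier_t f l) w) * norm (heis_proj k l (fourier_t g l) w)) \<partial>lborel)"
        unfolding \<Phi>_def using pm[of k] by (simp add: nn_integral_cmult)
      moreover have "ennreal (m\<^sup>2) * ennreal (\<bar>l\<bar> / m\<^sup>2) = ennreal \<bar>l\<bar>"
        using m by (simp add: ennreal_mult[symmetric])
      ultimately show ?thesis by (simp add: m_def mult.assoc[symmetric])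
    qed
    then show ?thesis by (simp add: S_def ennreal_suminf_cmult)
  qed
  have "(\<integral>\<^sup>+x. ennreal ((norm (f x))\<^sup>2) \<partial>lebesgue) = ennreal (\<integral>x. (norm (f x))\<^sup>2 \<partial>lborel)"
    unfolding nn_integral_completion
    by (rule nn_integral_eq_integral[OF integral_norm_square_le(2)[OF f]]) simp
  also have "\<dots> \<le> ennreal (2 * norm (\<integral>x. h x * cnj (g x) \<partial>lborel))"
    unfolding h_def g_def by (intro ennreal_leI integral_norm_square_le(1) f)
  also have "\<dots> = 2 * ennreal (norm (\<integral>x. h x * cnj (g x) \<partial>lborel))"
    by (simp add: ennreal_mult)
  also have "\<dots> \<le> 2 * (ennreal (1 / (2 * pi)) * (\<integral>\<^sup>+l. ennreal (norm (\<integral>z. fourier_t h l z * cnj (fourier_t g l z) \<partial>lborel)) \<partial>lborel))"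
    by (intro mult_left_mono parseval_inequality hC gC) simp
  also have "\<dots> \<le> 2 * (ennreal (1 / (2 * pi)) * (\<integral>\<^sup>+l. ennreal (1 / (2 * pi) ^ (2 * ?n)) *
      ((\<Sum>k. ennreal ((fan_mult ?n k)\<^sup>2) * \<Phi> (l, (2 * real k + real ?n) * \<bar>l\<bar>)) * ennreal (\<bar>l\<bar> ^ (2 * ?n))) \<partial>lborel))"
  proof (intro mult_left_mono nn_integral_mono_AE)
    \<comment> \<open>The spectral estimate and the formula on the rays hold for
      \<open>l \<noteq> 0\<close> only; the single point 0 is a null set.\<close>
    have "AE l in lborel. l \<noteq> (0::real)" by (rule AE_lborel_singleton)
    then show "AE l in lborel. ennreal (norm (\<integral>z. fourier_t h l z * cnj (fourier_t g l z) \<partial>lborel)) \<le>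
      ennreal (1 / (2 * pi) ^ (2 * ?n)) *
      ((\<Sum>k. ennreal ((fan_mult ?n k)\<^sup>2) * \<Phi> (l, (2 * real k + real ?n) * \<bar>l\<bar>)) * ennreal (\<bar>l\<bar> ^ (2 * ?n)))"
    proof eventually_elim
      case (elim l)
      have "(\<bar>l\<bar> / (2 * pi)) ^ (2 * ?n) * \<bar>l\<bar> = 1 / (2 * pi) ^ (2 * ?n) * (\<bar>l\<bar> * \<bar>l\<bar> ^ (2 * ?n))"
        unfolding power_divide by simp
      then have "ennreal ((\<bar>l\<bar> / (2 * pi)) ^ (2 * ?n) * \<bar>l\<bar>) * S l =
         ennreal (1 / (2 * pi) ^ (2 * ?n)) * ((ennreal \<bar>l\<bar> * S l) * ennreal (\<bar>l\<bar> ^ (2 * ?n)))"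
        by (simp only: ennreal_mult zero_le_divide_1_iff zero_le_power abs_ge_zero pi_ge_zero mult_nonneg_nonneg zero_le_numeral mult_ac)
      with spec[OF elim] show ?case unfolding fan_int[OF elim] by simp
    qed
  qed auto
  also have "\<dots> = 2 * (\<integral>\<^sup>+a. \<Phi> a \<partial>nu2 ?n)"
  proof -
    have m: "(\<lambda>l. (\<Sum>k. ennreal ((fan_mult ?n k)\<^sup>2) * \<Phi> (l, (2 * real k + real ?n) * \<bar>l\<bar>)) * ennreal (\<bar>l\<bar> ^ (2 * ?n))) \<in> borel_measurable lborel"
    proof -
      have [measurable]: "(\<lambda>l. \<Phi> (l, (2 * real k + real ?n) * \<bar>l\<bar>)) \<in> borel_measurable lborel" for k
      proof (rule measurable_compose[OF _ \<Phi>m])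
        show "(\<lambda>l. (l, (2 * real k + real ?n) * \<bar>l\<bar>)) \<in> lborel \<rightarrow>\<^sub>M restrict_space borel (fan ?n)"
          by (rule measurable_restrict_space2) (auto simp: fan_param_in)
      qed
      show ?thesis by measurable
    qed
    have "ennreal (1 / (2 * pi)) * ennreal (1 / (2 * pi) ^ (2 * ?n)) = ennreal (1 / (2 * pi) ^ (2 * ?n + 1))"
      by (subst ennreal_mult[symmetric]) simp_all
    then show ?thesis
      unfolding nn_integral_nu2[OF \<Phi>m] nn_integral_cmult[OF m] by (simp only: mult.assoc[symmetric])
  qed
  also have "(\<integral>\<^sup>+a. \<Phi> a \<partial>nu2 ?n) = (\<integral>\<^sup>+y. \<phi> y \<partial>fan_measure)"
    unfolding \<Phi>_def fan_measure_def nn_integral_completion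
    by (rule lborel.nn_integral_fst[OF \<phi>m])
  finally show ?thesis by (simp add: \<phi>_def g_def)
qed


section \<open>Hoelder's inequality and the uncertainty inequality\<close>

lemma ennreal_powr_eq_0_iff: "ennreal_powr x r = 0 \<longleftrightarrow> x = 0"
  by (cases x) (auto simp: ennreal_powr_def top_ereal_def ennreal_eq_0_iff powr_nonneg_iff less_le)

lemma ennreal_powr_eq_top_iff: "ennreal_powr x r = top \<longleftrightarrow> x = top"
  by (auto simp: ennreal_powr_def)

lemma ennreal_powr_ennreal: "0 \<le> x \<Longrightarrow> ennreal_powr (ennreal x) r = ennreal (x powr r)"
  by (simp add: ennreal_powr_def)

lemma measurable_ennreal_powr [measurable (raw)]:
  assumes [measurable]: "F \<in> borel_measurable M"
  shows "(\<lambda>x. ennreal_powr (F x) r) \<in> borel_measurable M"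
  unfolding ennreal_powr_def
proof (rule measurable_If)
  show "{x \<in> space M. F x = \<infinity>} \<in> sets M"
    using measurable_sets[OF assms, of "{\<infinity>}"] by (simp add: vimage_def Int_def conj_commute)
  show "(\<lambda>x. ennreal (enn2real (F x) powr r)) \<in> borel_measurable M"
    by measurable
qed simp

lemma ennreal_powr_1: "ennreal_powr x 1 = x"
  by (cases x) (auto simp: ennreal_powr_def)

lemma Lp_norm_1: "Lp_norm M 1 F = (\<integral>\<^sup>+x. F x \<partial>M)"
  by (simp add: Lp_norm_def ennreal_powr_1)

text \<open>Serves the points where \<open>u\<close> vanishes: the finite values obtained here force
  \<open>\<bar>\<lambda>\<bar>\<close> times the modulus of the transform of \<open>f\<close> to be
  0 at almost all of them.\<close>

lemma Lp_norm_finite_AE: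
  assumes F[measurable]: "F \<in> borel_measurable M" and fin: "Lp_norm M p F \<noteq> \<infinity>"
  shows "AE x in M. F x \<noteq> \<infinity>"
proof (cases "p = \<infinity>")
  case True
  then have "esssup M F < \<infinity>" using fin by (simp add: Lp_norm_def less_top)
  then show ?thesis
    using esssup_AE[of F M] by (auto elim!: eventually_mono simp: top_unique)
next
  case False
  then have "(\<integral>\<^sup>+x. ennreal_powr (F x) (enn2real p) \<partial>M) \<noteq> \<infinity>"
    using fin by (simp add: Lp_norm_def ennreal_powr_eq_top_iff)
  from nn_integral_PInf_AE[OF _ this]
  have "AE x in M. ennreal_powr (F x) (enn2real p) \<noteq> \<infinity>" by simp
  then show ?thesis by (simp add: ennreal_powr_eq_top_iff)
qed

text \<open>Young's inequality for \<open>F\<close> and \<open>G\<close> scaled to norm 1, after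
  separating the cases in which a norm is 0 or infinite and scaling is impossible.\<close>

lemma nn_integral_Hoelder_real:
  assumes [measurable]: "F \<in> borel_measurable M" "G \<in> borel_measurable M"
    and a: "1 < a" and b: "1 < b" and ab: "1 / a + 1 / b = 1"
  shows "(\<integral>\<^sup>+x. F x * G x \<partial>M) \<le> ennreal_powr (\<integral>\<^sup>+x. ennreal_powr (F x) a \<partial>M) (1 / a) *
    ennreal_powr (\<integral>\<^sup>+x. ennreal_powr (G x) b \<partial>M) (1 / b)"
proof -
  define X where "X = (\<integral>\<^sup>+x. ennreal_powr (F x) a \<partial>M)"
  define Y where "Y = (\<integral>\<^sup>+x. ennreal_powr (G x) b \<partial>M)"
  consider "X = 0" | "Y = 0" | "X \<noteq> 0" "Y \<noteq> 0" "X = \<infinity> \<or> Y = \<infinity>" | "X \<noteq> 0" "Y \<noteq> 0" "X \<noteq> \<infinity>" "Y \<noteq> \<infinity>" by blast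
  then have "(\<integral>\<^sup>+x. F x * G x \<partial>M) \<le> ennreal_powr X (1 / a) * ennreal_powr Y (1 / b)"
  proof cases
    \<comment> \<open>The other norm may be infinite, and the product on the right then reads 0;
      this is consistent because \<open>F\<close> vanishes almost everywhere.\<close>
    case 1
    then have "AE x in M. F x * G x = 0"
      unfolding X_def by (subst (asm) nn_integral_0_iff_AE) (auto simp: ennreal_powr_eq_0_iff)
    then have "(\<integral>\<^sup>+x. F x * G x \<partial>M) = 0" by (subst nn_integral_0_iff_AE) auto
    then show ?thesis by simp
  next
    case 2
    then have "AE x in M. F x * G x = 0"
      unfolding Y_def by (subst (asm) nn_integral_0_iff_AE) (auto simp: ennreal_powr_eq_0_iff)
    then have "(\<integral>\<^sup>+x. F x * G x \<partial>M) = 0" by (subst nn_integral_0_iff_AE) auto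
    then show ?thesis by simp
  next
    case 3
    then have "ennreal_powr X (1 / a) * ennreal_powr Y (1 / b) = \<infinity>"
      by (metis ennreal_mult_eq_top_iff ennreal_powr_eq_0_iff ennreal_powr_eq_top_iff infinity_ennreal_def)
    then show ?thesis by simp
  next
    case 4
    then obtain X' Y' where XY: "X = ennreal X'" "0 \<le> X'" "Y = ennreal Y'" "0 \<le> Y'"
      by (cases X; cases Y) auto
    with 4 have pos: "0 < X'" "0 < Y'" by (auto simp: less_le)
    \<comment> \<open>\<open>x\<close> and \<open>y\<close> are the two norms. Young's inequality
      for \<open>f / x\<close> and \<open>g / y\<close>, multiplied by \<open>x * y\<close>, is
      \<open>young\<close>; its coefficients integrate to
      \<open>x * y * (1 / a + 1 / b)\<close>.\<close>
    define x where "x = X' powr (1 / a)"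
    define y where "y = Y' powr (1 / b)"
    have xy: "0 < x" "0 < y" using pos by (simp_all add: x_def y_def)
    have xa: "x powr a = X'" "y powr b = Y'" using pos a b by (simp_all add: x_def y_def powr_powr)
    have young: "f * g \<le> x * y / (a * X') * f powr a + x * y / (b * Y') * g powr b" if "0 \<le> f" "0 \<le> g" for f g
    proof -
      have "(f / x) * (g / y) \<le> (f / x) powr a / a + (g / y) powr b / b"
        by (rule Youngs_inequality) (use a b ab that xy in auto)
      also have "\<dots> = f powr a / X' / a + g powr b / Y' / b"
        using that xy by (simp add: powr_divide xa)
      finally have "x * y * ((f / x) * (g / y)) \<le> x * y * (f powr a / X' / a + g powr b / Y' / b)"
        using xy by (intro mult_left_mono) auto
      then show ?thesis using xy by (simp add: field_simps)
    qed
    have "X \<noteq> \<infinity>" "Y \<noteq> \<infinity>" using 4 by auto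
    then have fin: "AE z in M. F z \<noteq> \<infinity>" "AE z in M. G z \<noteq> \<infinity>"
      using nn_integral_PInf_AE[of "\<lambda>z. ennreal_powr (F z) a" M] nn_integral_PInf_AE[of "\<lambda>z. ennreal_powr (G z) b" M]
      by (auto simp: X_def Y_def ennreal_powr_eq_top_iff)
    have "(\<integral>\<^sup>+z. F z * G z \<partial>M) \<le> (\<integral>\<^sup>+z. ennreal (x * y / (a * X')) * ennreal_powr (F z) a +
        ennreal (x * y / (b * Y')) * ennreal_powr (G z) b \<partial>M)"
    proof (rule nn_integral_mono_AE, use fin in eventually_elim)
      case (elim z)
      then obtain f g where fg: "F z = ennreal f" "0 \<le> f" "G z = ennreal g" "0 \<le> g"
        by (cases "F z"; cases "G z") auto
      have "F z * G z = ennreal (f * g)" using fg by (simp add: ennreal_mult)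
      also have "\<dots> \<le> ennreal (x * y / (a * X') * f powr a + x * y / (b * Y') * g powr b)"
        by (rule ennreal_leI[OF young]) (use fg in auto)
      also have "\<dots> = ennreal (x * y / (a * X')) * ennreal_powr (F z) a + ennreal (x * y / (b * Y')) * ennreal_powr (G z) b"
        using fg xy pos a b
        by (simp add: ennreal_powr_ennreal ennreal_mult[symmetric] ennreal_plus[symmetric] del: ennreal_plus)
      finally show ?case .
    qed
    also have "\<dots> = ennreal (x * y / (a * X')) * X + ennreal (x * y / (b * Y')) * Y"
      by (simp add: nn_integral_add nn_integral_cmult X_def Y_def)
    also have "\<dots> = ennreal (x * y / (a * X') * X' + x * y / (b * Y') * Y')"
      using XY xy pos a b by (simp add: ennreal_mult[symmetric] ennreal_plus[symmetric] del: ennreal_plus)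
    also have "x * y / (a * X') * X' + x * y / (b * Y') * Y' = x * y * (1 / a + 1 / b)"
      using pos by (simp add: field_simps)
    also have "\<dots> = x * y" using ab by simp
    finally show ?thesis
      using XY xy by (simp add: ennreal_powr_ennreal x_def y_def ennreal_mult)
  qed
  then show ?thesis by (simp add: X_def Y_def)
qed

text \<open>In \<open>ennreal\<close>, \<open>1 / \<infinity> = 0\<close> produces the two end point
  cases, and \<open>1 / 0 = \<infinity>\<close> rules out \<open>q' = 0\<close>. All other pairs
  become real exponents strictly above 1.\<close>

lemma conjugate_exponent_cases:
  fixes q q' :: ennreal
  assumes q: "1 \<le> q" and conj: "1 / q + 1 / q' = 1"
  obtains "q = 1" "q' = \<infinity>" | "q = \<infinity>" "q' = 1"
    | "q \<noteq> \<infinity>" "q' \<noteq> \<infinity>" "1 < enn2real q" "1 < enn2real q'" "1 / enn2real q' + 1 / enn2real q = 1"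
proof (cases q)
  case top
  have "q' = 1"
  proof (cases q')
    case (real r)
    have "r \<noteq> 0" using conj top real by auto
    with real have r: "r > 0" by simp
    then have "ennreal (1 / r) = ennreal 1"
      using conj top real by (simp add: divide_ennreal flip: ennreal_1)
    then have "1 / r = 1" using r by (subst (asm) ennreal_inj) auto
    then show ?thesis using real by simp
  qed (use conj top in simp)
  with top that(2) show ?thesis by simp
next
  case (real r)
  have r: "r \<ge> 1" using q real by (simp add: ennreal_le_iff flip: ennreal_1)
  show ?thesis
  proof (cases q')
    case top
    have "ennreal (1 / r) = ennreal 1"
      using conj top real r by (simp add: divide_ennreal flip: ennreal_1)
    then have "1 / r = 1" using r by (subst (asm) ennreal_inj) auto
    then show ?thesis using that(1) top real by simp
  next
    case (real s)
    have "s \<noteq> 0" using conj real by auto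
    with real have s: "s > 0" by simp
    have "ennreal (1 / r + 1 / s) = ennreal 1"
      using conj real \<open>q = ennreal r\<close> r s by (simp add: divide_ennreal flip: ennreal_1)
    then have rs: "1 / r + 1 / s = 1" using r s by (subst (asm) ennreal_inj) auto
    have "1 / s > 0" "1 / r > 0" using r s by simp_all
    then have "1 / r < 1" "1 / s < 1" using rs by linarith+
    then have "r > 1" "s > 1" using r s by (simp_all add: field_simps)
    then show ?thesis
      using that(3) real \<open>q = ennreal r\<close> r s rs by (simp add: add.commute)
  qed
qed

lemma Lp_norm_Hoelder:
  fixes q q' :: ennreal
  assumes [measurable]: "F \<in> borel_measurable M" "G \<in> borel_measurable M"
    and q: "1 \<le> q" and conj: "1 / q + 1 / q' = 1"
  shows "(\<integral>\<^sup>+x. F x * G x \<partial>M) \<le> Lp_norm M q' F * Lp_norm M q G"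
  using q conj
proof (cases rule: conjugate_exponent_cases)
  case 1
  have "(\<integral>\<^sup>+x. F x * G x \<partial>M) \<le> (\<integral>\<^sup>+x. esssup M F * G x \<partial>M)"
    using esssup_AE[of F M] by (intro nn_integral_mono_AE) (auto elim!: eventually_mono intro: mult_right_mono)
  then show ?thesis using 1 by (simp add: Lp_norm_1 nn_integral_cmult) (simp add: Lp_norm_def)
next
  case 2
  have "(\<integral>\<^sup>+x. F x * G x \<partial>M) \<le> (\<integral>\<^sup>+x. F x * esssup M G \<partial>M)"
    using esssup_AE[of G M] by (intro nn_integral_mono_AE) (auto elim!: eventually_mono intro: mult_left_mono)
  then show ?thesis using 2 by (simp add: Lp_norm_1 nn_integral_multc) (simp add: Lp_norm_def)
next
  case 3
  then show ?thesis
    using nn_integral_Hoelder_real[of F M G "enn2real q'" "enn2real q"] by (simp add: Lp_norm_def)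
qed

theorem theorem3p1p1:
  fixes p q q' :: ennreal
    and u :: "(real \<times> real) \<times> (complex ^ 'n::finite) \<Rightarrow> real"
    and v :: "'n heis \<Rightarrow> real"
  assumes "1 \<le> p" and "1 \<le> q" and "1 / q + 1 / q' = 1"
    and "u \<in> borel_measurable fan_measure"
    and "\<And>a w. a \<in> fan CARD('n) \<Longrightarrow> 0 \<le> u (a, w)"
    and "v \<in> borel_measurable lebesgue"
    and "\<And>x. 0 \<le> v x"
    and pitt: "\<exists>C0::real. \<forall>g \<in> schwartz.
      Lp_norm fan_measure q
        (\<lambda>(a, w). ennreal (norm (normalized_strichartz g a w)) * ennreal (u (a, w)))
      \<le> ennreal C0 * Lp_norm lebesgue p (\<lambda>x. ennreal (norm (g x)) * ennreal (v x))"
  shows "\<exists>C::real. \<forall>f \<in> test_functions.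
    (let A = Lp_norm fan_measure q'
               (\<lambda>(a, w). ennreal \<bar>fst a\<bar> * inverse (ennreal (u (a, w)))
                          * ennreal (norm (normalized_strichartz f a w)));
         B = Lp_norm lebesgue p (\<lambda>(z, t). ennreal \<bar>t\<bar> * ennreal (v (z, t)) * ennreal (norm (f (z, t))))
     in \<not> (A = \<infinity> \<and> B = 0) \<longrightarrow>
        (\<integral>\<^sup>+x. ennreal ((norm (f x))\<^sup>2) \<partial>lebesgue) \<le> ennreal C * A * B)"
proof -
  obtain C0 where C0: "\<And>g. g \<in> schwartz \<Longrightarrow>
      Lp_norm fan_measure q (\<lambda>(a, w). ennreal (norm (normalized_strichartz g a w)) * ennreal (u (a, w)))
      \<le> ennreal C0 * Lp_norm lebesgue p (\<lambda>x. ennreal (norm (g x)) * ennreal (v x))"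
    using pitt by blast
  \<comment> \<open>\<open>2 * C0\<close> is the constant of the estimate, with the 2 from
    integration by parts. The maximum keeps \<open>C\<close> positive, so that
    \<open>ennreal C\<close> cannot annihilate an infinite \<open>A\<close>.\<close>
  define C where "C = max 1 (2 * C0)"
  note [measurable] = \<open>u \<in> borel_measurable fan_measure\<close>
  have "(\<integral>\<^sup>+x. ennreal ((norm (f x))\<^sup>2) \<partial>lebesgue) \<le> ennreal C * A * B"
    if f: "f \<in> test_functions"
      and A: "A = Lp_norm fan_measure q'
               (\<lambda>(a, w). ennreal \<bar>fst a\<bar> * inverse (ennreal (u (a, w)))
                          * ennreal (norm (normalized_strichartz f a w)))"
      and B: "B = Lp_norm lebesgue p (\<lambda>(z, t). ennreal \<bar>t\<bar> * ennreal (v (z, t)) * ennreal (norm (f (z, t))))"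
      and nz: "\<not> (A = \<infinity> \<and> B = 0)"
    for f :: "'n heis \<Rightarrow> complex" and A B
  proof (cases "A = \<infinity>")
    case True
    \<comment> \<open>\<open>nz\<close> gives \<open>B \<noteq> 0\<close> here and
      \<open>C \<ge> 1\<close>, so no factor 0 meets the infinite one.\<close>
    then have "ennreal C * A * B = \<infinity>"
      using nz by (simp add: C_def ennreal_mult_eq_top_iff ennreal_eq_0_iff)
    then show ?thesis by simp
  next
    case False
    define N where "N = (fan_measure :: ((real \<times> real) \<times> (complex ^ 'n)) measure)"
    define f' where "f' y = norm (normalized_strichartz f (fst y) (snd y))" for y
    define g' where "g' y = norm (normalized_strichartz (time_mult f) (fst y) (snd y))" for y
    define F where "F y = ennreal \<bar>fst (fst y)\<bar> * inverse (ennreal (u y)) * ennreal (f' y)" for y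
    define G where "G y = ennreal (g' y) * ennreal (u y)" for y
    have fC: "f \<in> Cc" and gC: "time_mult f \<in> Cc"
      by (intro test_function_Cc time_mult_Cc f)+
    have [measurable]: "u \<in> borel_measurable N" unfolding N_def by measurable
    have [measurable]: "f' \<in> borel_measurable N" "g' \<in> borel_measurable N" "(\<lambda>y. \<bar>fst (fst y)\<bar>) \<in> borel_measurable N"
      using measurable_completion[OF measurable_normalized_strichartz[OF Cc_measurable[OF fC]]]
        measurable_completion[OF measurable_normalized_strichartz[OF Cc_measurable[OF gC]]]
        measurable_completion[OF measurable_fan_fst[of "CARD('n)"]]
      unfolding f'_def[abs_def] g'_def[abs_def] N_def fan_measure_def case_prod_unfold by simp_all
    have Fm: "F \<in> borel_measurable N" and Gm: "G \<in> borel_measurable N"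
      unfolding F_def[abs_def] G_def[abs_def] by measurable
    have AF: "A = Lp_norm N q' F"
      by (simp add: A F_def[abs_def] f'_def N_def case_prod_unfold)
    have GB: "Lp_norm N q G \<le> ennreal C0 * B"
    proof -
      have "Lp_norm N q G \<le> ennreal C0 * Lp_norm lebesgue p (\<lambda>x. ennreal (norm (time_mult f x)) * ennreal (v x))"
        using C0[OF time_mult_schwartz[OF f]] by (simp add: G_def[abs_def] g'_def N_def case_prod_unfold)
      also have "(\<lambda>x. ennreal (norm (time_mult f x)) * ennreal (v x)) =
          (\<lambda>(z, t). ennreal \<bar>t\<bar> * ennreal (v (z, t)) * ennreal (norm (f (z, t))))"
        by (auto simp: fun_eq_iff time_mult_def norm_mult ennreal_mult mult_ac)
      finally show ?thesis by (simp add: B)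
    qed
    have "(\<integral>\<^sup>+x. ennreal ((norm (f x))\<^sup>2) \<partial>lebesgue) \<le> 2 * (\<integral>\<^sup>+y. ennreal (\<bar>fst (fst y)\<bar> * f' y * g' y) \<partial>N)"
      using integral_norm_square_le_fan[OF f] by (simp add: f'_def g'_def N_def case_prod_unfold)
    also have "(\<integral>\<^sup>+y. ennreal (\<bar>fst (fst y)\<bar> * f' y * g' y) \<partial>N) \<le> (\<integral>\<^sup>+y. F y * G y \<partial>N)"
    proof (rule nn_integral_mono_AE)
      \<comment> \<open>The pointwise comparison below can fail only where \<open>u y = 0\<close>
        and \<open>F y = \<infinity>\<close>; finiteness of \<open>A\<close> confines such points to
        a null set.\<close>
      have "AE y in N. F y \<noteq> \<infinity>"
        by (rule Lp_norm_finite_AE[OF Fm]) (use False AF in simp)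
      then show "AE y in N. ennreal (\<bar>fst (fst y)\<bar> * f' y * g' y) \<le> F y * G y"
      proof (rule AE_mp, intro AE_I2 impI)
        fix y assume y: "y \<in> space N" and fin: "F y \<noteq> \<infinity>"
        have "fst y \<in> fan CARD('n)"
          using y by (auto simp: N_def fan_measure_def space_pair_measure space_nu2)
        then have u0: "0 \<le> u y" using assms(5)[of "fst y" "snd y"] by simp
        have nn: "0 \<le> f' y" "0 \<le> g' y" by (simp_all add: f'_def g'_def)
        show "ennreal (\<bar>fst (fst y)\<bar> * f' y * g' y) \<le> F y * G y"
        proof (cases "u y = 0")
          case True
          \<comment> \<open>Here \<open>F y * G y = 0\<close> by convention, so the finiteness of \<open>F y\<close> has to make the left-hand side vanish.\<close>
          have "ennreal \<bar>fst (fst y)\<bar> * ennreal (f' y) = 0"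
          proof (rule ccontr)
            assume "ennreal \<bar>fst (fst y)\<bar> * ennreal (f' y) \<noteq> 0"
            then have "F y = \<infinity>" using True by (simp add: F_def ennreal_mult_eq_top_iff)
            with fin show False by simp
          qed
          then have z: "\<bar>fst (fst y)\<bar> * f' y = 0"
            using nn by (simp add: ennreal_mult[symmetric] ennreal_eq_0_iff) (metis abs_ge_zero antisym mult_nonneg_nonneg mult_eq_0_iff abs_eq_0)
          show ?thesis unfolding z by simp
        next
          case False
          then have u: "0 < u y" using u0 by simp
          have "F y * G y = (ennreal \<bar>fst (fst y)\<bar> * ennreal (f' y) * ennreal (g' y)) * (inverse (ennreal (u y)) * ennreal (u y))"
            by (simp add: F_def G_def mult_ac)
          also have "inverse (ennreal (u y)) * ennreal (u y) = 1"
            using u by (simp add: inverse_ennreal ennreal_mult[symmetric])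
          finally show ?thesis using nn by (simp add: ennreal_mult)
        qed
      qed
    qed
    also have "(\<integral>\<^sup>+y. F y * G y \<partial>N) \<le> Lp_norm N q' F * Lp_norm N q G"
      by (rule Lp_norm_Hoelder[OF Fm Gm \<open>1 \<le> q\<close> \<open>1 / q + 1 / q' = 1\<close>])
    also have "\<dots> \<le> A * (ennreal C0 * B)"
      unfolding AF[symmetric] by (rule mult_left_mono[OF GB]) simp
    \<comment> \<open>For negative \<open>C0\<close> both sides are 0, because
      \<open>ennreal\<close> sends negative numbers to 0.\<close>
    also have "2 * (A * (ennreal C0 * B)) = ennreal (2 * C0) * A * B"
      by (cases "C0 \<ge> 0") (simp_all add: ennreal_mult ennreal_neg mult_ac)
    also have "\<dots> \<le> ennreal C * A * B"
      by (intro mult_right_mono ennreal_leI) (simp_all add: C_def)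
    finally show ?thesis by (simp add: mult_left_mono)
  qed
  then show ?thesis unfolding Let_def by blast
qed

end
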